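(* Let $\Omega$ be any open set in $\mathbb R^n$, $n\geq2$. Assume that $\mu$ is a Borel measure in $\Omega$ such that $\mu(B_r(x)\cap\Omega)\leq C_\mu r^\alpha$ for $x\in\Omega$ and $r>0$, for some exponent $\alpha\in(n-1,n]$ and some constant $C_\mu>0$. Let $X(\Omega)$, $Y(\Omega,\mu)$ and $Z(\partial\Omega)$ be rearrangement-invariant spaces such that $$\left\|s^{-\frac{n-1}{\alpha}}\int_0^{s^{\frac n\alpha}}\varphi(r)\,dr\right\|_{\overline Y(0,\infty)}\leq C\|\varphi\|_{\overline X(0,\infty)},$$ $$\left\|\int_{s^{\frac n\alpha}}^\infty r^{-\frac{n-1}{n}}\varphi(r)\,dr\right\|_{\overline Y(0,\infty)}\leq C\|\varphi\|_{\overline X(0,\infty)},$$ $$\left\|s^{-\frac{n-1}{\alpha}}\int_0^{s^{\frac{n-1}{\alpha}}}\varphi(r)\,dr\right\|_{\overline Y(0,\infty)}\leq C\|\varphi\|_{\overline Z(0,\infty)},$$ for some constant $C$ and for every non-increasing function $\varphi:[0,\infty)\to[0,\infty)$. Then there exists a constant $C'=C'(n,\alpha,C_\mu,C)$ such that $$\|\mathbf u\|_{Y(\Omega,\mu)}\leq C'\Big(\|\mathcal E\mathbf u\|_{X(\Omega)}+\|\mathbf u\|_{Z(\partial\Omega)}\Big)$$ for every function $\mathbf u\in E^1X(\Omega)\cap C_b(\overline\Omega)$.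
   Context: Functions $\mathbf u$ are $\mathbb R^n$-valued. $\mathcal E\mathbf u=\tfrac12(\nabla\mathbf u+(\nabla\mathbf u)^T)$ is the symmetric part of the distributional gradient. For a Banach function space $X(\Omega)$, $E^1X(\Omega)=\{\mathbf u\in L^1_{\rm loc}(\Omega):|\mathcal E\mathbf u|\in X(\Omega)\}$. $C_b(\overline\Omega)$ is the set of functions that are continuous in $\overline\Omega$ and have bounded support. $B_r(x)$ is the ball centered at $x$ with radius $r$. For a measure space $\mathcal R$ with a $\sigma$-finite, non-atomic measure $\nu$ and a $\nu$-measurable $\phi$, the decreasing rearrangement is $\phi^*_\nu(s)=\inf\{t\geq0:\nu(\{|\phi|>t\})\leq s\}$, $s\ge 0$. A rearrangement-invariant space $X(\mathcal R)$ is a Banach function space (in the sense of Luxemburg) whose norm satisfies $\|\phi\|_{X(\mathcal R)}=\|\psi\|_{X(\mathcal R)}$ whenever $\phi^*_\nu=\psi^*_\nu$. It admits a representation space $\overline X(0,\infty)$, i.e. a rearrangement-invariant space on $(0,\infty)$ (with Lebesgue measure) such that $\|\phi\|_{X(\mathcal R)}=\|\phi^*_\nu\|_{\overline X(0,\infty)}$ for every $\phi\in X(\mathcal R)$. $X(\Omega)$ is taken with respect to Lebesgue measure, $Y(\Omega,\mu)$ with respect to $\mu$, and $Z(\partial\Omega)$ with respect to the $(n-1)$-dimensional Hausdorff measure $\mathcal H^{n-1}$ on $\partial\Omega$; $\|\mathbf u\|_{Z(\partial\Omega)}$ is the norm of the restriction of $|\mathbf u|$ to $\partial\Omega$. Norms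 of vector- or matrix-valued functions are norms of their moduli. *)

theory Defs
  imports "HOL-Analysis.Analysis"
begin

text \<open>A Banach function space is represented by its function norm, defined on the
  measurable functions with values in $[0,\infty]$ and with values in $[0,\infty]$; the space
  consists of the functions whose modulus has finite norm. The clauses are Luxemburg's axioms
  (positivity, homogeneity, triangle inequality, lattice property, Fatou property, local
  finiteness, local integrability).\<close>

definition banach_function_norm :: "'a measure \<Rightarrow> (('a \<Rightarrow> ennreal) \<Rightarrow> ennreal) \<Rightarrow> bool" where
  "banach_function_norm M \<rho> \<longleftrightarrow>
     (\<forall>f\<in>borel_measurable M. \<rho> f = 0 \<longleftrightarrow> (AE x in M. f x = 0)) \<and>
     (\<forall>f\<in>borel_measurable M. \<forall>c::real. c \<ge> 0 \<longrightarrow> \<rho> (\<lambda>x. ennreal c * f x) = ennreal c * \<rho> f) \<and>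
     (\<forall>f\<in>borel_measurable M. \<forall>g\<in>borel_measurable M. \<rho> (\<lambda>x. f x + g x) \<le> \<rho> f + \<rho> g) \<and>
     (\<forall>f\<in>borel_measurable M. \<forall>g\<in>borel_measurable M.
        (AE x in M. f x \<le> g x) \<longrightarrow> \<rho> f \<le> \<rho> g) \<and>
     (\<forall>F f. (\<forall>i::nat. F i \<in> borel_measurable M) \<longrightarrow> f \<in> borel_measurable M \<longrightarrow>
        (AE x in M. incseq (\<lambda>i. F i x) \<and> f x = (SUP i. F i x)) \<longrightarrow> \<rho> f = (SUP i. \<rho> (F i))) \<and>
     (\<forall>E\<in>sets M. emeasure M E < \<infinity> \<longrightarrow> \<rho> (indicator E) < \<infinity>) \<and>
     (\<forall>E\<in>sets M. emeasure M E < \<infinity> \<longrightarrow>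
        (\<exists>K::real. \<forall>f\<in>borel_measurable M. (\<integral>\<^sup>+x\<in>E. f x \<partial>M) \<le> ennreal K * \<rho> f))"

text \<open>Here $t$ ranges over $[0,\infty]$; since $t=\infty$ is always admissible, the infimum is the
  same as over $[0,\infty)$ with the convention that the infimum of the empty set is $\infty$.\<close>

definition decreasing_rearrangement :: "'a measure \<Rightarrow> ('a \<Rightarrow> ennreal) \<Rightarrow> real \<Rightarrow> ennreal" where
  "decreasing_rearrangement M f s = Inf {t. emeasure M {x \<in> space M. t < f x} \<le> ennreal s}"

text \<open>No $\sigma$-finiteness is required of the measure: the Hausdorff measure on the boundary of
  an arbitrary open set need not be $\sigma$-finite.\<close>

definition ri_norm :: "'a measure \<Rightarrow> (('a \<Rightarrow> ennreal) \<Rightarrow> ennreal) \<Rightarrow> bool" where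
  "ri_norm M \<rho> \<longleftrightarrow> banach_function_norm M \<rho> \<and>
     (\<forall>f\<in>borel_measurable M. \<forall>g\<in>borel_measurable M.
        (\<forall>s\<ge>0. decreasing_rearrangement M f s = decreasing_rearrangement M g s) \<longrightarrow> \<rho> f = \<rho> g)"

text \<open>The representation is not unique when the measure is finite; the relation holds for each of
  them.\<close>

definition representation_norm ::
    "'a measure \<Rightarrow> (('a \<Rightarrow> ennreal) \<Rightarrow> ennreal) \<Rightarrow> ((real \<Rightarrow> ennreal) \<Rightarrow> ennreal) \<Rightarrow> bool" where
  "representation_norm M \<rho> \<rho>' \<longleftrightarrow> ri_norm (lebesgue_on {0<..}) \<rho>' \<and>
     (\<forall>f\<in>borel_measurable M. \<rho> f < \<infinity> \<longrightarrow> \<rho> f = \<rho>' (decreasing_rearrangement M f))"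

text \<open>The normalisation makes the $m$-dimensional measure agree with Lebesgue measure on
  $m$-dimensional planes. Covering sets are required to be bounded since \<^const>\<open>diameter\<close> is
  unspecified on unbounded sets.\<close>

definition hausdorff_gauge :: "nat \<Rightarrow> 'a::metric_space set \<Rightarrow> ennreal" where
  "hausdorff_gauge m E =
     (if E = {} then 0 else ennreal (unit_ball_vol (real m) * (diameter E / 2) ^ m))"

definition hausdorff_pre :: "nat \<Rightarrow> real \<Rightarrow> 'a::metric_space set \<Rightarrow> ennreal" where
  "hausdorff_pre m \<delta> A =
     (INF E\<in>{E::nat \<Rightarrow> 'a set. A \<subseteq> (\<Union>i. E i) \<and> (\<forall>i. bounded (E i) \<and> diameter (E i) \<le> \<delta>)}.
        \<Sum>i. hausdorff_gauge m (E i))"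

definition hausdorff_outer :: "nat \<Rightarrow> 'a::metric_space set \<Rightarrow> ennreal" where
  "hausdorff_outer m A = (SUP \<delta>\<in>{0<..}. hausdorff_pre m \<delta> A)"

definition hausdorff_measure :: "nat \<Rightarrow> 'a::metric_space measure" where
  "hausdorff_measure m = measure_of UNIV (sets borel) (hausdorff_outer m)"

text \<open>\<^const>\<open>measure_of\<close> silently yields the zero measure unless it is given a measure, so we
  check, by Caratheodory's criterion, that the Hausdorff outer measure is one on the Borel sets.\<close>

lemma hausdorff_pre_antimono:
  assumes "\<delta> \<le> \<epsilon>"
  shows "hausdorff_pre m \<epsilon> A \<le> hausdorff_pre m \<delta> A"
  unfolding hausdorff_pre_def using assms by (intro INF_superset_mono) (auto intro: order_trans)

lemma hausdorff_pre_mono: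
  assumes "A \<subseteq> B"
  shows "hausdorff_pre m \<delta> A \<le> hausdorff_pre m \<delta> B"
  unfolding hausdorff_pre_def using assms by (intro INF_superset_mono) auto

lemma hausdorff_pre_subadditive:
  fixes A :: "nat \<Rightarrow> 'a::metric_space set"
  shows "hausdorff_pre m \<delta> (\<Union>i. A i) \<le> (\<Sum>n. hausdorff_pre m \<delta> (A n))"
proof (rule ennreal_le_epsilon)
  let ?O = "hausdorff_pre m \<delta> :: 'a set \<Rightarrow> ennreal"
  fix e :: real
  assume "0 < e" "(\<Sum>n. ?O (A n)) < top"
  then have *: "\<And>n. ?O (A n) < ?O (A n) + e * (1/2)^Suc n"
    by (auto simp add: less_top dest!: ennreal_suminf_lessD)
  have "\<exists>B. A n \<subseteq> (\<Union>i. B i) \<and> (\<forall>i. bounded (B i) \<and> diameter (B i) \<le> \<delta>) \<and>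
          (\<Sum>i. hausdorff_gauge m (B i)) \<le> ?O (A n) + e * (1/2)^(Suc n)" for n
    using *[of n] unfolding hausdorff_pre_def INF_less_iff by (auto intro: less_imp_le)
  then obtain B
    where B: "\<And>n i. bounded (B n i) \<and> diameter (B n i) \<le> \<delta>"
      and sbB: "\<And>n. A n \<subseteq> (\<Union>i. B n i)"
      and Ble: "\<And>n. (\<Sum>i. hausdorff_gauge m (B n i)) \<le> ?O (A n) + e * (1/2)^(Suc n)"
    by metis
  define C where "C = case_prod B o prod_decode"
  have C: "bounded (C i) \<and> diameter (C i) \<le> \<delta>" for i
    using B by (auto simp: C_def split_def)
  have A_C: "(\<Union>i. A i) \<subseteq> (\<Union>i. C i)"
    using sbB by (auto simp add: C_def subset_eq) (metis prod.case prod_encode_inverse)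
  have "?O (\<Union>i. A i) \<le> (\<Sum>i. hausdorff_gauge m (C i))"
    unfolding hausdorff_pre_def using A_C C by (intro INF_lower) auto
  also have "\<dots> = (\<Sum>n. \<Sum>i. hausdorff_gauge m (B n i))"
    unfolding C_def comp_def by (intro suminf_ennreal_2dimen) auto
  also have "\<dots> \<le> (\<Sum>n. ?O (A n) + e * (1/2) ^ Suc n)"
    by (intro suminf_le suminf_nonneg allI Ble) auto
  also have "... = (\<Sum>n. ?O (A n)) + (\<Sum>n. ennreal e * ennreal ((1/2) ^ Suc n))"
    using \<open>0 < e\<close> by (subst suminf_add[symmetric])
                     (auto simp del: ennreal_suminf_cmult simp add: ennreal_mult[symmetric])
  also have "\<dots> = (\<Sum>n. ?O (A n)) + e"
    unfolding ennreal_suminf_cmult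
    by (subst suminf_ennreal_eq[OF zero_le_power power_half_series]) auto
  finally show "?O (\<Union>i. A i) \<le> (\<Sum>n. ?O (A n)) + e" .
qed

lemma hausdorff_pre_separated:
  assumes d: "\<And>x y. x \<in> A \<Longrightarrow> y \<in> B \<Longrightarrow> \<delta> < dist x y"
  shows "hausdorff_pre m \<delta> A + hausdorff_pre m \<delta> B \<le> hausdorff_pre m \<delta> (A \<union> B)"
proof -
  have "hausdorff_pre m \<delta> A + hausdorff_pre m \<delta> B \<le> (\<Sum>i. hausdorff_gauge m (E i))"
    if cov: "A \<union> B \<subseteq> (\<Union>i. E i)" and E: "\<And>i::nat. bounded (E i) \<and> diameter (E i) \<le> \<delta>" for E
  proof -
    have \<delta>: "0 \<le> \<delta>" using E[of 0] diameter_ge_0[of "E 0"] by linarith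
    define EA where "EA i = (if E i \<inter> A = {} then {} else E i)" for i
    define EB where "EB i = (if E i \<inter> B = {} then {} else E i)" for i
    have disj: "E i \<inter> A = {} \<or> E i \<inter> B = {}" for i
    proof (rule ccontr)
      assume "\<not> ?thesis"
      then obtain x y where "x \<in> A" "y \<in> B" "x \<in> E i" "y \<in> E i" by auto
      with d[of x y] E[of i] diameter_bounded_bound[of "E i" x y] show False by simp
    qed
    have "A \<subseteq> (\<Union>i. EA i)" "B \<subseteq> (\<Union>i. EB i)"
      using cov unfolding EA_def EB_def by fastforce+
    then have "hausdorff_pre m \<delta> A \<le> (\<Sum>i. hausdorff_gauge m (EA i))"
      unfolding hausdorff_pre_def using E \<delta> by (intro INF_lower) (auto simp: EA_def)
    moreover from \<open>B \<subseteq> (\<Union>i. EB i)\<close> have "hausdorff_pre m \<delta> B \<le> (\<Sum>i. hausdorff_gauge m (EB i))"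
      unfolding hausdorff_pre_def using E \<delta> by (intro INF_lower) (auto simp: EB_def)
    ultimately have "hausdorff_pre m \<delta> A + hausdorff_pre m \<delta> B
        \<le> (\<Sum>i. hausdorff_gauge m (EA i)) + (\<Sum>i. hausdorff_gauge m (EB i))"
      by (rule add_mono)
    also have "\<dots> = (\<Sum>i. hausdorff_gauge m (EA i) + hausdorff_gauge m (EB i))"
      by (rule suminf_add) auto
    also have "\<dots> \<le> (\<Sum>i. hausdorff_gauge m (E i))"
    proof (rule suminf_le)
      show "hausdorff_gauge m (EA i) + hausdorff_gauge m (EB i) \<le> hausdorff_gauge m (E i)" for i
        using disj[of i] by (auto simp: EA_def EB_def hausdorff_gauge_def)
    qed auto
    finally show ?thesis .
  qed
  then show ?thesis
    by (subst (3) hausdorff_pre_def) (auto intro!: INF_greatest)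
qed

lemma hausdorff_outer_mono: "A \<subseteq> B \<Longrightarrow> hausdorff_outer m A \<le> hausdorff_outer m B"
  unfolding hausdorff_outer_def by (intro SUP_mono) (auto intro: hausdorff_pre_mono)

lemma hausdorff_outer_subadditive:
  "hausdorff_outer m (\<Union>i. A i) \<le> (\<Sum>n::nat. hausdorff_outer m (A n))"
proof -
  have "hausdorff_pre m \<delta> (\<Union>i. A i) \<le> (\<Sum>n. hausdorff_outer m (A n))" if "0 < \<delta>" for \<delta>
  proof -
    have "(\<Sum>n. hausdorff_pre m \<delta> (A n)) \<le> (\<Sum>n. hausdorff_outer m (A n))"
      using that unfolding hausdorff_outer_def by (intro suminf_le SUP_upper) auto
    with hausdorff_pre_subadditive[of m \<delta> A] show ?thesis by (rule order_trans)
  qed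
  then show ?thesis
    by (subst hausdorff_outer_def) (auto intro!: SUP_least)
qed

lemma hausdorff_outer_empty: "hausdorff_outer m ({}::'a::metric_space set) = 0"
proof -
  have "hausdorff_pre m \<delta> ({}::'a set) \<le> (\<Sum>i. hausdorff_gauge m ({}::'a set))" if "0 < \<delta>" for \<delta>
    unfolding hausdorff_pre_def using that by (intro INF_lower) auto
  then have "hausdorff_outer m ({}::'a set) \<le> 0"
    unfolding hausdorff_outer_def by (intro SUP_least) (auto simp: hausdorff_gauge_def)
  then show ?thesis by simp
qed

lemma hausdorff_outer_separated:
  assumes "0 < d" and d: "\<And>x y. x \<in> A \<Longrightarrow> y \<in> B \<Longrightarrow> d < dist x y"
  shows "hausdorff_outer m A + hausdorff_outer m B \<le> hausdorff_outer m (A \<union> B)"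
proof -
  have lim: "((\<lambda>k. hausdorff_pre m (d / real (Suc k)) A) \<longlonglongrightarrow> hausdorff_outer m A)" for A
  proof -
    have "(SUP k. hausdorff_pre m (d / real (Suc k)) A) = hausdorff_outer m A"
    proof (rule antisym)
      show "(SUP k. hausdorff_pre m (d / real (Suc k)) A) \<le> hausdorff_outer m A"
        unfolding hausdorff_outer_def using \<open>0 < d\<close> by (intro SUP_subset_mono SUP_mono) 
          (auto intro!: bexI)
      show "hausdorff_outer m A \<le> (SUP k. hausdorff_pre m (d / real (Suc k)) A)"
        unfolding hausdorff_outer_def
      proof (intro SUP_mono)
        fix \<delta> :: real assume "\<delta> \<in> {0<..}"
        then obtain k where "inverse (real (Suc k)) < \<delta> / d"
          using reals_Archimedean[of "\<delta> / d"] \<open>0 < d\<close> by auto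
        then have "d / real (Suc k) \<le> \<delta>"
          using \<open>0 < d\<close> by (simp add: field_simps)
        then show "\<exists>k\<in>UNIV. hausdorff_pre m \<delta> A \<le> hausdorff_pre m (d / real (Suc k)) A"
          by (auto intro!: hausdorff_pre_antimono)
      qed
    qed
    moreover have "incseq (\<lambda>k. hausdorff_pre m (d / real (Suc k)) A)"
      using \<open>0 < d\<close> by (intro monoI hausdorff_pre_antimono divide_left_mono) auto
    ultimately show ?thesis
      using LIMSEQ_SUP by metis
  qed
  show ?thesis
  proof (rule LIMSEQ_le[OF tendsto_add[OF lim lim] lim], intro exI allI impI)
    fix k
    have "d / real (Suc k) \<le> d" using \<open>0 < d\<close> by (simp add: field_simps)
    then show "hausdorff_pre m (d / real (Suc k)) A + hausdorff_pre m (d / real (Suc k)) B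
        \<le> hausdorff_pre m (d / real (Suc k)) (A \<union> B)"
      using d by (intro hausdorff_pre_separated) (meson order_le_less_trans)
  qed
qed

lemma outer_measure_space_hausdorff: "outer_measure_space UNIV (hausdorff_outer m)"
  by (auto simp: outer_measure_space_def positive_def increasing_def countably_subadditive_def
      hausdorff_outer_empty hausdorff_outer_mono hausdorff_outer_subadditive)

lemma hausdorff_outer_closed:
  fixes A F :: "'a::metric_space set"
  assumes F: "closed F"
  shows "hausdorff_outer m (A \<inter> F) + hausdorff_outer m (A - F) \<le> hausdorff_outer m A"
proof (cases "F = {} \<or> hausdorff_outer m A = \<infinity>")
  case True
  then show ?thesis by (auto simp: hausdorff_outer_empty)
next
  case False
  let ?H = "hausdorff_outer m"
  define G where "G k = {x \<in> A. 1 / real (Suc k) \<le> infdist x F}" for k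
  define R where "R k = {x \<in> A. 1 / real (Suc (Suc k)) \<le> infdist x F \<and> infdist x F < 1 / real (Suc k)}"
    for k
  have sep: "?H (A \<inter> F) + ?H (G k) \<le> ?H A" for k
  proof -
    have "?H (A \<inter> F) + ?H (G k) \<le> ?H ((A \<inter> F) \<union> G k)"
    proof (rule hausdorff_outer_separated[where d = "1 / real (Suc k) / 2"])
      fix x y assume "x \<in> A \<inter> F" "y \<in> G k"
      then have "1 / real (Suc k) \<le> infdist y F" "infdist y F \<le> dist y x"
        by (auto simp: G_def intro: infdist_le)
      then have "1 / real (Suc k) \<le> dist x y"
        by (simp add: dist_commute)
      moreover have "e / 2 < c" if "e \<le> c" "0 < e" for e c :: real using that by linarith
      ultimately show "1 / real (Suc k) / 2 < dist x y"
        using zero_less_divide_1_iff[of "real (Suc k)"] of_nat_0_less_iff by blast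
    qed simp
    also have "\<dots> \<le> ?H A" by (rule hausdorff_outer_mono) (auto simp: G_def)
    finally show ?thesis .
  qed
  have sum_le: "(\<Sum>k<N. ?H (R (2 * k + p))) \<le> ?H (\<Union>k<N. R (2 * k + p))" for N p
  proof (induction N)
    case (Suc N)
    have "(\<Sum>k<Suc N. ?H (R (2 * k + p))) \<le> ?H (\<Union>k<N. R (2 * k + p)) + ?H (R (2 * N + p))"
      using Suc by (simp add: add_right_mono)
    also have "\<dots> \<le> ?H ((\<Union>k<N. R (2 * k + p)) \<union> R (2 * N + p))"
    proof (rule hausdorff_outer_separated)
      let ?d = "1 / real (2 * N + p) - 1 / real (Suc (2 * N + p))"
      let ?d = "if N = 0 then 1 else ?d / 2"
      show "0 < ?d"
        by (auto simp del: of_nat_Suc intro!: divide_strict_left_mono)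
      fix x y assume x: "x \<in> (\<Union>k<N. R (2 * k + p))" and y: "y \<in> R (2 * N + p)"
      from x obtain k where k: "k < N" "1 / real (Suc (Suc (2 * k + p))) \<le> infdist x F"
        by (auto simp: R_def)
      have "1 / real (2 * N + p) \<le> 1 / real (Suc (Suc (2 * k + p)))"
        using k(1) by (intro divide_left_mono) auto
      moreover have "infdist y F < 1 / real (Suc (2 * N + p))" using y by (auto simp: R_def)
      moreover have "infdist x F \<le> infdist y F + dist x y" by (rule infdist_triangle)
      moreover have "1 / real (Suc (2 * N + p)) < 1 / real (2 * N + p)"
        using k(1) by (intro divide_strict_left_mono) auto
      moreover have "N \<noteq> 0" using k by auto
      ultimately show "?d < dist x y"
        unfolding if_not_P[OF \<open>N \<noteq> 0\<close>] using k(2) by argo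
    qed
    also have "(\<Union>k<N. R (2 * k + p)) \<union> R (2 * N + p) = (\<Union>k<Suc N. R (2 * k + p))"
      by (auto simp: lessThan_Suc)
    finally show ?case .
  qed simp
  have fin: "(\<Sum>k. ?H (R (2 * k + p))) \<noteq> \<infinity>" for p
  proof -
    have "(\<Sum>k. ?H (R (2 * k + p))) \<le> ?H A"
    proof (rule suminf_le_const)
      show "(\<Sum>k<N. ?H (R (2 * k + p))) \<le> ?H A" for N
        by (rule order_trans[OF sum_le]) (auto simp: R_def intro!: hausdorff_outer_mono)
    qed simp
    then show ?thesis using False by (auto simp: top_unique)
  qed
  have tail_zero: "(\<lambda>N. \<Sum>k. f (k + N)) \<longlonglongrightarrow> 0"
    if "(\<Sum>k. f k) \<noteq> \<infinity>" for f :: "nat \<Rightarrow> ennreal"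
  proof -
    have "(\<Sum>k. f (k + N)) = (\<Sum>k. f k) - (\<Sum>k<N. f k)" for N
    proof -
      have "(\<Sum>k. f k) = (\<Sum>k. f (k + N)) + (\<Sum>k<N. f k)"
        by (intro suminf_offset) simp
      moreover from this that have "(\<Sum>k<N. f k) \<noteq> top" by (auto simp: top_unique)
      ultimately show ?thesis by simp
    qed
    moreover have "(\<lambda>N. (\<Sum>k. f k) - (\<Sum>k<N. f k)) \<longlonglongrightarrow> (\<Sum>k. f k) - (\<Sum>k. f k)"
      using that by (intro tendsto_diff_ennreal tendsto_const summable_LIMSEQ) auto
    ultimately show ?thesis using that by simp
  qed
  have tail: "(\<lambda>N. \<Sum>k. ?H (R (2 * (k + N) + p))) \<longlonglongrightarrow> 0" for p
    by (rule tail_zero[OF fin])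
  have bound: "?H (A \<inter> F) + ?H (A - F) \<le>
      ?H A + ((\<Sum>k. ?H (R (2 * (k + N) + 0))) + (\<Sum>k. ?H (R (2 * (k + N) + 1))))" for N
  proof -
    have "A - F \<subseteq> G (2 * N) \<union> (\<Union>k. R (2 * N + k))"
    proof
      fix x assume x: "x \<in> A - F"
      then have "0 < infdist x F"
        using F False infdist_pos_not_in_closed by auto
      then obtain j where "inverse (real (Suc j)) < infdist x F"
        using reals_Archimedean by blast
      then have ex: "\<exists>j. 1 / real (Suc j) \<le> infdist x F"
        by (auto simp: inverse_eq_divide intro: less_imp_le)
      define l where "l = (LEAST j. 1 / real (Suc j) \<le> infdist x F)"
      have l: "1 / real (Suc l) \<le> infdist x F"
        unfolding l_def using ex by (rule LeastI_ex)
      show "x \<in> G (2 * N) \<union> (\<Union>k. R (2 * N + k))"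
      proof (cases "l \<le> 2 * N")
        case True
        then have "1 / real (Suc (2 * N)) \<le> 1 / real (Suc l)"
          by (intro divide_left_mono) auto
        with l x show ?thesis by (auto simp: G_def)
      next
        case lN: False
        then obtain k where k: "l = Suc (2 * N + k)"
          by (metis add_Suc_right less_iff_Suc_add not_less)
        have "\<not> 1 / real (Suc (2 * N + k)) \<le> infdist x F"
          using not_less_Least[of "2 * N + k" "\<lambda>j. 1 / real (Suc j) \<le> infdist x F"] k
          unfolding l_def by auto
        then have "x \<in> R (2 * N + k)"
          using l x k unfolding R_def by (auto simp: not_le)
        then show ?thesis by auto
      qed
    qed
    also have "(\<Union>k. R (2 * N + k)) = (\<Union>k. R (2 * (k + N) + 0)) \<union> (\<Union>k. R (2 * (k + N) + 1))"
    proof -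
      have "k = 2 * (k div 2) + 0 \<or> k = 2 * (k div 2) + 1" for k :: nat
        by presburger
      then have "2 * N + k = 2 * (k div 2 + N) + 0 \<or> 2 * N + k = 2 * (k div 2 + N) + 1" for k
        by presburger
      then have *: "R (2 * N + k) = R (2 * (k div 2 + N) + 0) \<or> R (2 * N + k) = R (2 * (k div 2 + N) + 1)"
        for k by metis
      show ?thesis
      proof (rule set_eqI, rule iffI)
        fix x assume "x \<in> (\<Union>k. R (2 * N + k))"
        then obtain k where "x \<in> R (2 * N + k)" by (rule UN_E)
        with *[of k] consider "x \<in> R (2 * (k div 2 + N) + 0)" | "x \<in> R (2 * (k div 2 + N) + 1)"
          by metis
        then show "x \<in> (\<Union>k. R (2 * (k + N) + 0)) \<union> (\<Union>k. R (2 * (k + N) + 1))"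
          by cases (rule UnI1, rule UN_I[OF UNIV_I], assumption,
            rule UnI2, rule UN_I[OF UNIV_I], assumption)
      next
        fix x assume "x \<in> (\<Union>k. R (2 * (k + N) + 0)) \<union> (\<Union>k. R (2 * (k + N) + 1))"
        moreover have "x \<in> (\<Union>k. R (2 * N + k))" if "x \<in> R (2 * (k + N) + p)" for k p
        proof -
          have "2 * (k + N) + p = 2 * N + (2 * k + p)" by simp
          then have "x \<in> R (2 * N + (2 * k + p))" using that by argo
          then show ?thesis by (rule UN_I[OF UNIV_I])
        qed
        ultimately show "x \<in> (\<Union>k. R (2 * N + k))" by (elim UnE UN_E)
      qed
    qed
    finally have sub: "A - F \<subseteq> G (2 * N) \<union> ((\<Union>k. R (2 * (k + N) + 0)) \<union> (\<Union>k. R (2 * (k + N) + 1)))" .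
    have Un: "?H (P \<union> Q) \<le> ?H P + ?H Q" for P Q :: "'a set"
      using hausdorff_outer_subadditive[of m "binaryset P Q"]
      by (simp add: UN_binaryset_eq suminf_binaryset_eq hausdorff_outer_empty)
    have "?H (A - F) \<le> ?H (G (2 * N)) +
        (?H (\<Union>k. R (2 * (k + N) + 0)) + ?H (\<Union>k. R (2 * (k + N) + 1)))"
      by (intro order_trans[OF hausdorff_outer_mono[OF sub]] order_trans[OF Un] add_left_mono Un)
    also have "\<dots> \<le> ?H (G (2 * N)) +
        ((\<Sum>k. ?H (R (2 * (k + N) + 0))) + (\<Sum>k. ?H (R (2 * (k + N) + 1))))"
      by (intro add_left_mono add_mono hausdorff_outer_subadditive)
    finally have "?H (A \<inter> F) + ?H (A - F) \<le> ?H (A \<inter> F) + (?H (G (2 * N)) +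
        ((\<Sum>k. ?H (R (2 * (k + N) + 0))) + (\<Sum>k. ?H (R (2 * (k + N) + 1)))))"
      by (rule add_left_mono)
    also have "\<dots> \<le> ?H A + ((\<Sum>k. ?H (R (2 * (k + N) + 0))) + (\<Sum>k. ?H (R (2 * (k + N) + 1))))"
      unfolding add.assoc[symmetric] by (intro add_right_mono sep)
    finally show ?thesis .
  qed
  have "(\<lambda>N. ?H A + ((\<Sum>k. ?H (R (2 * (k + N) + 0))) + (\<Sum>k. ?H (R (2 * (k + N) + 1)))))
      \<longlonglongrightarrow> ?H A + (0 + 0)"
    by (intro tendsto_add tendsto_const tail)
  then have "?H (A \<inter> F) + ?H (A - F) \<le> ?H A + (0 + 0)"
    by (rule LIMSEQ_le_const) (intro exI allI impI bound)
  then show ?thesis by simp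
qed

lemma measure_space_hausdorff:
  "measure_space (UNIV :: 'a::metric_space set) (sets borel) (hausdorff_outer m)"
proof -
  let ?L = "lambda_system UNIV UNIV (hausdorff_outer m :: 'a set \<Rightarrow> ennreal)"
  have ms: "measure_space UNIV ?L (hausdorff_outer m)"
    using sigma_algebra.caratheodory_lemma[OF sigma_algebra_Pow[of UNIV],
        of "hausdorff_outer m :: 'a set \<Rightarrow> ennreal"]
      outer_measure_space_hausdorff[of m] by simp
  then interpret L: sigma_algebra UNIV ?L
    by (simp add: measure_space_def)
  have "F \<in> ?L" if "closed F" for F :: "'a set"
  proof -
    have "hausdorff_outer m (F \<inter> A) + hausdorff_outer m ((UNIV - F) \<inter> A) = hausdorff_outer m A"
      for A
    proof (rule antisym)
      show "hausdorff_outer m (F \<inter> A) + hausdorff_outer m ((UNIV - F) \<inter> A) \<le> hausdorff_outer m A"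
        using hausdorff_outer_closed[OF that, of m A] by (simp add: Int_commute Diff_eq)
      have "hausdorff_outer m (\<Union>i. binaryset (F \<inter> A) ((UNIV - F) \<inter> A) i)
          \<le> hausdorff_outer m (F \<inter> A) + hausdorff_outer m ((UNIV - F) \<inter> A)"
        using hausdorff_outer_subadditive[of m "binaryset (F \<inter> A) ((UNIV - F) \<inter> A)"]
        by (simp add: suminf_binaryset_eq hausdorff_outer_empty)
      moreover have "(\<Union>i. binaryset (F \<inter> A) ((UNIV - F) \<inter> A) i) = A"
        by (auto simp: UN_binaryset_eq)
      ultimately show
          "hausdorff_outer m A \<le> hausdorff_outer m (F \<inter> A) + hausdorff_outer m ((UNIV - F) \<inter> A)"
        by simp
    qed
    then show ?thesis by (simp add: lambda_system_def)
  qed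
  then have "sigma_sets UNIV (Collect closed) \<subseteq> ?L"
    by (intro L.sigma_sets_subset) auto
  then have "sets borel \<subseteq> ?L"
    by (simp add: borel_eq_closed)
  then show ?thesis
    using ms sets.sigma_algebra_axioms[of "borel :: 'a measure"]
    unfolding measure_space_def by (auto simp: countably_additive_def positive_def)
qed

lemma space_hausdorff_measure [simp]: "space (hausdorff_measure m) = UNIV"
  by (simp add: hausdorff_measure_def)

lemma sets_hausdorff_measure [simp, measurable_cong]: 
  "sets (hausdorff_measure m :: 'a::metric_space measure) = sets borel"
  unfolding hausdorff_measure_def
  using sigma_algebra.sets_measure_of_eq[OF sets.sigma_algebra_axioms[of "borel :: 'a measure"]]
  by (simp only: space_borel)

lemma emeasure_hausdorff_measure:
  "A \<in> sets borel \<Longrightarrow> emeasure (hausdorff_measure m) A = hausdorff_outer m A"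
  unfolding hausdorff_measure_def using measure_space_hausdorff[of m]
  by (intro emeasure_measure_of_sigma) (auto simp: measure_space_def)

definition partial_deriv :: "'n \<Rightarrow> (real^'n \<Rightarrow> real) \<Rightarrow> real^'n \<Rightarrow> real" where
  "partial_deriv i f x = frechet_derivative f (at x) (axis i 1)"

fun differentiable_times :: "nat \<Rightarrow> (real^'n \<Rightarrow> real) \<Rightarrow> bool" where
  "differentiable_times 0 f \<longleftrightarrow> True"
| "differentiable_times (Suc k) f \<longleftrightarrow>
     f differentiable_on UNIV \<and> (\<forall>i. differentiable_times k (partial_deriv i f))"

text \<open>Being differentiable any number of times is being smooth.\<close>

definition test_functions :: "(real^'n) set \<Rightarrow> (real^'n \<Rightarrow> real) set" where
  "test_functions \<Omega> = {\<phi>. (\<forall>k. differentiable_times k \<phi>) \<and>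
     compact (closure {x. \<phi> x \<noteq> 0}) \<and> closure {x. \<phi> x \<noteq> 0} \<subseteq> \<Omega>}"

definition locally_integrable :: "(real^'n) set \<Rightarrow> (real^'n \<Rightarrow> 'b::euclidean_space) \<Rightarrow> bool" where
  "locally_integrable \<Omega> f \<longleftrightarrow> (\<forall>K. compact K \<and> K \<subseteq> \<Omega> \<longrightarrow> f absolutely_integrable_on K)"

definition distr_deriv ::
    "(real^'n) set \<Rightarrow> 'n \<Rightarrow> (real^'n \<Rightarrow> real) \<Rightarrow> (real^'n \<Rightarrow> real) \<Rightarrow> real" where
  "distr_deriv \<Omega> i f \<phi> = - (LINT x:\<Omega>|lebesgue. f x * partial_deriv i \<phi> x)"

definition has_sym_grad ::
    "(real^'n) set \<Rightarrow> (real^'n \<Rightarrow> real^'n) \<Rightarrow> (real^'n \<Rightarrow> real^'n^'n) \<Rightarrow> bool" where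
  "has_sym_grad \<Omega> u G \<longleftrightarrow> locally_integrable \<Omega> G \<and>
     (\<forall>\<phi>\<in>test_functions \<Omega>. \<forall>i j.
        (LINT x:\<Omega>|lebesgue. G x $ i $ j * \<phi> x) =
          (distr_deriv \<Omega> j (\<lambda>x. u x $ i) \<phi> + distr_deriv \<Omega> i (\<lambda>x. u x $ j) \<phi>) / 2)"

text \<open>The symmetric gradient is determined up to null subsets of $\Omega$. Its modulus is the
  norm of type \<^typ>\<open>real^'n^'n\<close>, which is the Frobenius norm.\<close>

definition sym_grad :: "(real^'n) set \<Rightarrow> (real^'n \<Rightarrow> real^'n) \<Rightarrow> real^'n \<Rightarrow> real^'n^'n" where
  "sym_grad \<Omega> u = (SOME G. has_sym_grad \<Omega> u G)"

definition E1 ::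
    "(real^'n) set \<Rightarrow> ((real^'n \<Rightarrow> ennreal) \<Rightarrow> ennreal) \<Rightarrow> (real^'n \<Rightarrow> real^'n) set" where
  "E1 \<Omega> \<rho> = {u. locally_integrable \<Omega> u \<and> (\<exists>G. has_sym_grad \<Omega> u G) \<and>
     \<rho> (\<lambda>x. ennreal (norm (sym_grad \<Omega> u x))) < \<infinity>}"

definition Cb_closure :: "(real^'n) set \<Rightarrow> (real^'n \<Rightarrow> real^'n) set" where
  "Cb_closure \<Omega> = {u. continuous_on (closure \<Omega>) u \<and> bounded {x \<in> closure \<Omega>. u x \<noteq> 0}}"

end

theory Submission
  imports Defs
begin

text \<open>Along a ray $t \mapsto x + tv$ the derivative of $u \cdot v$ is $v \cdot (\mathcal{E}u) v$. Follow
  the ray from $x \in \Omega$ until it meets $\partial\Omega$ or leaves the support of $u$, and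
  average over the directions $v$ in a ball on which $u(x) \cdot v \geq |u(x)|$. This bounds $|u(x)|$ by
  the Riesz potential $\int_\Omega |\mathcal{E}u(y)| |x-y|^{1-n} dy$ plus any level $\tau$ such that at
  least half of the directions avoid the boundary set $E = \{|u| > \tau\}$. Averaging over $v$ in a
  Lebesgue ball instead of the unit sphere avoids polar coordinates.

  Covering $E$ by small balls of radii $r_i$ centred at $y_i$, the directions which hit $E$ have
  measure at most a constant times $\sum_i (r_i/|x-y_i|)^{n-1}$. The growth condition on $\mu$ makes the
  kernel $|x-y|^{1-n}$ of weak type $\alpha/(n-1)$ with respect to $\mu$, so that for
  $\mathcal{H}^{n-1}(E)$ small against $s^{(n-1)/\alpha}$ the points from which too many directions hit
  $E$ have $\mu$-measure at most $s/2$. Splitting $|\mathcal{E}u|$ at the level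
  $|\mathcal{E}u|^*(s^{n/\alpha})$, the part above the level is handled by the same weak type bound, and
  the part below it by the bound of the potential from $L^{n,1}$ to $L^\infty$. Altogether $u^*_\mu(s)$
  is at most a constant times the sum of the three operators of the hypotheses, applied to
  $|\mathcal{E}u|^*$ and to the rearrangement of $|u|$ on $\partial\Omega$.\<close>

section \<open>Smooth bump functions\<close>

text \<open>The symmetric gradient exists only as a distribution, and u need not be differentiable
  along a given ray. The identity along the ray is therefore tested with mollifiers whose centre
  travels along a segment, which requires a tube of fixed radius around the whole segment inside
  \<Omega>. The admissible radius depends on the direction; \<open>good_directions\<close> makes it
  uniform on a set of directions of definite measure, and only then is the scale \<epsilon> chosen.
  The scale is never sent to 0: averaging |x-y|^(1-n) over a ball centred at y costs only a constant
  factor of its value at y, so the mollified potential is dominated by the potential itself,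
  uniformly in \<epsilon>.

  Weak type bounds are always derived from bounds on integrals over sets of given measure, because
  those add up over the countable cover of E and over the integral against the part of |Eu| above
  its level.

  The mollifiers are products of one-dimensional bumps so that their partial derivatives of all
  orders lie in one explicit family, as the recursive definition of test functions demands.\<close>

fun differentiable_real :: "nat \<Rightarrow> (real \<Rightarrow> real) \<Rightarrow> bool" where
  "differentiable_real 0 f \<longleftrightarrow> True"
| "differentiable_real (Suc k) f \<longleftrightarrow>
     (\<exists>f'. (\<forall>t. (f has_real_derivative f' t) (at t)) \<and> differentiable_real k f')"

lemma differentiable_real_Suc_D: "differentiable_real (Suc k) f \<Longrightarrow> differentiable_real k f"
proof (induction k arbitrary: f)
  case (Suc k)
  then obtain f' where "\<forall>t. (f has_real_derivative f' t) (at t)" "differentiable_real (Suc k) f'"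
    by (auto simp only: differentiable_real.simps(2)[of "Suc k"])
  with Suc.IH[of f'] show ?case by (auto simp only: differentiable_real.simps)
qed simp

lemma differentiable_real_add:
  "differentiable_real k f \<Longrightarrow> differentiable_real k g \<Longrightarrow> differentiable_real k (\<lambda>t. f t + g t)"
proof (induction k arbitrary: f g)
  case (Suc k)
  from Suc.prems obtain f' g' where "\<forall>t. (f has_real_derivative f' t) (at t)" "differentiable_real k f'"
    "\<forall>t. (g has_real_derivative g' t) (at t)" "differentiable_real k g'" by auto
  with Suc.IH[of f' g'] show ?case
    by (auto intro!: exI[of _ "\<lambda>t. f' t + g' t"] DERIV_add)
qed simp

lemma differentiable_real_mult:
  "differentiable_real k f \<Longrightarrow> differentiable_real k g \<Longrightarrow> differentiable_real k (\<lambda>t. f t * g t)"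
proof (induction k arbitrary: f g)
  case (Suc k)
  from Suc.prems obtain f' g' where fg: "\<forall>t. (f has_real_derivative f' t) (at t)" "differentiable_real k f'"
    "\<forall>t. (g has_real_derivative g' t) (at t)" "differentiable_real k g'" by auto
  have "differentiable_real k f" "differentiable_real k g"
    using Suc.prems[THEN differentiable_real_Suc_D] by auto
  with fg have "differentiable_real k (\<lambda>t. f' t * g t + g' t * f t)"
    by (intro differentiable_real_add Suc.IH)
  moreover have "\<forall>t. ((\<lambda>t. f t * g t) has_real_derivative f' t * g t + g' t * f t) (at t)"
    using fg by (auto intro!: DERIV_mult)
  ultimately show ?case by (auto simp only: differentiable_real.simps)
qed simp

lemma differentiable_real_affine:
  "differentiable_real k f \<Longrightarrow> differentiable_real k (\<lambda>t. f (a * t + b))"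
proof (induction k arbitrary: f)
  case (Suc k)
  from Suc.prems obtain f' where f': "\<forall>t. (f has_real_derivative f' t) (at t)" "differentiable_real k f'"
    by auto
  have const: "differentiable_real k (\<lambda>t. a)" for a
  proof (induction k arbitrary: a)
    case (Suc k) then show ?case by (auto intro!: exI[of _ "\<lambda>t. 0"])
  qed simp
  have "\<forall>t. ((\<lambda>t. f (a * t + b)) has_real_derivative f' (a * t + b) * a) (at t)"
    using f' by (auto intro!: DERIV_chain2[of f] derivative_eq_intros)
  moreover have "differentiable_real k (\<lambda>t. f' (a * t + b) * a)"
    using Suc.IH[of f'] f' by (intro differentiable_real_mult const) auto
  ultimately show ?case by (auto simp only: differentiable_real.simps)
qed simp

text \<open>The power of 1/t is carried along because differentiating a member of this family gives
  a combination of two others. All derivatives of exp(-1/t), extended by 0 to t <= 0, thus stay in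
  the linear span of the family, and smoothness is a plain induction.\<close>

definition flat_exp :: "nat \<Rightarrow> real \<Rightarrow> real" where
  "flat_exp k t = (if t > 0 then (1 / t) ^ k * exp (- (1 / t)) else 0)"

lemma flat_exp_tendsto_0: "(flat_exp k \<longlongrightarrow> 0) (at 0)"
proof -
  have "((\<lambda>t. (1 / t) ^ k * exp (- (1 / t))) \<longlongrightarrow> 0) (at_right (0::real))"
  proof -
    have "((\<lambda>t::real. inverse t ^ k / exp (inverse t)) \<longlongrightarrow> 0) (at_right 0)"
      by (rule filterlim_compose[OF tendsto_power_div_exp_0 filterlim_inverse_at_top_right])
    then show ?thesis
      by (simp add: exp_minus divide_inverse)
  qed
  then have "(flat_exp k \<longlongrightarrow> 0) (at_right 0)"
    by (rule Lim_transform_eventually)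
      (auto simp: eventually_at_filter flat_exp_def)
  moreover have "(flat_exp k \<longlongrightarrow> 0) (at_left 0)"
    by (rule Lim_transform_eventually[OF tendsto_const])
      (auto simp: eventually_at_filter flat_exp_def)
  ultimately show ?thesis
    by (simp add: filterlim_at_split)
qed

lemma flat_exp_has_derivative:
  "(flat_exp k has_real_derivative flat_exp (k + 2) t - real k * flat_exp (k + 1) t) (at t)"
proof -
  consider "t > 0" | "t < 0" | "t = 0" by linarith
  then show ?thesis
  proof cases
    case 1
    have "((\<lambda>t. (1 / t) ^ k * exp (- (1 / t))) has_real_derivative
        (1 / t) ^ (k + 2) * exp (- (1 / t)) - real k * ((1 / t) ^ (k + 1) * exp (- (1 / t)))) (at t)"
    proof -
      have 2: "((\<lambda>t. 1 / t) has_real_derivative (- ((1 / t) ^ 2))) (at t)"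
        using 1 by (auto intro!: derivative_eq_intros simp: power2_eq_square)
      have "(1 / t) ^ 2 * (1 / t) ^ (k - Suc 0) = (1 / t) ^ (k + 1)" if "k > 0"
        unfolding power_add[symmetric] using that by simp
      then have "real k * (- ((1 / t) ^ 2) * (1 / t) ^ (k - Suc 0)) = - real k * (1 / t) ^ (k + 1)"
        by (cases "k = 0") (simp_all add: algebra_simps)
      with DERIV_power[OF 2, of k] have "((\<lambda>t. (1 / t) ^ k) has_real_derivative - real k * (1 / t) ^ (k + 1)) (at t)"
        by simp
      from DERIV_mult[OF this DERIV_fun_exp[OF DERIV_minus[OF 2]]]
      show ?thesis by (rule DERIV_cong) (simp add: algebra_simps power2_eq_square)
    qed
    then have "(flat_exp k has_real_derivative
        (1 / t) ^ (k + 2) * exp (- (1 / t)) - real k * ((1 / t) ^ (k + 1) * exp (- (1 / t)))) (at t)"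
      by (rule has_field_derivative_transform_within_open[of _ _ _ "{0<..}"])
        (use 1 in \<open>auto simp: flat_exp_def\<close>)
    then show ?thesis using 1 by (simp add: flat_exp_def)
  next
    case 2
    have "(flat_exp k has_real_derivative 0) (at t)"
      by (rule has_field_derivative_transform_within_open[of "\<lambda>t. 0" _ _ "{..<0}"])
        (use 2 in \<open>auto simp: flat_exp_def\<close>)
    then show ?thesis using 2 by (simp add: flat_exp_def)
  next
    case 3
    \<comment> \<open>The difference quotient of \<open>flat_exp k\<close> at 0 is
      \<open>flat_exp (k + 1)\<close> itself, whose limit at 0 is known.\<close>
    have "((\<lambda>h. (flat_exp k (0 + h) - flat_exp k 0) / h) \<longlongrightarrow> 0) (at 0)"
      by (rule Lim_transform_eventually[OF flat_exp_tendsto_0[of "k + 1"]])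
        (auto simp: eventually_at_filter flat_exp_def)
    then show ?thesis using 3 by (simp add: DERIV_def flat_exp_def)
  qed
qed

lemma differentiable_real_const: "differentiable_real k (\<lambda>t. a)"
proof (induction k arbitrary: a)
  case (Suc k) then show ?case by (auto intro!: exI[of _ "\<lambda>t. 0"])
qed simp

lemma differentiable_real_flat_exp: "differentiable_real m (flat_exp k)"
proof (induction m arbitrary: k)
  case (Suc m)
  have "differentiable_real m (\<lambda>t. flat_exp (k + 2) t + (- real k) * flat_exp (k + 1) t)"
    by (intro differentiable_real_add differentiable_real_mult differentiable_real_const Suc)
  then show ?case
    using flat_exp_has_derivative[of k]
    by (auto intro!: exI[of _ "\<lambda>t. flat_exp (k + 2) t - real k * flat_exp (k + 1) t"])
qed simp

lemma deriv_differentiable_real: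
  assumes "differentiable_real (Suc k) f"
  shows "(f has_real_derivative deriv f t) (at t)" "differentiable_real k (deriv f)"
proof -
  from assms obtain f' where f': "\<forall>t. (f has_real_derivative f' t) (at t)" "differentiable_real k f'"
    by auto
  then have "deriv f = f'" by (auto intro!: ext DERIV_imp_deriv)
  with f' show "(f has_real_derivative deriv f t) (at t)" "differentiable_real k (deriv f)" by auto
qed

text \<open>On (-1,1) this is exp(-2/(1-t^2)); elsewhere it is 0.\<close>

definition bump :: "real \<Rightarrow> real" where
  "bump t = flat_exp 0 (1 + t) * flat_exp 0 (1 - t)"

definition bump_deriv :: "nat \<Rightarrow> real \<Rightarrow> real" where
  "bump_deriv k = (deriv ^^ k) bump"

lemma differentiable_real_bump_deriv: "differentiable_real m (bump_deriv k)"
proof (induction k arbitrary: m)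
  case 0
  have "differentiable_real m (\<lambda>t. flat_exp 0 (1 * t + 1) * flat_exp 0 ((-1) * t + 1))"
    by (intro differentiable_real_mult differentiable_real_affine differentiable_real_flat_exp)
  then show ?case by (simp add: bump_deriv_def bump_def[abs_def] algebra_simps)
next
  case (Suc k)
  then show ?case
    using deriv_differentiable_real(2)[of m "bump_deriv k"] by (simp add: bump_deriv_def)
qed

lemma bump_deriv_has_derivative:
  "(bump_deriv k has_real_derivative bump_deriv (Suc k) t) (at t)"
  using deriv_differentiable_real(1)[OF differentiable_real_bump_deriv[of "Suc 0" k]]
  by (simp add: bump_deriv_def)

lemma isCont_bump_deriv: "isCont (bump_deriv k) t"
  using bump_deriv_has_derivative DERIV_isCont by blast

lemma bump_deriv_eq_0: "\<bar>t\<bar> \<ge> 1 \<Longrightarrow> bump_deriv k t = 0"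
proof -
  have *: "bump_deriv k t = 0" if "\<bar>t\<bar> > 1" for t
    using that
  proof (induction k arbitrary: t)
    case 0
    then show ?case by (auto simp: bump_deriv_def bump_def flat_exp_def)
  next
    case (Suc k)
    have "(bump_deriv k has_real_derivative 0) (at t)"
    proof (rule has_field_derivative_transform_within_open[of "\<lambda>t. 0" _ _ "{t. 1 < \<bar>t\<bar>}"])
      show "open {t::real. 1 < \<bar>t\<bar>}" by (intro open_Collect_less continuous_intros)
    qed (use Suc in auto)
    then show ?case using bump_deriv_has_derivative[of k t] DERIV_unique by blast
  qed
  assume t: "\<bar>t\<bar> \<ge> 1"
  show ?thesis
  proof (cases "\<bar>t\<bar> > 1")
    case False
    then have tt: "\<bar>t\<bar> = 1" using t by simp
    \<comment> \<open>A sequence tending to the endpoint t from outside [-1,1], where the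
      derivatives already vanish; continuity carries the zero over to t.\<close>
    define s where "s n = t * (1 + 1 / real (Suc n))" for n :: nat
    have "s \<longlonglongrightarrow> t * (1 + 0)"
      unfolding s_def by (intro tendsto_intros LIMSEQ_inverse_real_of_nat[unfolded inverse_eq_divide])
    then have "(\<lambda>n. bump_deriv k (s n)) \<longlonglongrightarrow> bump_deriv k t"
      using isCont_tendsto_compose[OF isCont_bump_deriv] by simp
    moreover have "bump_deriv k (s n) = 0" for n
      by (rule *) (simp add: s_def abs_mult tt)
    ultimately show ?thesis by (simp add: LIMSEQ_const_iff)
  qed (rule *)
qed

lemma bump_deriv_0_nonneg: "0 \<le> bump_deriv 0 t"
  by (auto simp: bump_deriv_def bump_def flat_exp_def)

lemma bump_deriv_0_at_0: "0 < bump_deriv 0 0"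
  by (auto simp: bump_deriv_def bump_def flat_exp_def)

lemma bump_deriv_0_le: "bump_deriv 0 t \<le> 1"
  by (auto simp: bump_deriv_def bump_def flat_exp_def intro!: mult_le_one)

text \<open>A class of functions which contains the mollifiers and is closed under \<^const>\<open>partial_deriv\<close>.\<close>

definition bump_prod :: "real \<Rightarrow> real \<Rightarrow> real^'n \<Rightarrow> ('n \<Rightarrow> nat) \<Rightarrow> real^'n \<Rightarrow> real" where
  "bump_prod a b c k y = a * (\<Prod>i\<in>UNIV. bump_deriv (k i) (b * (y $ i - c $ i)))"

lemma bump_prod_has_derivative:
  "(bump_prod a b c k has_derivative
      (\<lambda>h. \<Sum>j\<in>UNIV. h $ j * bump_prod (a * b) b c (k(j := Suc (k j))) y)) (at y)"
proof -
  have 1: "((\<lambda>y. bump_deriv (k i) (b * (y $ i - c $ i))) has_derivative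
      (\<lambda>h. bump_deriv (Suc (k i)) (b * (y $ i - c $ i)) * (b * h $ i))) (at y)" for i
  proof -
    have "((\<lambda>y. b * (y $ i - c $ i)) has_derivative (\<lambda>h. b * h $ i)) (at y)"
      by (auto intro!: derivative_eq_intros bounded_linear.has_derivative[OF bounded_linear_vec_nth])
    from has_derivative_compose[OF this bump_deriv_has_derivative[unfolded has_field_derivative_def]]
    show ?thesis by simp
  qed
  have "(bump_prod a b c k has_derivative (\<lambda>h. a * (\<Sum>j\<in>UNIV.
      bump_deriv (Suc (k j)) (b * (y $ j - c $ j)) * (b * h $ j) *
      (\<Prod>i\<in>UNIV - {j}. bump_deriv (k i) (b * (y $ i - c $ i)))))) (at y)"
    unfolding bump_prod_def[abs_def]
    by (intro has_derivative_mult_right has_derivative_prod 1)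
  moreover have "a * (\<Sum>j\<in>UNIV. bump_deriv (Suc (k j)) (b * (y $ j - c $ j)) * (b * h $ j) *
      (\<Prod>i\<in>UNIV - {j}. bump_deriv (k i) (b * (y $ i - c $ i)))) =
      (\<Sum>j\<in>UNIV. h $ j * bump_prod (a * b) b c (k(j := Suc (k j))) y)" for h
  proof -
    have "(\<Prod>i\<in>UNIV. bump_deriv ((k(j := Suc (k j))) i) (b * (y $ i - c $ i))) =
        bump_deriv (Suc (k j)) (b * (y $ j - c $ j)) *
        (\<Prod>i\<in>UNIV - {j}. bump_deriv (k i) (b * (y $ i - c $ i)))" for j
      by (subst prod.remove[of UNIV j]) (auto intro!: prod.cong)
    then show ?thesis
      unfolding sum_distrib_left bump_prod_def by (intro sum.cong) (simp_all add: algebra_simps)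
  qed
  ultimately show ?thesis by simp
qed

lemma partial_deriv_bump_prod:
  "partial_deriv j (bump_prod a b c k) = bump_prod (a * b) b c (k(j := Suc (k j)))"
proof
  fix y
  have "frechet_derivative (bump_prod a b c k) (at y) =
      (\<lambda>h. \<Sum>j\<in>UNIV. h $ j * bump_prod (a * b) b c (k(j := Suc (k j))) y)"
    using frechet_derivative_at[OF bump_prod_has_derivative[of a b c k y]] by simp
  then show "partial_deriv j (bump_prod a b c k) y = bump_prod (a * b) b c (k(j := Suc (k j))) y"
    by (simp add: partial_deriv_def axis_def if_distrib[of "\<lambda>x. x * _"] sum.delta cong: if_cong)
qed

lemma differentiable_times_bump_prod: "differentiable_times m (bump_prod a b c k)"
proof (induction m arbitrary: a k)
  case (Suc m)
  have "bump_prod a b c k differentiable_on UNIV"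
    unfolding differentiable_on_def differentiable_def
    using has_derivative_at_withinI[OF bump_prod_has_derivative[of a b c k]] by blast
  with Suc show ?case by (simp add: partial_deriv_bump_prod)
qed simp

lemma continuous_on_bump_prod:
  "continuous_on S (\<lambda>(p, y). bump_prod a b p k y)"
proof -
  have *: "continuous_on UNIV (bump_deriv m)" for m
    using isCont_bump_deriv continuous_at_imp_continuous_on by blast
  show ?thesis
    unfolding bump_prod_def split_def
    by (intro continuous_intros continuous_on_compose2[OF *]) auto
qed

text \<open>The support lies in a cube of half-width 1/b. A point at distance at least
  \<open>CARD('n)\<close>/b from the centre is off the open cube, because the norm is at most the
  sum of the moduli of the coordinates.\<close>

lemma bump_prod_eq_0:
  fixes y :: "real^'n"
  assumes "b > 0" "real CARD('n) \<le> b * norm (y - c)"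
  shows "bump_prod a b c k y = 0"
proof -
  have "\<exists>i. \<bar>b * (y $ i - c $ i)\<bar> \<ge> 1"
  proof (rule ccontr)
    assume "\<not> ?thesis"
    then have "\<bar>b * (y $ i - c $ i)\<bar> < 1" for i by (auto simp: not_le)
    then have "(\<Sum>i\<in>UNIV. \<bar>b * (y $ i - c $ i)\<bar>) < (\<Sum>i\<in>(UNIV::'n set). 1)"
      by (intro sum_strict_mono) auto
    moreover have "b * norm (y - c) \<le> (\<Sum>i\<in>UNIV. \<bar>b * (y $ i - c $ i)\<bar>)"
      using norm_le_l1_cart[of "b *\<^sub>R (y - c)"] assms(1) by simp
    ultimately show False using assms(2) by simp
  qed
  then show ?thesis
    using bump_deriv_eq_0 unfolding bump_prod_def by (auto intro!: bexI)
qed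

section \<open>Mollification along lines\<close>

lemma nn_integral_lborel_affine:
  fixes t :: "'a::euclidean_space"
  assumes "f \<in> borel_measurable borel" "c \<noteq> 0"
  shows "(\<integral>\<^sup>+x. f x \<partial>lborel) = ennreal (\<bar>c\<bar> ^ DIM('a)) * (\<integral>\<^sup>+x. f (t + c *\<^sub>R x) \<partial>lborel)"
  using assms
  by (subst lborel_affine[OF \<open>c \<noteq> 0\<close>, of t])
    (simp add: nn_integral_density nn_integral_distr nn_integral_cmult)

lemma borel_measurable_bump_prod [measurable]: "bump_prod a b c k \<in> borel_measurable borel"
  using continuous_on_compose2[OF continuous_on_bump_prod[of UNIV a b k], of UNIV "\<lambda>y. (c, y)"]
  by (intro borel_measurable_continuous_onI) (auto simp: continuous_on_Pair continuous_on_const continuous_on_id)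

lemma bump_prod_0_nonneg: "0 \<le> a \<Longrightarrow> 0 \<le> bump_prod a b c (\<lambda>_. 0) y"
  by (auto simp: bump_prod_def bump_deriv_0_nonneg intro!: mult_nonneg_nonneg prod_nonneg)

definition bump_mass :: "'n::finite itself \<Rightarrow> real" where
  "bump_mass _ = enn2real (\<integral>\<^sup>+z. ennreal (bump_prod 1 (real CARD('n)) (0::real^'n) (\<lambda>_. 0) z) \<partial>lborel)"

lemma bump_mass:
  shows "0 < bump_mass TYPE('n::finite)"
    and "(\<integral>\<^sup>+z. ennreal (bump_prod 1 (real CARD('n)) (0::real^'n) (\<lambda>_. 0) z) \<partial>lborel) =
      ennreal (bump_mass TYPE('n))"
proof -
  let ?f = "bump_prod 1 (real CARD('n)) (0::real^'n) (\<lambda>_. 0)"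
  let ?J = "\<integral>\<^sup>+z. ennreal (?f z) \<partial>lborel"
  have N: "real CARD('n) > 0" by simp
  have "?J \<le> (\<integral>\<^sup>+z. indicator (cball 0 1) z \<partial>(lborel::(real^'n) measure))"
  proof (rule nn_integral_mono)
    fix z :: "real^'n"
    have "?f z = 0" if "norm z > 1"
      by (rule bump_prod_eq_0) (use that in auto)
    moreover have "?f z \<le> 1"
      unfolding bump_prod_def
      by (auto intro!: prod_le_1 simp: bump_deriv_0_nonneg bump_deriv_0_le)
    ultimately show "ennreal (?f z) \<le> indicator (cball 0 1) z"
      by (auto simp: indicator_def not_le)
  qed
  also have "\<dots> < \<infinity>"
    using emeasure_lborel_cball_finite by simp
  finally have fin: "?J < \<infinity>" .
  have "?J \<noteq> 0"
  proof
    assume "?J = 0"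
    then have "AE z in lborel. ?f z \<le> 0"
      by (subst (asm) nn_integral_0_iff_AE) (auto simp: ennreal_eq_0_iff)
    then have "AE z in lborel. z \<notin> {z. 0 < ?f z}" by eventually_elim auto
    moreover have op: "open {z. 0 < ?f z}"
    proof (intro open_Collect_less continuous_intros)
      show "continuous_on UNIV ?f"
        using continuous_on_compose2[OF continuous_on_bump_prod[of UNIV 1 "real CARD('n)" "\<lambda>_. 0"],
            of UNIV "\<lambda>y. (0, y)"] by (auto simp: continuous_on_Pair continuous_on_const continuous_on_id)
    qed
    ultimately have "{z. 0 < ?f z} \<in> null_sets lborel"
      by (subst AE_iff_null_sets) auto
    then have "negligible {z. 0 < ?f z}"
      by (simp add: negligible_iff_null_sets null_sets_completionI)
    moreover have "0 \<in> {z. 0 < ?f z}"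
      by (auto simp: bump_prod_def bump_deriv_0_at_0 intro!: prod_pos)
    ultimately show False
      using open_not_negligible[OF op] by blast
  qed
  with fin show "0 < bump_mass TYPE('n)" "?J = ennreal (bump_mass TYPE('n))"
    by (auto simp: bump_mass_def enn2real_positive_iff zero_less_iff_neq_zero)
qed

text \<open>The scale \<open>real CARD('n) / \<epsilon>\<close> puts the support into the ball of
  radius \<epsilon> about p, and the prefactor normalises the integral to 1. The centre p comes
  first since it is the quantity that will move along a ray.\<close>

definition mollifier :: "real \<Rightarrow> real^'n \<Rightarrow> real^'n \<Rightarrow> real" where
  "mollifier \<epsilon> p =
     bump_prod (1 / (bump_mass TYPE('n) * \<epsilon> ^ CARD('n))) (real CARD('n) / \<epsilon>) p (\<lambda>_. 0)"

lemma mollifier_nonneg: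
  fixes p y :: "real^'n"
  shows "\<epsilon> > 0 \<Longrightarrow> 0 \<le> mollifier \<epsilon> p y"
  unfolding mollifier_def using bump_mass(1)[where 'n='n]
  by (intro bump_prod_0_nonneg) (auto intro!: mult_nonneg_nonneg simp: less_imp_le)

lemma mollifier_eq_0:
  fixes p y :: "real^'n"
  assumes "\<epsilon> > 0" "norm (y - p) \<ge> \<epsilon>"
  shows "mollifier \<epsilon> p y = 0"
  unfolding mollifier_def using assms
  by (intro bump_prod_eq_0) (auto simp: field_simps)

lemma mollifier_le:
  fixes p y :: "real^'n"
  assumes "\<epsilon> > 0"
  shows "mollifier \<epsilon> p y \<le> 1 / (bump_mass TYPE('n) * \<epsilon> ^ CARD('n))"
proof -
  have "(\<Prod>i\<in>UNIV. bump_deriv 0 (real CARD('n) / \<epsilon> * (y $ i - p $ i))) \<le> 1"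
    by (intro prod_le_1) (auto simp: bump_deriv_0_nonneg bump_deriv_0_le)
  then show ?thesis
    unfolding mollifier_def bump_prod_def using bump_mass(1)[where 'n='n] assms
    by (intro mult_left_le) auto
qed

lemma borel_measurable_mollifier [measurable]: "mollifier \<epsilon> p \<in> borel_measurable borel"
  unfolding mollifier_def by measurable

lemma borel_measurable_mollifier_pair [measurable]:
  "(\<lambda>(p, y). mollifier \<epsilon> p y) \<in> borel_measurable (borel \<Otimes>\<^sub>M borel)"
  unfolding mollifier_def borel_prod by (intro borel_measurable_continuous_onI continuous_on_bump_prod)

lemma nn_integral_mollifier:
  fixes p :: "real^'n"
  assumes "\<epsilon> > 0"
  shows "(\<integral>\<^sup>+y. ennreal (mollifier \<epsilon> p y) \<partial>lborel) = 1"
proof -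
  let ?m = "bump_mass TYPE('n)"
  let ?f = "bump_prod 1 (real CARD('n)) (0::real^'n) (\<lambda>_. 0)"
  have *: "mollifier \<epsilon> p (p + \<epsilon> *\<^sub>R z) = 1 / (?m * \<epsilon> ^ CARD('n)) * ?f z" for z
    using assms by (simp add: mollifier_def bump_prod_def)
  have "(\<integral>\<^sup>+y. ennreal (mollifier \<epsilon> p y) \<partial>lborel) =
      ennreal (\<epsilon> ^ CARD('n)) * (\<integral>\<^sup>+z. ennreal (mollifier \<epsilon> p (p + \<epsilon> *\<^sub>R z)) \<partial>lborel)"
    by (subst nn_integral_lborel_affine[of _ \<epsilon> p]) (use assms in auto)
  also have "\<dots> = ennreal (\<epsilon> ^ CARD('n)) * (ennreal (1 / (?m * \<epsilon> ^ CARD('n))) * (\<integral>\<^sup>+z. ennreal (?f z) \<partial>lborel))"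
    unfolding * using assms bump_mass(1)[where 'n='n]
    by (subst nn_integral_cmult[symmetric])
      (auto simp: ennreal_mult[symmetric] bump_prod_0_nonneg simp del: mult_1)
  also have "\<dots> = 1"
    unfolding bump_mass(2) using assms bump_mass(1)[where 'n='n]
    by (simp add: ennreal_mult[symmetric])
  finally show ?thesis .
qed

lemma mollifier_test_function:
  fixes p :: "real^'n"
  assumes "\<epsilon> > 0" "cball p \<epsilon> \<subseteq> \<Omega>"
  shows "mollifier \<epsilon> p \<in> test_functions \<Omega>"
proof -
  have "{y. mollifier \<epsilon> p y \<noteq> 0} \<subseteq> cball p \<epsilon>"
    using mollifier_eq_0[OF assms(1)] by (force simp: dist_norm norm_minus_commute not_le)
  then have "closure {y. mollifier \<epsilon> p y \<noteq> 0} \<subseteq> cball p \<epsilon>"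
    by (rule closure_minimal) simp
  moreover have "bounded {y. mollifier \<epsilon> p y \<noteq> 0}"
    using \<open>{y. mollifier \<epsilon> p y \<noteq> 0} \<subseteq> _\<close> bounded_cball bounded_subset by blast
  ultimately show ?thesis
    using assms(2) unfolding test_functions_def
    by (auto simp: compact_closure mollifier_def differentiable_times_bump_prod)
qed

lemma continuous_compact_bounded_pair:
  fixes f :: "'a::euclidean_space \<times> real \<Rightarrow> real"
  assumes "continuous_on UNIV f"
  obtains B where "B > 0" "\<And>z. z \<in> cball x r \<times> {0..b} \<Longrightarrow> \<bar>f z\<bar> \<le> B"
proof -
  have "compact (f ` (cball x r \<times> {0..b}))"
    by (intro compact_continuous_image compact_Times continuous_on_subset[OF assms]) auto
  then obtain B where "\<And>z. z \<in> cball x r \<times> {0..b} \<Longrightarrow> \<bar>f z\<bar> \<le> B"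
    using compact_imp_bounded[of "f ` (cball x r \<times> {0..b})"] unfolding bounded_iff by fastforce
  then have "\<bar>f z\<bar> \<le> \<bar>B\<bar> + 1" if "z \<in> cball x r \<times> {0..b}" for z
    using that abs_ge_self[of B] by (smt (verit))
  then show thesis by (intro that[of "\<bar>B\<bar> + 1"]) auto
qed

text \<open>Cauchy-Schwarz for the Frobenius inner product of G with the rank-one matrix v v^T,
  whose Frobenius norm is |v|^2.\<close>

lemma norm_quadratic_form_le:
  fixes G :: "real^'n^'n" and v :: "real^'n"
  shows "\<bar>\<Sum>i\<in>UNIV. \<Sum>j\<in>UNIV. v $ i * v $ j * G $ i $ j\<bar> \<le> norm v ^ 2 * norm G"
proof -
  define H :: "real^'n^'n" where "H = (\<chi> i. v $ i *\<^sub>R v)"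
  have "H \<bullet> G = (\<Sum>i\<in>UNIV. \<Sum>j\<in>UNIV. v $ i * v $ j * G $ i $ j)"
    by (simp add: H_def inner_vec_def sum_distrib_left algebra_simps)
  moreover have "norm H = norm v ^ 2"
  proof -
    have "H \<bullet> H = (\<Sum>i\<in>UNIV. (v $ i)\<^sup>2 * (v \<bullet> v))"
      unfolding inner_vec_def[of H H] by (simp add: H_def power2_eq_square algebra_simps)
    also have "\<dots> = (v \<bullet> v) * (v \<bullet> v)"
      by (simp add: sum_distrib_right[symmetric] inner_vec_def[of v v] power2_eq_square)
    finally have "(norm H)\<^sup>2 = ((norm v)\<^sup>2)\<^sup>2"
      by (simp only: power2_norm_eq_inner power2_eq_square[of "v \<bullet> v"])
    then show ?thesis by (metis norm_ge_zero power2_eq_iff_nonneg zero_le_power2)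
  qed
  ultimately show ?thesis using Cauchy_Schwarz_ineq2[of H G] by simp
qed

text \<open>G is integrable only on compact subsets of \<Omega>. A bounded factor supported in such
  a subset S replaces G by its restriction to S, so the integrals of G against mollifiers over
  \<Omega> are genuine Bochner integrals and not default values.\<close>

lemma locally_integrable_times_bounded:
  fixes G :: "real^'n \<Rightarrow> real^'n^'n"
  assumes G: "locally_integrable \<Omega> G" and S: "compact S" "S \<subseteq> \<Omega>"
    and k: "k \<in> borel_measurable borel" "\<And>y. \<bar>k y\<bar> \<le> B" "\<And>y. y \<notin> S \<Longrightarrow> k y = 0"
  shows "integrable lebesgue (\<lambda>y. indicator \<Omega> y * (G y $ i $ j * k y))"
    and "integrable lebesgue (\<lambda>y. indicator \<Omega> y * (norm (G y) * k y))"
proof -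
  have int: "integrable lebesgue (\<lambda>y. indicator S y *\<^sub>R G y)"
    using G S unfolding locally_integrable_def set_integrable_def by blast
  then have meas [measurable]: "(\<lambda>y. indicator S y *\<^sub>R G y) \<in> borel_measurable lebesgue"
    by (rule borel_measurable_integrable)
  have k' [measurable]: "k \<in> borel_measurable lebesgue"
    using k(1) by (simp add: measurable_completion)
  have B: "0 \<le> B" using k(2)[of 0] by linarith
  have eq: "indicator \<Omega> y * (G y $ i $ j * k y) = (indicator S y *\<^sub>R G y) $ i $ j * k y"
    "indicator \<Omega> y * (norm (G y) * k y) = norm (indicator S y *\<^sub>R G y) * k y" for y
    using k(3)[of y] S(2) by (auto simp: indicator_def)
  have nth: "(\<lambda>H::real^'n^'n. H $ i $ j) \<in> borel_measurable borel"
    by (intro borel_measurable_continuous_onI continuous_intros)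
  have [measurable]: "(\<lambda>y. (indicator S y *\<^sub>R G y) $ i $ j) \<in> borel_measurable lebesgue"
    using measurable_compose[OF meas nth] by simp
  have intB: "integrable lebesgue (\<lambda>y. B *\<^sub>R (indicator S y *\<^sub>R G y))"
    using int by (rule integrable_scaleR_right)
  have bd: "\<bar>(indicator S y *\<^sub>R G y) $ i $ j * k y\<bar> \<le> B * norm (indicator S y *\<^sub>R G y)"
    "norm (indicator S y *\<^sub>R G y) * \<bar>k y\<bar> \<le> B * norm (indicator S y *\<^sub>R G y)" for y
  proof -
    have "\<bar>(indicator S y *\<^sub>R G y) $ i $ j\<bar> \<le> norm (indicator S y *\<^sub>R G y)"
      by (rule order_trans[OF component_le_norm_cart Finite_Cartesian_Product.norm_nth_le])
    then have "\<bar>k y\<bar> * \<bar>(indicator S y *\<^sub>R G y) $ i $ j\<bar> \<le> B * norm (indicator S y *\<^sub>R G y)"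
      using k(2)[of y] by (intro mult_mono) auto
    then show "\<bar>(indicator S y *\<^sub>R G y) $ i $ j * k y\<bar> \<le> B * norm (indicator S y *\<^sub>R G y)"
      by (simp only: abs_mult mult.commute)
    show "norm (indicator S y *\<^sub>R G y) * \<bar>k y\<bar> \<le> B * norm (indicator S y *\<^sub>R G y)"
      using mult_right_mono[OF k(2)[of y] norm_ge_zero[of "indicator S y *\<^sub>R G y"]]
      by (simp only: mult.commute)
  qed
  have nB: "norm (B *\<^sub>R (indicator S y *\<^sub>R G y)) = B * norm (indicator S y *\<^sub>R G y)" for y
    using B by simp
  show "integrable lebesgue (\<lambda>y. indicator \<Omega> y * (G y $ i $ j * k y))"
    unfolding eq
  proof (rule Bochner_Integration.integrable_bound[OF intB])
    show "(\<lambda>y. (indicator S y *\<^sub>R G y) $ i $ j * k y) \<in> borel_measurable lebesgue"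
      by measurable
  qed (use bd(1) in \<open>simp only: nB real_norm_def AE_I2\<close>)
  show "integrable lebesgue (\<lambda>y. indicator \<Omega> y * (norm (G y) * k y))"
    unfolding eq
  proof (rule Bochner_Integration.integrable_bound[OF intB])
    show "(\<lambda>y. norm (indicator S y *\<^sub>R G y) * k y) \<in> borel_measurable lebesgue"
      by measurable
  qed (use bd(2) in \<open>simp only: nB real_norm_def AE_I2 abs_mult abs_norm_cancel\<close>)
qed

text \<open>The derivative of the mollifier, as a function of its centre, in the direction $-v$.\<close>

definition mollifier_deriv :: "real \<Rightarrow> real^'n \<Rightarrow> real^'n \<Rightarrow> real^'n \<Rightarrow> real" where
  "mollifier_deriv \<epsilon> v p y = (\<Sum>j\<in>UNIV. v $ j * partial_deriv j (mollifier \<epsilon> p) y)"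

lemma continuous_on_partial_mollifier:
  "continuous_on UNIV (\<lambda>(p, y). partial_deriv j (mollifier \<epsilon> p) y)"
  unfolding mollifier_def partial_deriv_bump_prod by (rule continuous_on_bump_prod)

lemma partial_mollifier_eq_0:
  fixes p y :: "real^'n"
  assumes "\<epsilon> > 0" "norm (y - p) \<ge> \<epsilon>"
  shows "partial_deriv j (mollifier \<epsilon> p) y = 0"
  unfolding mollifier_def partial_deriv_bump_prod using assms
  by (intro bump_prod_eq_0) (auto simp: field_simps)

text \<open>Moving the centre by s v amounts to moving the argument by -s v, hence the sign.\<close>

lemma mollifier_has_vector_derivative:
  fixes x v y :: "real^'n"
  shows "((\<lambda>s. mollifier \<epsilon> (x + s *\<^sub>R v) y) has_vector_derivative
    - mollifier_deriv \<epsilon> v (x + s *\<^sub>R v) y) (at s within S)"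
proof -
  have shift: "bump_prod a b (x + s *\<^sub>R v) k y = bump_prod a b x k (y - s *\<^sub>R v)" for a b k s
    by (simp add: bump_prod_def algebra_simps)
  have 1: "((\<lambda>s. y - s *\<^sub>R v) has_derivative (\<lambda>h. - (h *\<^sub>R v))) (at s within S)"
    by (auto intro!: derivative_eq_intros)
  show ?thesis
    unfolding mollifier_deriv_def mollifier_def has_vector_derivative_def partial_deriv_bump_prod shift
    by (rule has_derivative_eq_rhs[OF has_derivative_compose[OF 1 bump_prod_has_derivative]])
      (auto simp: sum_distrib_left sum_negf algebra_simps)
qed

text \<open>This is $\partial_v (u \cdot v) = v \cdot (\mathcal{E}u) v$, tested with a mollifier.\<close>

lemma has_sym_grad_mollifier_deriv:
  fixes u :: "real^'n \<Rightarrow> real^'n" and x v :: "real^'n"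
  assumes G: "has_sym_grad \<Omega> u G" and \<epsilon>: "\<epsilon> > 0" "cball p \<epsilon> \<subseteq> \<Omega>" and "open \<Omega>"
    and u: "continuous_on \<Omega> u" "\<And>y. y \<in> \<Omega> \<Longrightarrow> norm (u y) \<le> M"
  shows "ennreal \<bar>\<integral>y. indicator \<Omega> y * (u y \<bullet> v) * mollifier_deriv \<epsilon> v p y \<partial>lborel\<bar> \<le>
    ennreal (norm v ^ 2) * (\<integral>\<^sup>+y\<in>\<Omega>. ennreal (norm (G y) * mollifier \<epsilon> p y) \<partial>lebesgue)"
proof -
  let ?K = "mollifier \<epsilon> p"
  have \<Omega>[measurable]: "\<Omega> \<in> sets borel" using \<open>open \<Omega>\<close> by simp
  have Om[measurable]: "\<Omega> \<in> sets lebesgue" by (simp add: sets_completionI_sets)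
  have pd[measurable]: "(\<lambda>y. partial_deriv j ?K y) \<in> borel_measurable borel" for j
    unfolding mollifier_def partial_deriv_bump_prod by measurable
  have u_meas[measurable]: "(\<lambda>y. indicator \<Omega> y *\<^sub>R u y) \<in> borel_measurable borel"
    using u(1) \<Omega> by (rule borel_measurable_continuous_on_indicator[rotated])
  have "0 \<le> M" if "p \<in> \<Omega>" using u(2)[OF that] norm_ge_zero order_trans by blast
  then have M: "0 \<le> M" using \<epsilon> by (meson centre_in_cball less_imp_le subsetD)
  have K: "locally_integrable \<Omega> G" using G by (simp add: has_sym_grad_def)
  have K0: "?K y = 0" if "y \<notin> cball p \<epsilon>" for y
    by (rule mollifier_eq_0) (use \<epsilon> that in \<open>auto simp: dist_norm norm_minus_commute\<close>)
  have Kb: "\<bar>?K y\<bar> \<le> 1 / (bump_mass TYPE('n) * \<epsilon> ^ CARD('n))" for y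
    using mollifier_le[OF \<epsilon>(1), of p y] mollifier_nonneg[OF \<epsilon>(1), of p y] by simp
  have intG: "integrable lebesgue (\<lambda>y. indicator \<Omega> y * (G y $ i $ j * ?K y))"
    "integrable lebesgue (\<lambda>y. indicator \<Omega> y * (norm (G y) * ?K y))" for i j
    by (rule locally_integrable_times_bounded[OF K compact_cball \<epsilon>(2) borel_measurable_mollifier Kb K0];
        assumption)+
  define U where "U i j y = indicator \<Omega> y * (u y $ i * partial_deriv j ?K y)" for i j y
  have U_eq: "U i j y = (indicator \<Omega> y *\<^sub>R u y) $ i * partial_deriv j ?K y" for i j y
    by (simp add: U_def)
  have nth: "(\<lambda>H::real^'n. H $ i) \<in> borel_measurable borel" for i
    by (intro borel_measurable_continuous_onI continuous_intros)
  have U_meas[measurable]: "U i j \<in> borel_measurable borel" for i j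
    unfolding U_eq[abs_def] using measurable_compose[OF u_meas nth] by measurable
  have U_int: "integrable lborel (U i j)" for i j
  proof -
    have "compact ((\<lambda>y. partial_deriv j ?K y) ` cball p \<epsilon>)"
      using continuous_on_compose2[OF continuous_on_partial_mollifier[of j \<epsilon>], of "cball p \<epsilon>" "\<lambda>y. (p, y)"]
      by (intro compact_continuous_image)
        (auto simp: continuous_on_Pair continuous_on_const continuous_on_id)
    then obtain B where B: "\<And>y. y \<in> cball p \<epsilon> \<Longrightarrow> \<bar>partial_deriv j ?K y\<bar> \<le> B"
      using compact_imp_bounded[of "(\<lambda>y. partial_deriv j ?K y) ` cball p \<epsilon>"]
      unfolding bounded_iff by fastforce
    show ?thesis
    proof (rule integrableI_bounded_set[of "cball p \<epsilon>" _ _ "M * B"])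
      show "AE y \<in> cball p \<epsilon> in lborel. norm (U i j y) \<le> M * B"
      proof (intro AE_I2 impI)
        fix y assume y: "y \<in> cball p \<epsilon>"
        then have "\<bar>u y $ i\<bar> \<le> M"
          using \<epsilon>(2) u(2)[of y] component_le_norm_cart[of "u y" i] by auto
        then show "norm (U i j y) \<le> M * B"
          using B[OF y] M by (auto simp: U_def indicator_def abs_mult intro!: mult_mono)
      qed
      show "AE y in lborel. y \<notin> cball p \<epsilon> \<longrightarrow> U i j y = 0"
        unfolding U_def using partial_mollifier_eq_0[of \<epsilon> _ p j] \<epsilon>
        by (intro AE_I2) (auto simp: dist_norm norm_minus_commute)
    qed (use emeasure_lborel_cball_finite in auto)
  qed
  have D: "distr_deriv \<Omega> j (\<lambda>x. u x $ i) ?K = - (\<integral>y. U i j y \<partial>lborel)" for i j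
    unfolding distr_deriv_def set_lebesgue_integral_def U_def[abs_def, symmetric]
  proof -
    have "U i j \<in> borel_measurable lborel" by simp
    from integral_completion[OF this] show "- (\<integral>x. indicator \<Omega> x *\<^sub>R (u x $ i * partial_deriv j ?K x) \<partial>lebesgue) =
      - (\<integral>y. U i j y \<partial>lborel)"
      by (simp add: U_def[abs_def])
  qed
  have "(\<integral>y. indicator \<Omega> y * (u y \<bullet> v) * mollifier_deriv \<epsilon> v p y \<partial>lborel) =
      (\<integral>y. (\<Sum>i\<in>UNIV. \<Sum>j\<in>UNIV. v $ i * v $ j * U i j y) \<partial>lborel)"
    by (intro Bochner_Integration.integral_cong refl)
      (simp add: U_def mollifier_deriv_def inner_vec_def sum_product sum_distrib_left algebra_simps)
  also have "\<dots> = (\<Sum>i\<in>UNIV. \<Sum>j\<in>UNIV. v $ i * v $ j * (\<integral>y. U i j y \<partial>lborel))"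
    using U_int by (simp add: Bochner_Integration.integral_sum)
  also have "\<dots> = - (\<Sum>i\<in>UNIV. \<Sum>j\<in>UNIV. v $ i * v $ j * distr_deriv \<Omega> j (\<lambda>x. u x $ i) ?K)"
    by (simp add: D sum_negf)
  \<comment> \<open>The coefficients v_i v_j are symmetric in i and j, so averaging the sum with its
    transpose changes nothing and leaves exactly the symmetric part of the gradient, for which G can
    be substituted.\<close>
  also have "(\<Sum>i\<in>UNIV. \<Sum>j\<in>UNIV. v $ i * v $ j * distr_deriv \<Omega> j (\<lambda>x. u x $ i) ?K) =
      (\<Sum>i\<in>UNIV. \<Sum>j\<in>UNIV. v $ i * v $ j *
        ((distr_deriv \<Omega> j (\<lambda>x. u x $ i) ?K + distr_deriv \<Omega> i (\<lambda>x. u x $ j) ?K) / 2))" (is "?S = _")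
  proof -
    have "?S = (\<Sum>i\<in>UNIV. \<Sum>j\<in>UNIV. v $ i * v $ j * distr_deriv \<Omega> i (\<lambda>x. u x $ j) ?K)"
      by (subst sum.swap) (simp add: mult.commute)
    then have "?S = (?S + (\<Sum>i\<in>UNIV. \<Sum>j\<in>UNIV. v $ i * v $ j * distr_deriv \<Omega> i (\<lambda>x. u x $ j) ?K)) / 2"
      by simp
    then show ?thesis
      by (simp add: sum.distrib[symmetric] sum_divide_distrib algebra_simps)
  qed
  also have "\<dots> = (\<Sum>i\<in>UNIV. \<Sum>j\<in>UNIV. v $ i * v $ j * (LINT y:\<Omega>|lebesgue. G y $ i $ j * ?K y))"
  proof -
    have "(LINT y:\<Omega>|lebesgue. G y $ i $ j * ?K y) =
        (distr_deriv \<Omega> j (\<lambda>x. u x $ i) ?K + distr_deriv \<Omega> i (\<lambda>x. u x $ j) ?K) / 2" for i j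
      using G mollifier_test_function[OF \<epsilon>] unfolding has_sym_grad_def by blast
    then show ?thesis by (simp only:)
  qed
  also have "\<dots> = (\<integral>y. (\<Sum>i\<in>UNIV. \<Sum>j\<in>UNIV. v $ i * v $ j * (indicator \<Omega> y * (G y $ i $ j * ?K y))) \<partial>lebesgue)"
    using intG(1) by (simp add: Bochner_Integration.integral_sum set_lebesgue_integral_def)
  finally have eq: "\<bar>\<integral>y. indicator \<Omega> y * (u y \<bullet> v) * mollifier_deriv \<epsilon> v p y \<partial>lborel\<bar> =
    \<bar>\<integral>y. (\<Sum>i\<in>UNIV. \<Sum>j\<in>UNIV. v $ i * v $ j * (indicator \<Omega> y * (G y $ i $ j * ?K y))) \<partial>lebesgue\<bar>"
    by simp
  have int2: "integrable lebesgue (\<lambda>y. norm v ^ 2 * (indicator \<Omega> y * (norm (G y) * ?K y)))"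
    using intG(2) by simp
  have pt: "\<bar>\<Sum>i\<in>UNIV. \<Sum>j\<in>UNIV. v $ i * v $ j * (indicator \<Omega> y * (G y $ i $ j * ?K y))\<bar> \<le>
     norm v ^ 2 * (indicator \<Omega> y * (norm (G y) * ?K y))" for y
  proof -
    have "(\<Sum>i\<in>UNIV. \<Sum>j\<in>UNIV. v $ i * v $ j * (indicator \<Omega> y * (G y $ i $ j * ?K y))) =
        (indicator \<Omega> y * ?K y) * (\<Sum>i\<in>UNIV. \<Sum>j\<in>UNIV. v $ i * v $ j * G y $ i $ j)"
      by (simp add: sum_distrib_left algebra_simps)
    also have "\<bar>\<dots>\<bar> \<le> (indicator \<Omega> y * ?K y) * (norm v ^ 2 * norm (G y))"
      unfolding abs_mult using mollifier_nonneg[OF \<epsilon>(1), of p y]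
      by (intro mult_mono norm_quadratic_form_le) auto
    finally show ?thesis by (simp add: algebra_simps)
  qed
  have "\<bar>\<integral>y. indicator \<Omega> y * (u y \<bullet> v) * mollifier_deriv \<epsilon> v p y \<partial>lborel\<bar> \<le>
      (\<integral>y. norm v ^ 2 * (indicator \<Omega> y * (norm (G y) * ?K y)) \<partial>lebesgue)"
    unfolding eq
  proof (rule order_trans[OF integral_abs_bound integral_mono[OF _ int2 pt]])
    show "integrable lebesgue (\<lambda>y. \<bar>\<Sum>i\<in>UNIV. \<Sum>j\<in>UNIV. v $ i * v $ j * (indicator \<Omega> y * (G y $ i $ j * ?K y))\<bar>)"
      using intG(1) by (intro integrable_abs Bochner_Integration.integrable_sum) auto
  qed
  then have "ennreal \<bar>\<integral>y. indicator \<Omega> y * (u y \<bullet> v) * mollifier_deriv \<epsilon> v p y \<partial>lborel\<bar> \<le>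
      ennreal (\<integral>y. norm v ^ 2 * (indicator \<Omega> y * (norm (G y) * ?K y)) \<partial>lebesgue)"
    by (rule ennreal_leI)
  also have "\<dots> = ennreal (norm v ^ 2) * ennreal (\<integral>y. indicator \<Omega> y * (norm (G y) * ?K y) \<partial>lebesgue)"
    by (simp add: ennreal_mult')
  also have "ennreal (\<integral>y. indicator \<Omega> y * (norm (G y) * ?K y) \<partial>lebesgue) =
      (\<integral>\<^sup>+y. ennreal (indicator \<Omega> y * (norm (G y) * ?K y)) \<partial>lebesgue)"
    using intG(2) mollifier_nonneg[OF \<epsilon>(1), of p] by (intro nn_integral_eq_integral[symmetric]) auto
  also have "\<dots> = (\<integral>\<^sup>+y\<in>\<Omega>. ennreal (norm (G y) * ?K y) \<partial>lebesgue)"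
    by (intro nn_integral_cong) (auto simp: indicator_def)
  finally show ?thesis .
qed

text \<open>For fixed y, the fundamental theorem of calculus is applied to the mollifier as a
  function of its centre, and Fubini then exchanges the integrals in y and s. All the smoothness is
  thus taken from the mollifier; of u only boundedness and continuity enter.\<close>

lemma line_estimate:
  fixes u :: "real^'n \<Rightarrow> real^'n" and x v :: "real^'n"
  assumes G: "has_sym_grad \<Omega> u G" and "open \<Omega>"
    and \<epsilon>: "\<epsilon> > 0" and b: "b \<ge> 0" and cb: "\<And>s. s \<in> {0..b} \<Longrightarrow> cball (x + s *\<^sub>R v) \<epsilon> \<subseteq> \<Omega>"
    and u: "continuous_on \<Omega> u" "\<And>y. y \<in> \<Omega> \<Longrightarrow> norm (u y) \<le> M"
  shows "ennreal \<bar>\<integral>y. indicator \<Omega> y * (u y \<bullet> v) * (mollifier \<epsilon> (x + b *\<^sub>R v) y - mollifier \<epsilon> x y) \<partial>lborel\<bar> \<le>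
    (\<integral>\<^sup>+s\<in>{0..b}. ennreal (norm v ^ 2) *
      (\<integral>\<^sup>+y\<in>\<Omega>. ennreal (norm (G y) * mollifier \<epsilon> (x + s *\<^sub>R v) y) \<partial>lebesgue) \<partial>lborel)"
proof -
  have \<Omega>[measurable]: "\<Omega> \<in> sets borel" using \<open>open \<Omega>\<close> by simp
  have u_meas[measurable]: "(\<lambda>y. indicator \<Omega> y *\<^sub>R u y) \<in> borel_measurable borel"
    using u(1) \<Omega> by (rule borel_measurable_continuous_on_indicator[rotated])
  have "x \<in> \<Omega>" using cb[of 0] b \<epsilon> by auto
  then have M: "0 \<le> M" using u(2)[of x] norm_ge_zero[of "u x"] by linarith
  define w where "w y = indicator \<Omega> y * (u y \<bullet> v)" for y
  have "w = (\<lambda>y. (indicator \<Omega> y *\<^sub>R u y) \<bullet> v)" by (auto simp: w_def)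
  moreover have "(\<lambda>y. (indicator \<Omega> y *\<^sub>R u y) \<bullet> v) \<in> borel_measurable borel" by measurable
  ultimately have w_meas[measurable]: "w \<in> borel_measurable borel" by (simp only:)
  have w_le: "\<bar>w y\<bar> \<le> M * norm v" for y
  proof (cases "y \<in> \<Omega>")
    case True
    have "\<bar>u y \<bullet> v\<bar> \<le> norm (u y) * norm v" by (rule Cauchy_Schwarz_ineq2)
    also have "\<dots> \<le> M * norm v" using u(2)[OF True] by (intro mult_right_mono) auto
    finally show ?thesis using True by (simp add: w_def)
  qed (use M in \<open>simp add: w_def\<close>)
  define D where "D y s = mollifier_deriv \<epsilon> v (x + s *\<^sub>R v) y" for y s
  have D_cont: "continuous_on UNIV (\<lambda>(y, s). D y s)"
    unfolding D_def mollifier_deriv_def split_def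
    by (intro continuous_intros continuous_on_compose2[OF continuous_on_partial_mollifier[unfolded split_def],
          where f = "\<lambda>z. (x + snd z *\<^sub>R v, fst z)", unfolded fst_conv snd_conv]) auto
  then have D_meas[measurable]: "(\<lambda>(y, s). D y s) \<in> borel_measurable (borel \<Otimes>\<^sub>M borel)"
    unfolding borel_prod by (rule borel_measurable_continuous_onI)
  \<comment> \<open>The balls of radius \<epsilon> centred on the segment all lie in this ball about
    x, so the integrand of the double integral is supported in a set of finite measure.\<close>
  define R where "R = b * norm v + \<epsilon>"
  have D0: "D y s = 0" if "s \<in> {0..b}" "y \<notin> cball x R" for y s
  proof -
    have "s * norm v \<le> b * norm v" using that(1) by (intro mult_right_mono) auto
    moreover have "norm (y - x) \<le> norm (y - (x + s *\<^sub>R v)) + norm (s *\<^sub>R v)"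
      using norm_triangle_ineq[of "y - (x + s *\<^sub>R v)" "s *\<^sub>R v"] by (simp add: algebra_simps)
    ultimately have "norm (y - (x + s *\<^sub>R v)) \<ge> \<epsilon>"
      using that by (auto simp: R_def dist_norm norm_minus_commute)
    then have "partial_deriv j (mollifier \<epsilon> (x + s *\<^sub>R v)) y = 0" for j
      by (rule partial_mollifier_eq_0[OF \<epsilon>])
    then show ?thesis
      unfolding D_def mollifier_deriv_def by simp
  qed
  obtain B where B: "B > 0" "\<And>z. z \<in> cball x R \<times> {0..b} \<Longrightarrow> \<bar>case_prod D z\<bar> \<le> B"
    using continuous_compact_bounded_pair[OF D_cont] by metis
  define \<Phi> where "\<Phi> y s = w y * (indicator {0..b} s * D y s)" for y s
  have \<Phi>_int: "integrable (lborel \<Otimes>\<^sub>M lborel) (\<lambda>(y, s). \<Phi> y s)"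
  proof (rule integrableI_bounded_set[of "cball x R \<times> {0..b}" _ _ "(M * norm v) * B"])
    show "(\<lambda>(y, s). \<Phi> y s) \<in> borel_measurable (lborel \<Otimes>\<^sub>M lborel)"
      unfolding \<Phi>_def by measurable
    have "emeasure (lborel \<Otimes>\<^sub>M lborel) (cball x R \<times> {0..b}) = emeasure lborel (cball x R) * emeasure lborel {0..b}"
      by (intro lborel.emeasure_pair_measure_Times) auto
    also have "\<dots> < \<infinity>"
      using emeasure_lborel_cball_finite[of x R] b by (auto simp: ennreal_mult_less_top)
    finally show "emeasure (lborel \<Otimes>\<^sub>M lborel) (cball x R \<times> {0..b}) < \<infinity>" .
    show "AE z \<in> cball x R \<times> {0..b} in lborel \<Otimes>\<^sub>M lborel. norm (case z of (y, s) \<Rightarrow> \<Phi> y s) \<le> M * norm v * B"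
    proof (intro AE_I2 impI)
      fix z assume "z \<in> cball x R \<times> {0..b}"
      then have "\<bar>case_prod D z\<bar> \<le> B" by (rule B)
      then have "\<bar>w (fst z)\<bar> * \<bar>case_prod D z\<bar> \<le> M * norm v * B"
        using w_le M by (intro mult_mono) auto
      then show "norm (case z of (y, s) \<Rightarrow> \<Phi> y s) \<le> M * norm v * B"
        using \<open>z \<in> _\<close> by (auto simp: \<Phi>_def abs_mult)
    qed
    show "AE z in lborel \<Otimes>\<^sub>M lborel. z \<notin> cball x R \<times> {0..b} \<longrightarrow> (case z of (y, s) \<Rightarrow> \<Phi> y s) = 0"
    proof (intro AE_I2 impI)
      fix z assume "z \<notin> cball x R \<times> {0..b}"
      then have "fst z \<notin> cball x R \<or> snd z \<notin> {0..b}" by (cases z) auto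
      then show "(case z of (y, s) \<Rightarrow> \<Phi> y s) = 0"
        unfolding split_def \<Phi>_def using D0[of "snd z" "fst z"] by (cases "snd z \<in> {0..b}") simp_all
    qed
  qed (auto intro!: pair_measureI)
  have ftc: "(\<integral>s. indicator {0..b} s * D y s \<partial>lborel) = - (mollifier \<epsilon> (x + b *\<^sub>R v) y - mollifier \<epsilon> x y)" for y
  proof -
    have "(\<integral>s. indicator {0..b} s *\<^sub>R (- D y s) \<partial>lborel) =
        mollifier \<epsilon> (x + b *\<^sub>R v) y - mollifier \<epsilon> (x + 0 *\<^sub>R v) y"
    proof (rule integral_FTC_atLeastAtMost[OF b])
      show "continuous_on {0..b} (\<lambda>s. - D y s)"
        using continuous_on_compose2[OF D_cont, of "{0..b}" "\<lambda>s. (y, s)"]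
        by (auto simp: continuous_on_Pair continuous_on_const continuous_on_id intro!: continuous_intros)
      show "((\<lambda>s. mollifier \<epsilon> (x + s *\<^sub>R v) y) has_vector_derivative - D y s) (at s within {0..b})" for s
        unfolding D_def by (rule mollifier_has_vector_derivative)
    qed
    then show ?thesis by simp
  qed
  have "(\<integral>y. w y * (mollifier \<epsilon> (x + b *\<^sub>R v) y - mollifier \<epsilon> x y) \<partial>lborel) =
      (\<integral>y. - (\<integral>s. \<Phi> y s \<partial>lborel) \<partial>lborel)"
    by (intro Bochner_Integration.integral_cong refl)
      (simp only: \<Phi>_def integral_mult_right_zero ftc mult_minus_right minus_minus)
  also have "\<dots> = - (\<integral>y. (\<integral>s. \<Phi> y s \<partial>lborel) \<partial>lborel)"
    by (rule Bochner_Integration.integral_minus)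
  also have "(\<integral>y. (\<integral>s. \<Phi> y s \<partial>lborel) \<partial>lborel) = (\<integral>s. (\<integral>y. \<Phi> y s \<partial>lborel) \<partial>lborel)"
    by (rule lborel_pair.Fubini_integral[OF \<Phi>_int, symmetric])
  finally have eq: "\<bar>\<integral>y. w y * (mollifier \<epsilon> (x + b *\<^sub>R v) y - mollifier \<epsilon> x y) \<partial>lborel\<bar> =
      norm (\<integral>s. (\<integral>y. \<Phi> y s \<partial>lborel) \<partial>lborel)" by simp
  have "ennreal (norm (\<integral>s. (\<integral>y. \<Phi> y s \<partial>lborel) \<partial>lborel)) \<le>
      (\<integral>\<^sup>+s. ennreal (norm (\<integral>y. \<Phi> y s \<partial>lborel)) \<partial>lborel)"
    by (rule integral_norm_bound_ennreal[OF lborel_pair.integrable_snd[OF \<Phi>_int]])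
  also have "\<dots> \<le> (\<integral>\<^sup>+s\<in>{0..b}. ennreal (norm v ^ 2) *
      (\<integral>\<^sup>+y\<in>\<Omega>. ennreal (norm (G y) * mollifier \<epsilon> (x + s *\<^sub>R v) y) \<partial>lebesgue) \<partial>lborel)"
  proof (rule nn_integral_mono)
    fix s :: real
    show "ennreal (norm (\<integral>y. \<Phi> y s \<partial>lborel)) \<le> ennreal (norm v ^ 2) *
      (\<integral>\<^sup>+y\<in>\<Omega>. ennreal (norm (G y) * mollifier \<epsilon> (x + s *\<^sub>R v) y) \<partial>lebesgue) * indicator {0..b} s"
    proof (cases "s \<in> {0..b}")
      case True
      then show ?thesis
        using has_sym_grad_mollifier_deriv[OF G \<epsilon> cb[OF True] \<open>open \<Omega>\<close> u, of v]
        by (simp add: \<Phi>_def w_def D_def)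
    qed (simp add: \<Phi>_def)
  qed
  finally show ?thesis by (simp only: eq[unfolded w_def])
qed

section \<open>The Riesz kernel\<close>

lemma dyadic_shell:
  fixes d R :: real
  assumes "0 < d" "d < R"
  obtains k :: nat where "R * (1/2) ^ Suc k \<le> d" "d < R * (1/2) ^ k"
proof -
  have "\<exists>k. R * (1/2) ^ k \<le> d"
  proof -
    obtain k where "(1/2::real) ^ k < d / R"
      using real_arch_pow_inv[of "d / R" "1/2"] assms by auto
    then show ?thesis using assms by (intro exI[of _ k]) (simp add: field_simps)
  qed
  then obtain k where k: "R * (1/2) ^ k \<le> d" "\<And>j. j < k \<Longrightarrow> \<not> R * (1/2) ^ j \<le> d"
    by (subst (asm) exists_least_iff) blast
  with assms have "k \<noteq> 0" by (intro notI) auto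
  then obtain j where "k = Suc j" by (cases k) auto
  with k show thesis by (intro that[of j]) (auto simp: not_le)
qed

text \<open>A set of measure m sees most of the kernel when it fills a ball of radius about R =
  m^(1/\<alpha>). Beyond R the kernel is at most R^(-\<beta>); inside, the dyadic shells contribute
  a geometric series of ratio 2^(\<beta>-\<alpha>), which converges because \<beta> < \<alpha>. The
  lemma is used for Lebesgue measure with \<alpha> = n and for \<mu>.\<close>

lemma nn_integral_kernel_le:
  fixes d :: "'a \<Rightarrow> real" and \<alpha> \<beta> K m :: real
  assumes d[measurable]: "d \<in> borel_measurable M"
    and K: "K \<ge> 0" "\<And>r. r > 0 \<Longrightarrow> emeasure M {x\<in>space M. d x < r} \<le> ennreal (K * r powr \<alpha>)"
    and F[measurable]: "F \<in> sets M" and m: "m > 0" "emeasure M F \<le> ennreal m"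
    and \<beta>: "0 \<le> \<beta>" "\<beta> < \<alpha>" and d0: "\<And>x. x \<in> space M \<Longrightarrow> 0 \<le> d x"
  shows "(\<integral>\<^sup>+x\<in>F. ennreal (d x powr (- \<beta>)) \<partial>M) \<le>
    ennreal ((1 + K * 2 powr \<beta> / (1 - 2 powr (\<beta> - \<alpha>))) * m powr (1 - \<beta> / \<alpha>))"
proof -
  \<comment> \<open>At this radius the two contributions R^(-\<beta>) m and R^(\<alpha>-\<beta>) are
    the same power of m.\<close>
  define R where "R = m powr (1 / \<alpha>)"
  have R: "R > 0" and \<alpha>: "\<alpha> > 0" using m \<beta> by (auto simp: R_def)
  define q where "q = 2 powr (\<beta> - \<alpha>)"
  have q: "0 < q" "q < 1" using \<beta> powr_less_one[of 2 "\<beta> - \<alpha>"] by (auto simp: q_def)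
  define r where "r k = R * (1/2) ^ k" for k :: nat
  have r: "r k > 0" for k using R by (simp add: r_def)
  define A where "A k = {x\<in>space M. d x < r k}" for k
  have [measurable]: "A k \<in> sets M" for k unfolding A_def by measurable
  have pt: "ennreal (d x powr (- \<beta>)) * indicator F x \<le>
      ennreal (R powr (- \<beta>)) * indicator F x + (\<Sum>k. ennreal (r (Suc k) powr (- \<beta>)) * indicator (A k) x)"
    if x: "x \<in> space M" for x
  proof -
    \<comment> \<open>A point where d vanishes lies in none of the shells, but there the kernel is 0
      because \<open>0 powr a = 0\<close>.\<close>
    consider "x \<notin> F" | "d x = 0" | "d x \<ge> R" "x \<in> F" | "0 < d x" "d x < R"
      using d0[OF x] by linarith
    then show ?thesis
    proof cases
      case 3
      then have "d x powr (- \<beta>) \<le> R powr (- \<beta>)" using R \<beta> by (intro powr_mono2') auto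
      then show ?thesis using 3 by (intro add_increasing2) (auto intro: ennreal_leI)
    next
      case 4
      obtain k where k: "R * (1/2) ^ Suc k \<le> d x" "d x < R * (1/2) ^ k" using dyadic_shell[OF 4] .
      have "d x powr (- \<beta>) \<le> r (Suc k) powr (- \<beta>)"
        using k(1) r[of "Suc k"] \<beta> by (intro powr_mono2') (auto simp: r_def)
      then have "ennreal (d x powr (- \<beta>)) * indicator F x \<le> ennreal (r (Suc k) powr (- \<beta>)) * indicator (A k) x"
        using k(2) x by (auto simp: A_def r_def indicator_def intro: ennreal_leI)
      also have "\<dots> \<le> (\<Sum>k. ennreal (r (Suc k) powr (- \<beta>)) * indicator (A k) x)"
      proof -
        define g where "g k = ennreal (r (Suc k) powr (- \<beta>)) * indicator (A k) x" for k
        have "sum g {k} \<le> suminf g" by (rule sum_le_suminf) auto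
        moreover have "sum g {k} = g k" by simp
        ultimately show ?thesis unfolding g_def by (simp only:)
      qed
      finally show ?thesis by (intro add_increasing) auto
    qed auto
  qed
  have shell_le: "ennreal (r (Suc k) powr (- \<beta>)) * emeasure M (A k) \<le> ennreal (K * R powr (\<alpha> - \<beta>) * 2 powr \<beta> * q ^ k)" for k
  proof -
    have half: "(1/2::real) ^ k = 2 powr (- real k)" for k
    proof -
      have "(2::real) powr (- real k) = inverse (2 ^ k)"
        unfolding powr_minus by (simp add: powr_realpow)
      then show ?thesis by (simp add: power_divide inverse_eq_divide)
    qed
    have rk: "r k = R * 2 powr (- real k)" for k by (simp add: r_def half)
    have "ennreal (r (Suc k) powr (- \<beta>)) * emeasure M (A k) \<le>
        ennreal (r (Suc k) powr (- \<beta>)) * ennreal (K * r k powr \<alpha>)"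
      unfolding A_def by (intro mult_left_mono K r) auto
    also have "\<dots> = ennreal (r (Suc k) powr (- \<beta>) * (K * r k powr \<alpha>))"
      using K by (simp add: ennreal_mult)
    also have "r (Suc k) powr (- \<beta>) * (K * r k powr \<alpha>) = K * R powr (\<alpha> - \<beta>) * 2 powr \<beta> * q ^ k"
    proof -
      have 1: "r (Suc k) powr (- \<beta>) = R powr (- \<beta>) * 2 powr (\<beta> * (real k + 1))"
        using R by (simp add: rk powr_mult powr_powr algebra_simps)
      have 2: "r k powr \<alpha> = R powr \<alpha> * 2 powr (- (\<alpha> * real k))"
        using R by (simp add: rk powr_mult powr_powr algebra_simps)
      have 3: "q ^ k = 2 powr ((\<beta> - \<alpha>) * real k)"
      proof -
        have "q ^ k = q powr real k" using q(1) by (rule powr_realpow[symmetric])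
        then show ?thesis by (simp add: q_def powr_powr)
      qed
      have 4: "2 powr (\<beta> * (real k + 1)) * 2 powr (- (\<alpha> * real k)) = (2::real) powr \<beta> * 2 powr ((\<beta> - \<alpha>) * real k)"
        by (simp add: powr_add[symmetric] algebra_simps)
      have 5: "R powr (- \<beta>) * R powr \<alpha> = R powr (\<alpha> - \<beta>)"
        by (simp add: powr_add[symmetric])
      have "r (Suc k) powr (- \<beta>) * (K * r k powr \<alpha>) =
          K * (R powr (- \<beta>) * R powr \<alpha>) * (2 powr (\<beta> * (real k + 1)) * 2 powr (- (\<alpha> * real k)))"
        unfolding 1 2 by (simp only: mult_ac)
      then show ?thesis unfolding 3 4 5 by (simp only: mult.assoc)
    qed
    finally show ?thesis .
  qed
  have "(\<integral>\<^sup>+x\<in>F. ennreal (d x powr (- \<beta>)) \<partial>M) \<le> (\<integral>\<^sup>+x. ennreal (R powr (- \<beta>)) * indicator F x +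
      (\<Sum>k. ennreal (r (Suc k) powr (- \<beta>)) * indicator (A k) x) \<partial>M)"
    by (intro nn_integral_mono pt)
  also have "\<dots> = ennreal (R powr (- \<beta>)) * emeasure M F + (\<Sum>k. ennreal (r (Suc k) powr (- \<beta>)) * emeasure M (A k))"
    by (simp add: nn_integral_add nn_integral_suminf nn_integral_cmult)
  also have "\<dots> \<le> ennreal (R powr (- \<beta>)) * ennreal m + (\<Sum>k. ennreal (K * R powr (\<alpha> - \<beta>) * 2 powr \<beta> * q ^ k))"
    by (intro add_mono mult_left_mono m suminf_le shell_le) auto
  also have "(\<Sum>k. ennreal (K * R powr (\<alpha> - \<beta>) * 2 powr \<beta> * q ^ k)) = ennreal (K * R powr (\<alpha> - \<beta>) * 2 powr \<beta> * (1 / (1 - q)))"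
    using K q by (intro suminf_ennreal_eq sums_mult geometric_sums) auto
  also have "ennreal (R powr (- \<beta>)) * ennreal m + \<dots> = ennreal (R powr (- \<beta>) * m + K * R powr (\<alpha> - \<beta>) * 2 powr \<beta> * (1 / (1 - q)))"
    using m K q by (simp add: ennreal_plus ennreal_mult)
  also have "R powr (- \<beta>) * m = m powr (1 - \<beta> / \<alpha>)"
    using m(1) powr_add[of m 1 "- (\<beta> / \<alpha>)"] by (simp add: R_def powr_powr)
  also have "R powr (\<alpha> - \<beta>) = m powr (1 - \<beta> / \<alpha>)"
    using m(1) \<alpha> by (simp add: R_def powr_powr diff_divide_distrib)
  finally show ?thesis by (simp add: q_def algebra_simps)
qed

lemma nn_integral_powr_0:
  fixes a m :: real
  assumes "a > -1" "m \<ge> 0"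
  shows "(\<integral>\<^sup>+r\<in>{0..m}. ennreal (r powr a) \<partial>lborel) = ennreal (m powr (a + 1) / (a + 1))"
proof -
  have "((\<lambda>r. if r \<in> {0..m} then r powr a else 0) has_integral (m powr (a + 1) / (a + 1))) UNIV"
    using has_integral_powr_from_0[OF assms] by (simp only: has_integral_restrict_UNIV)
  then have "(\<integral>\<^sup>+r. ennreal (if r \<in> {0..m} then r powr a else 0) \<partial>lborel) = ennreal (m powr (a + 1) / (a + 1))"
    by (intro nn_integral_has_integral_lborel) auto
  moreover have "(\<integral>\<^sup>+r\<in>{0..m}. ennreal (r powr a) \<partial>lborel) = (\<integral>\<^sup>+r. ennreal (if r \<in> {0..m} then r powr a else 0) \<partial>lborel)"
    by (intro nn_integral_cong) (auto simp: indicator_def)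
  ultimately show ?thesis by simp
qed

lemma half_powr_minus: "R > 0 \<Longrightarrow> (R / 2) powr (- a) = 2 powr a * R powr (- a)" for R a :: real
  by (simp add: powr_divide powr_minus field_simps)

lemma nn_integral_lborel_norm_kernel_le:
  assumes n: "CARD('n::finite) \<ge> 2"
  shows "\<exists>C>0. \<forall>x::real^'n. \<forall>F\<in>sets borel. \<forall>m>0. emeasure lborel F \<le> ennreal m \<longrightarrow>
    (\<integral>\<^sup>+w\<in>F. ennreal (norm (w - x) powr (- (real CARD('n) - 1))) \<partial>lborel) \<le>
      ennreal (C * m powr (1 / real CARD('n)))"
proof -
  let ?n = "real CARD('n)" and ?K = "unit_ball_vol (real CARD('n))"
  define C where "C = 1 + ?K * 2 powr (?n - 1) / (1 - 2 powr (?n - 1 - ?n))"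
  have K: "?K > 0" by simp
  have "2 powr (?n - 1 - ?n) = 1/2" by (simp add: powr_minus_divide)
  then have C: "C > 0" using K by (auto simp: C_def intro!: add_pos_nonneg)
  have "(\<integral>\<^sup>+w\<in>F. ennreal (norm (w - x) powr (- (?n - 1))) \<partial>lborel) \<le> ennreal (C * m powr (1 / ?n))"
    if [measurable]: "F \<in> sets borel" and m: "m > 0" "emeasure lborel F \<le> ennreal m" for F m and x :: "real^'n"
  proof -
    have "(\<integral>\<^sup>+w\<in>F. ennreal (norm (w - x) powr (- (?n - 1))) \<partial>lborel) \<le> ennreal (C * m powr (1 - (?n - 1) / ?n))"
      unfolding C_def
    proof (rule nn_integral_kernel_le)
      fix r :: real assume r: "r > 0"
      have "{w \<in> space lborel. norm (w - x) < r} = ball x r"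
        by (auto simp: dist_norm norm_minus_commute)
      then show "emeasure lborel {w \<in> space lborel. norm (w - x) < r} \<le> ennreal (?K * r powr ?n)"
        using r emeasure_ball[of r x] by (simp add: powr_realpow)
    qed (use n m that in auto)
    also have "1 - (?n - 1) / ?n = 1 / ?n" by (simp add: field_simps)
    finally show ?thesis .
  qed
  with C show ?thesis by blast
qed

text \<open>The A1 condition of Muckenhoupt for the kernel: its averages over balls centred at y are
  at most a constant times its value at y. If the ball is small against |y-x|, every w in it has
  |w-x| at least |y-x|/2. Otherwise the bound for arbitrary sets of the same volume is good enough.
  Independence of \<epsilon> is the whole point.\<close>

lemma nn_integral_ball_kernel_le:
  assumes n: "CARD('n::finite) \<ge> 2"
  shows "\<exists>C>0. \<forall>x y::real^'n. \<forall>\<epsilon>>0. x \<noteq> y \<longrightarrow>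
    (\<integral>\<^sup>+w\<in>ball y \<epsilon>. ennreal (norm (w - x) powr (- (real CARD('n) - 1))) \<partial>lborel) \<le>
      ennreal (C * \<epsilon> ^ CARD('n) * norm (y - x) powr (- (real CARD('n) - 1)))"
proof -
  let ?n = "real CARD('n)" and ?K = "unit_ball_vol (real CARD('n))"
  let ?k = "\<lambda>w x::real^'n. norm (w - x) powr (- (?n - 1))"
  obtain C where C: "C > 0" "\<And>x F m. F \<in> sets borel \<Longrightarrow> m > 0 \<Longrightarrow> emeasure lborel F \<le> ennreal m \<Longrightarrow>
      (\<integral>\<^sup>+w\<in>F. ennreal (?k w x) \<partial>lborel) \<le> ennreal (C * m powr (1 / ?n))"
    using nn_integral_lborel_norm_kernel_le[OF n] by blast
  have K: "?K > 0" by simp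
  define C1 where "C1 = 2 powr (?n - 1) * (?K + C * ?K powr (1 / ?n))"
  have C1: "C1 > 0" unfolding C1_def using C K by (intro mult_pos_pos add_pos_nonneg) auto
  have "(\<integral>\<^sup>+w\<in>ball y \<epsilon>. ennreal (?k w x) \<partial>lborel) \<le> ennreal (C1 * \<epsilon> ^ CARD('n) * ?k y x)"
    if \<epsilon>: "\<epsilon> > 0" and xy: "x \<noteq> y" for x y :: "real^'n" and \<epsilon>
  proof -
    let ?R = "norm (y - x)"
    have R: "?R > 0" using xy by simp
    have half: "(?R / 2) powr (- (?n - 1)) = 2 powr (?n - 1) * ?k y x"
      using R by (intro half_powr_minus)
    have vol: "emeasure lborel (ball y \<epsilon>) = ennreal (?K * \<epsilon> ^ CARD('n))"
      using emeasure_ball[of \<epsilon> y] \<epsilon> by simp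
    show ?thesis
    proof (cases "2 * \<epsilon> \<le> ?R")
      case True
      have "(\<integral>\<^sup>+w\<in>ball y \<epsilon>. ennreal (?k w x) \<partial>lborel) \<le> (\<integral>\<^sup>+w. ennreal (2 powr (?n - 1) * ?k y x) * indicator (ball y \<epsilon>) w \<partial>lborel)"
      proof (intro nn_integral_mono)
        fix w
        show "ennreal (?k w x) * indicator (ball y \<epsilon>) w \<le> ennreal (2 powr (?n - 1) * ?k y x) * indicator (ball y \<epsilon>) w"
        proof (cases "w \<in> ball y \<epsilon>")
          case w: True
          have "?R \<le> norm (y - w) + norm (w - x)"
            using norm_triangle_ineq[of "y - w" "w - x"] by simp
          then have "?R / 2 \<le> norm (w - x)" using w True by (simp add: dist_norm)
          then have "?k w x \<le> (?R / 2) powr (- (?n - 1))" using R n by (intro powr_mono2') auto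
          then show ?thesis unfolding half using w by (auto intro: ennreal_leI)
        qed simp
      qed
      also have "\<dots> = ennreal (2 powr (?n - 1) * ?k y x * (?K * \<epsilon> ^ CARD('n)))"
        using \<epsilon> by (simp add: nn_integral_cmult_indicator vol ennreal_mult)
      also have "\<dots> \<le> ennreal (C1 * \<epsilon> ^ CARD('n) * ?k y x)"
        using C K \<epsilon> by (intro ennreal_leI) (simp add: C1_def algebra_simps)
      finally show ?thesis .
    next
      \<comment> \<open>Now \<epsilon> exceeds |y-x|/2, and the bound of order \<epsilon> =
        \<epsilon>^n \<epsilon>^(1-n) is compared with the kernel at y through the second
        factor.\<close>
      case False
      have "(\<integral>\<^sup>+w\<in>ball y \<epsilon>. ennreal (?k w x) \<partial>lborel) \<le> ennreal (C * (?K * \<epsilon> ^ CARD('n)) powr (1 / ?n))"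
        using \<epsilon> by (intro C) (auto simp: vol)
      also have "(?K * \<epsilon> ^ CARD('n)) powr (1 / ?n) = ?K powr (1 / ?n) * \<epsilon>"
        using \<epsilon> K by (simp add: powr_mult powr_powr flip: powr_realpow)
      also have "?K powr (1 / ?n) * \<epsilon> = ?K powr (1 / ?n) * (\<epsilon> ^ CARD('n) * \<epsilon> powr (- (?n - 1)))"
        using \<epsilon> by (simp add: powr_add[symmetric] flip: powr_realpow)
      also have "ennreal (C * (?K powr (1 / ?n) * (\<epsilon> ^ CARD('n) * \<epsilon> powr (- (?n - 1))))) \<le>
          ennreal (C * (?K powr (1 / ?n) * (\<epsilon> ^ CARD('n) * (?R / 2) powr (- (?n - 1)))))"
        using C \<epsilon> False R n zero_le_power[OF less_imp_le[OF \<epsilon>], of "CARD('n)"]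
        by (intro ennreal_leI mult_left_mono powr_mono2') auto
      also have "\<dots> \<le> ennreal (C1 * \<epsilon> ^ CARD('n) * ?k y x)"
        unfolding half using C K \<epsilon> by (intro ennreal_leI) (simp add: C1_def algebra_simps)
      finally show ?thesis .
    qed
  qed
  with C1 show ?thesis by blast
qed

text \<open>For fixed t substitute w = x + t v, with Jacobian t^(-n), and exchange the integrals.
  For fixed w only those t between |w-x|/2 and |w-x| occur, where t^(-n) is at most (2/|w-x|)^n; an
  interval of length |w-x|/2 then yields 2^(n-1) |w-x|^(1-n).\<close>

lemma nn_integral_rays_le:
  fixes f :: "real^'n \<Rightarrow> ennreal"
  assumes [measurable]: "f \<in> borel_measurable borel" and n: "CARD('n) \<ge> 2"
  shows "(\<integral>\<^sup>+v\<in>{v. 1 < norm v \<and> norm v < 2}. (\<integral>\<^sup>+t\<in>{0<..}. f (x + t *\<^sub>R v) \<partial>lborel) \<partial>lborel) \<le>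
    ennreal (2 ^ (CARD('n) - 1)) * (\<integral>\<^sup>+w. f w * ennreal (norm (w - x) powr (- (real CARD('n) - 1))) \<partial>lborel)"
proof -
  let ?n = "CARD('n)"
  let ?A = "{v::real^'n. 1 < norm v \<and> norm v < 2}"
  \<comment> \<open>The condition 1 < |v| < 2 in the variables t and w = x + t v.\<close>
  define T :: "(real \<times> (real^'n)) set" where "T = {(t, w). 0 < t \<and> t < norm (w - x) \<and> norm (w - x) < 2 * t}"
  have T[measurable]: "T \<in> sets (borel \<Otimes>\<^sub>M borel)"
  proof -
    have "open T" unfolding T_def split_def
      by (intro open_Collect_conj open_Collect_less continuous_intros)
    then show ?thesis unfolding borel_prod by simp
  qed
  have A[measurable]: "?A \<in> sets borel" by measurable
  have "(\<integral>\<^sup>+v\<in>?A. (\<integral>\<^sup>+t\<in>{0<..}. f (x + t *\<^sub>R v) \<partial>lborel) \<partial>lborel) =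
      (\<integral>\<^sup>+v. (\<integral>\<^sup>+t. f (x + t *\<^sub>R v) * indicator {0<..} t * indicator ?A v \<partial>lborel) \<partial>lborel)"
    by (intro nn_integral_cong nn_integral_multc[symmetric]) measurable
  also have "\<dots> = (\<integral>\<^sup>+t. (\<integral>\<^sup>+v. f (x + t *\<^sub>R v) * indicator {0<..} t * indicator ?A v \<partial>lborel) \<partial>lborel)"
    by (rule lborel_pair.Fubini'[symmetric]) measurable
  also have "\<dots> = (\<integral>\<^sup>+t. (\<integral>\<^sup>+w. f w * (indicator T (t, w) * ennreal ((1 / t) ^ ?n)) \<partial>lborel) \<partial>lborel)"
  proof (rule nn_integral_cong)
    fix t :: real
    show "(\<integral>\<^sup>+v. f (x + t *\<^sub>R v) * indicator {0<..} t * indicator ?A v \<partial>lborel) =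
        (\<integral>\<^sup>+w. f w * (indicator T (t, w) * ennreal ((1 / t) ^ ?n)) \<partial>lborel)"
    proof (cases "t > 0")
      case True
      have "(\<integral>\<^sup>+w. f w * (indicator T (t, w) * ennreal ((1 / t) ^ ?n)) \<partial>lborel) =
          ennreal (t ^ ?n) * (\<integral>\<^sup>+v. f (x + t *\<^sub>R v) * (indicator T (t, x + t *\<^sub>R v) * ennreal ((1 / t) ^ ?n)) \<partial>lborel)"
        by (subst nn_integral_lborel_affine[of _ t x]) (use True in auto)
      also have "\<dots> = (\<integral>\<^sup>+v. f (x + t *\<^sub>R v) * indicator T (t, x + t *\<^sub>R v) * (ennreal (t ^ ?n) * ennreal ((1 / t) ^ ?n)) \<partial>lborel)"
        by (subst nn_integral_cmult[symmetric]) (auto simp: mult_ac)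
      also have "ennreal (t ^ ?n) * ennreal ((1 / t) ^ ?n) = 1"
        using True by (simp add: ennreal_mult[symmetric] power_one_over)
      also have "(\<integral>\<^sup>+v. f (x + t *\<^sub>R v) * indicator T (t, x + t *\<^sub>R v) * 1 \<partial>lborel) =
          (\<integral>\<^sup>+v. f (x + t *\<^sub>R v) * indicator {0<..} t * indicator ?A v \<partial>lborel)"
        using True by (intro nn_integral_cong) (auto simp: T_def indicator_def)
      finally show ?thesis by simp
    qed (simp add: T_def)
  qed
  also have "\<dots> = (\<integral>\<^sup>+w. (\<integral>\<^sup>+t. f w * (indicator T (t, w) * ennreal ((1 / t) ^ ?n)) \<partial>lborel) \<partial>lborel)"
    by (rule lborel_pair.Fubini') measurable
  also have "\<dots> \<le> (\<integral>\<^sup>+w. f w * (ennreal (2 ^ (?n - 1)) * ennreal (norm (w - x) powr (- (real ?n - 1)))) \<partial>lborel)"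
  proof (rule nn_integral_mono)
    fix w :: "real^'n"
    let ?R = "norm (w - x)"
    have "(\<integral>\<^sup>+t. indicator T (t, w) * ennreal ((1 / t) ^ ?n) \<partial>lborel) \<le>
        (\<integral>\<^sup>+t. ennreal ((2 / ?R) ^ ?n) * indicator {?R / 2 .. ?R} t \<partial>lborel)"
    proof (rule nn_integral_mono)
      fix t :: real
      show "indicator T (t, w) * ennreal ((1 / t) ^ ?n) \<le> ennreal ((2 / ?R) ^ ?n) * indicator {?R / 2 .. ?R} t"
      proof (cases "(t, w) \<in> T")
        case True
        then have t: "t > 0" "t < ?R" "?R < 2 * t" by (auto simp: T_def)
        then have "?R > 0" by linarith
        with t have "2 / (2 * t) \<le> 2 / ?R"
          by (intro divide_left_mono mult_pos_pos) simp_all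
        then have "1 / t \<le> 2 / ?R" by simp
        with t show ?thesis using True by (auto intro!: ennreal_leI power_mono)
      qed simp
    qed
    also have "\<dots> = ennreal ((2 / ?R) ^ ?n) * ennreal (?R / 2)"
      by (simp add: nn_integral_cmult_indicator)
    also have "\<dots> = ennreal (2 ^ (?n - 1)) * ennreal (?R powr (- (real ?n - 1)))"
    proof (cases "?R = 0")
      case False
      have 1: "(2 / ?R) ^ ?n * (?R / 2) = (2 / ?R) ^ (?n - 1)"
        using False n by (cases ?n) (auto simp: field_simps)
      have "?R powr (- (real ?n - 1)) = (1 / ?R) ^ (?n - 1)"
      proof -
        have e: "real ?n - 1 = real (?n - 1)" using n by simp
        have "?R powr real (?n - 1) = ?R ^ (?n - 1)"
          using False by (intro powr_realpow) simp
        then show ?thesis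
          unfolding e powr_minus by (simp add: power_divide inverse_eq_divide)
      qed
      then have "(2 / ?R) ^ (?n - 1) = 2 ^ (?n - 1) * ?R powr (- (real ?n - 1))"
        by (simp add: power_divide)
      with 1 show ?thesis by (simp add: ennreal_mult[symmetric])
    qed simp
    finally have "f w * (\<integral>\<^sup>+t. indicator T (t, w) * ennreal ((1 / t) ^ ?n) \<partial>lborel) \<le>
      f w * (ennreal (2 ^ (?n - 1)) * ennreal (?R powr (- (real ?n - 1))))"
      by (rule mult_left_mono) simp
    then show "(\<integral>\<^sup>+t. f w * (indicator T (t, w) * ennreal ((1 / t) ^ ?n)) \<partial>lborel) \<le>
      f w * (ennreal (2 ^ (?n - 1)) * ennreal (?R powr (- (real ?n - 1))))"
      by (subst nn_integral_cmult) auto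
  qed
  also have "\<dots> = ennreal (2 ^ (?n - 1)) * (\<integral>\<^sup>+w. f w * ennreal (norm (w - x) powr (- (real ?n - 1))) \<partial>lborel)"
    by (subst nn_integral_cmult[symmetric]) (auto simp: mult_ac)
  finally show ?thesis .
qed

section \<open>Mollified potentials and the estimate along one direction\<close>

lemma mollifier_integral:
  fixes p :: "real^'n"
  assumes "\<epsilon> > 0"
  shows "integrable lborel (mollifier \<epsilon> p)" "(\<integral>y. mollifier \<epsilon> p y \<partial>lborel) = 1"
proof -
  have "has_bochner_integral lborel (mollifier \<epsilon> p) 1"
    using nn_integral_mollifier[OF assms, of p] mollifier_nonneg[OF assms, of p]
    by (intro has_bochner_integral_nn_integral) auto
  then show "integrable lborel (mollifier \<epsilon> p)" "(\<integral>y. mollifier \<epsilon> p y \<partial>lborel) = 1"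
    by (auto simp: has_bochner_integral_iff)
qed

text \<open>After Tonelli this is \<open>nn_integral_ball_kernel_le\<close>, since the mollifier is
  at most a constant times \<epsilon>^(-n) and lives on a ball of radius \<epsilon>. As the constant
  is independent of \<epsilon>, the mollification can be discarded without passing to a
  limit.\<close>

lemma nn_integral_mollified_kernel_le:
  assumes n: "CARD('n::finite) \<ge> 2"
  shows "\<exists>C>0. \<forall>(f :: real^'n \<Rightarrow> ennreal) x. \<forall>\<epsilon>>0. f \<in> borel_measurable borel \<longrightarrow>
    (\<integral>\<^sup>+w. (\<integral>\<^sup>+y. f y * ennreal (mollifier \<epsilon> w y) \<partial>lborel) * ennreal (norm (w - x) powr (- (real CARD('n) - 1))) \<partial>lborel) \<le>
      ennreal C * (\<integral>\<^sup>+y. f y * ennreal (norm (y - x) powr (- (real CARD('n) - 1))) \<partial>lborel)"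
proof -
  let ?\<beta> = "real CARD('n) - 1" and ?m = "bump_mass TYPE('n)"
  let ?k = "\<lambda>w x::real^'n. ennreal (norm (w - x) powr (- ?\<beta>))"
  obtain C where C: "C > 0" "\<And>x y \<epsilon>. \<epsilon> > 0 \<Longrightarrow> x \<noteq> y \<Longrightarrow>
    (\<integral>\<^sup>+w\<in>ball y \<epsilon>. ?k w x \<partial>lborel) \<le> ennreal (C * \<epsilon> ^ CARD('n) * norm (y - x) powr (- ?\<beta>))"
    using nn_integral_ball_kernel_le[OF n] by blast
  have m: "?m > 0" by (rule bump_mass)
  have "(\<integral>\<^sup>+w. (\<integral>\<^sup>+y. f y * ennreal (mollifier \<epsilon> w y) \<partial>lborel) * ?k w x \<partial>lborel) \<le>
      ennreal (C / ?m) * (\<integral>\<^sup>+y. f y * ?k y x \<partial>lborel)"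
    if \<epsilon>: "\<epsilon> > 0" and f[measurable]: "f \<in> borel_measurable borel" for f :: "real^'n \<Rightarrow> ennreal" and x \<epsilon>
  proof -
    have "(\<integral>\<^sup>+w. (\<integral>\<^sup>+y. f y * ennreal (mollifier \<epsilon> w y) \<partial>lborel) * ?k w x \<partial>lborel) =
        (\<integral>\<^sup>+w. (\<integral>\<^sup>+y. f y * ennreal (mollifier \<epsilon> w y) * ?k w x \<partial>lborel) \<partial>lborel)"
      by (intro nn_integral_cong nn_integral_multc[symmetric]) measurable
    also have "\<dots> = (\<integral>\<^sup>+y. (\<integral>\<^sup>+w. f y * ennreal (mollifier \<epsilon> w y) * ?k w x \<partial>lborel) \<partial>lborel)"
      by (rule lborel_pair.Fubini') measurable
    also have "\<dots> \<le> (\<integral>\<^sup>+y. ennreal (C / ?m) * (f y * ?k y x) \<partial>lborel)"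
    proof (rule nn_integral_mono_AE)
      \<comment> \<open>The ball estimate breaks down at y = x, where its right-hand side is 0 by
        the convention \<open>0 powr a = 0\<close>.\<close>
      have "AE y in lborel. y \<noteq> x" by (rule AE_lborel_singleton)
      then show "AE y in lborel. (\<integral>\<^sup>+w. f y * ennreal (mollifier \<epsilon> w y) * ?k w x \<partial>lborel) \<le>
          ennreal (C / ?m) * (f y * ?k y x)"
      proof eventually_elim
        fix y :: "real^'n" assume yx: "y \<noteq> x"
        have "(\<integral>\<^sup>+w. f y * ennreal (mollifier \<epsilon> w y) * ?k w x \<partial>lborel) \<le>
          (\<integral>\<^sup>+w. f y * ennreal (1 / (?m * \<epsilon> ^ CARD('n))) * (?k w x * indicator (ball y \<epsilon>) w) \<partial>lborel)"
        proof (rule nn_integral_mono)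
          fix w :: "real^'n"
          show "f y * ennreal (mollifier \<epsilon> w y) * ?k w x \<le>
              f y * ennreal (1 / (?m * \<epsilon> ^ CARD('n))) * (?k w x * indicator (ball y \<epsilon>) w)"
          proof (cases "w \<in> ball y \<epsilon>")
            case True
            then show ?thesis
              by (simp, intro mult_left_mono mult_right_mono ennreal_leI mollifier_le[OF \<epsilon>]) auto
          next
            case False
            then have "mollifier \<epsilon> w y = 0" by (intro mollifier_eq_0 \<epsilon>) (auto simp: dist_norm)
            then show ?thesis by simp
          qed
        qed
        also have "\<dots> = f y * ennreal (1 / (?m * \<epsilon> ^ CARD('n))) * (\<integral>\<^sup>+w\<in>ball y \<epsilon>. ?k w x \<partial>lborel)"
          by (rule nn_integral_cmult) (intro borel_measurable_times_ennreal borel_measurable_indicator, auto)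
        also have "\<dots> \<le> f y * ennreal (1 / (?m * \<epsilon> ^ CARD('n))) *
            ennreal (C * \<epsilon> ^ CARD('n) * norm (y - x) powr (- ?\<beta>))"
          using yx by (intro mult_left_mono C \<epsilon>) auto
        also have "\<dots> = f y * (ennreal (1 / (?m * \<epsilon> ^ CARD('n))) *
            ennreal (C * \<epsilon> ^ CARD('n) * norm (y - x) powr (- ?\<beta>)))"
          by (simp only: mult.assoc)
        also have "ennreal (1 / (?m * \<epsilon> ^ CARD('n))) * ennreal (C * \<epsilon> ^ CARD('n) * norm (y - x) powr (- ?\<beta>)) =
            ennreal (1 / (?m * \<epsilon> ^ CARD('n)) * (C * \<epsilon> ^ CARD('n) * norm (y - x) powr (- ?\<beta>)))"
          using m \<epsilon> by (intro ennreal_mult'[symmetric]) auto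
        also have "1 / (?m * \<epsilon> ^ CARD('n)) * (C * \<epsilon> ^ CARD('n) * norm (y - x) powr (- ?\<beta>)) =
            C / ?m * norm (y - x) powr (- ?\<beta>)"
          using m \<epsilon> by simp
        also have "ennreal (C / ?m * norm (y - x) powr (- ?\<beta>)) = ennreal (C / ?m) * ?k y x"
          using m C by (intro ennreal_mult') auto
        finally show "(\<integral>\<^sup>+w. f y * ennreal (mollifier \<epsilon> w y) * ?k w x \<partial>lborel) \<le> ennreal (C / ?m) * (f y * ?k y x)"
          by (simp only: mult_ac)
      qed
    qed
    also have "\<dots> = ennreal (C / ?m) * (\<integral>\<^sup>+y. f y * ?k y x \<partial>lborel)"
      by (rule nn_integral_cmult) measurable
    finally show ?thesis .
  qed
  then show ?thesis using C(1) m by (intro exI[of _ "C / ?m"]) auto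
qed

text \<open>Mollified values of u \<bullet> v are compared at the two ends of the segment. Since |v|
  <= 2, the oscillation \<eta> near x and the bound \<tau> near the far end each enter with a factor
  2, and |v|^2 gives the factor 4. On the right the segment is enlarged to the full ray and |G| to
  its Borel majorant f, so that the bound no longer involves the length b, which varies with
  v.\<close>

lemma direction_estimate:
  fixes u :: "real^'n \<Rightarrow> real^'n" and x v :: "real^'n" and f :: "real^'n \<Rightarrow> ennreal"
  assumes G: "has_sym_grad \<Omega> u G" and "open \<Omega>"
    and u: "continuous_on \<Omega> u" "\<And>y. y \<in> \<Omega> \<Longrightarrow> norm (u y) \<le> M"
    and f[measurable]: "f \<in> borel_measurable borel"
    and Gf: "AE y in lebesgue. y \<in> \<Omega> \<longrightarrow> ennreal (norm (G y)) \<le> f y"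
    and \<epsilon>: "0 < \<epsilon>" "\<epsilon> < r" and b: "0 \<le> b"
    and seg: "\<And>s. s \<in> {0..b} \<Longrightarrow> ball (x + s *\<^sub>R v) r \<subseteq> \<Omega>"
    and end_le: "\<And>y. y \<in> ball (x + b *\<^sub>R v) r \<Longrightarrow> norm (u y) \<le> \<tau>"
    and start: "\<And>y. y \<in> ball x r \<Longrightarrow> norm (u y - u x) \<le> \<eta>"
    and v: "norm v \<le> 2" "norm (u x) \<le> u x \<bullet> v"
  shows "ennreal (norm (u x) - 2 * \<eta> - 2 * \<tau>) \<le>
    4 * (\<integral>\<^sup>+s\<in>{0<..}. (\<integral>\<^sup>+y. f y * ennreal (mollifier \<epsilon> (x + s *\<^sub>R v) y) \<partial>lborel) \<partial>lborel)"
proof -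
  have \<Omega>[measurable]: "\<Omega> \<in> sets borel" using \<open>open \<Omega>\<close> by simp
  have r: "r > 0" using \<epsilon> by simp
  have \<tau>: "0 \<le> \<tau>" using end_le[of "x + b *\<^sub>R v"] r norm_ge_zero[of "u (x + b *\<^sub>R v)"] by (simp del: norm_ge_zero)
  have ball0: "ball x r \<subseteq> \<Omega>" using seg[of 0] b by simp
  have ballb: "ball (x + b *\<^sub>R v) r \<subseteq> \<Omega>" using seg[of b] b by simp
  have "x \<in> \<Omega>" using ball0 r by (meson centre_in_ball subsetD)
  then have "norm (u x) \<le> M" by (rule u(2))
  then have M: "0 \<le> M" using norm_ge_zero order_trans by blast
  have cb: "cball (x + s *\<^sub>R v) \<epsilon> \<subseteq> \<Omega>" if "s \<in> {0..b}" for s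
    using seg[OF that] \<epsilon> by (auto simp: subset_iff)
  let ?w = "\<lambda>y. indicator \<Omega> y * (u y \<bullet> v)"
  have "(\<lambda>y. (indicator \<Omega> y *\<^sub>R u y) \<bullet> v) \<in> borel_measurable borel"
    using borel_measurable_continuous_on_indicator[OF _ u(1)] by measurable
  then have w[measurable]: "?w \<in> borel_measurable borel" by simp
  have wM: "\<bar>?w y\<bar> \<le> M * norm v" for y
    using Cauchy_Schwarz_ineq2[of "u y" v] mult_right_mono[OF u(2)[of y], of "norm v"] M
    by (auto simp: indicator_def)
  have int: "integrable lborel (\<lambda>y. ?w y * mollifier \<epsilon> p y)" for p
  proof (rule Bochner_Integration.integrable_bound)
    show "integrable lborel (\<lambda>y. (M * norm v) * mollifier \<epsilon> p y)"
      using mollifier_integral[OF \<epsilon>(1), of p] by simp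
    have "\<bar>?w y\<bar> * mollifier \<epsilon> p y \<le> (M * norm v) * mollifier \<epsilon> p y" for y
      by (intro mult_right_mono wM mollifier_nonneg \<epsilon>)
    then show "AE y in lborel. norm (?w y * mollifier \<epsilon> p y) \<le> norm ((M * norm v) * mollifier \<epsilon> p y)"
      using mollifier_nonneg[OF \<epsilon>(1), of p] M by (intro AE_I2) (simp add: abs_mult)
  qed measurable
  have "norm (u x) - 2 * \<eta> = (\<integral>y. (norm (u x) - 2 * \<eta>) * mollifier \<epsilon> x y \<partial>lborel)"
    using mollifier_integral[OF \<epsilon>(1), of x] by simp
  also have "\<dots> \<le> (\<integral>y. ?w y * mollifier \<epsilon> x y \<partial>lborel)"
  proof (rule integral_mono)
    fix y
    show "(norm (u x) - 2 * \<eta>) * mollifier \<epsilon> x y \<le> ?w y * mollifier \<epsilon> x y"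
    proof (cases "y \<in> ball x \<epsilon>")
      case True
      then have y: "y \<in> ball x r" using \<epsilon> by auto
      have "norm (u y - u x) * norm v \<le> \<eta> * 2"
        using start[OF y] v norm_ge_zero[of "u y - u x"] norm_ge_zero[of v]
        by (intro mult_mono) linarith+
      moreover have "\<bar>(u y - u x) \<bullet> v\<bar> \<le> norm (u y - u x) * norm v" by (rule Cauchy_Schwarz_ineq2)
      ultimately have "norm (u x) - 2 * \<eta> \<le> u y \<bullet> v" using v by (simp add: inner_diff_left)
      then show ?thesis
        using y ball0 mollifier_nonneg[OF \<epsilon>(1), of x y] by (intro mult_right_mono) auto
    next
      case False
      then have "mollifier \<epsilon> x y = 0" by (intro mollifier_eq_0 \<epsilon>) (auto simp: dist_norm norm_minus_commute)
      then show ?thesis by simp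
    qed
  qed (use int mollifier_integral[OF \<epsilon>(1), of x] in auto)
  finally have 1: "norm (u x) - 2 * \<eta> \<le> (\<integral>y. ?w y * mollifier \<epsilon> x y \<partial>lborel)" .
  have "(\<integral>y. ?w y * mollifier \<epsilon> (x + b *\<^sub>R v) y \<partial>lborel) \<le> (\<integral>y. (2 * \<tau>) * mollifier \<epsilon> (x + b *\<^sub>R v) y \<partial>lborel)"
  proof (rule integral_mono)
    fix y
    show "?w y * mollifier \<epsilon> (x + b *\<^sub>R v) y \<le> (2 * \<tau>) * mollifier \<epsilon> (x + b *\<^sub>R v) y"
    proof (cases "y \<in> ball (x + b *\<^sub>R v) \<epsilon>")
      case True
      then have y: "y \<in> ball (x + b *\<^sub>R v) r" using \<epsilon> by auto
      have "norm (u y) * norm v \<le> \<tau> * 2"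
        using end_le[OF y] v \<tau> by (intro mult_mono) auto
      moreover have "\<bar>u y \<bullet> v\<bar> \<le> norm (u y) * norm v" by (rule Cauchy_Schwarz_ineq2)
      ultimately have "?w y \<le> 2 * \<tau>" using \<tau> by (auto simp: indicator_def)
      then show ?thesis
        using mollifier_nonneg[OF \<epsilon>(1), of "x + b *\<^sub>R v" y] by (intro mult_right_mono) auto
    next
      case False
      then have "mollifier \<epsilon> (x + b *\<^sub>R v) y = 0"
        by (intro mollifier_eq_0 \<epsilon>) (auto simp: dist_norm norm_minus_commute)
      then show ?thesis by simp
    qed
  qed (use int mollifier_integral[OF \<epsilon>(1), of "x + b *\<^sub>R v"] in auto)
  also have "\<dots> = 2 * \<tau>" using mollifier_integral[OF \<epsilon>(1), of "x + b *\<^sub>R v"] by simp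
  finally have 2: "(\<integral>y. ?w y * mollifier \<epsilon> (x + b *\<^sub>R v) y \<partial>lborel) \<le> 2 * \<tau>" .
  have 3: "(\<integral>y. ?w y * (mollifier \<epsilon> (x + b *\<^sub>R v) y - mollifier \<epsilon> x y) \<partial>lborel) =
      (\<integral>y. ?w y * mollifier \<epsilon> (x + b *\<^sub>R v) y \<partial>lborel) - (\<integral>y. ?w y * mollifier \<epsilon> x y \<partial>lborel)"
    using int by (simp only: right_diff_distrib Bochner_Integration.integral_diff)
  have "norm (u x) - 2 * \<eta> - 2 * \<tau> \<le> \<bar>\<integral>y. ?w y * (mollifier \<epsilon> (x + b *\<^sub>R v) y - mollifier \<epsilon> x y) \<partial>lborel\<bar>"
    using 1 2 3 by linarith
  then have "ennreal (norm (u x) - 2 * \<eta> - 2 * \<tau>) \<le>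
      ennreal \<bar>\<integral>y. ?w y * (mollifier \<epsilon> (x + b *\<^sub>R v) y - mollifier \<epsilon> x y) \<partial>lborel\<bar>"
    by (rule ennreal_leI)
  also have "\<dots> \<le> (\<integral>\<^sup>+s\<in>{0..b}. ennreal (norm v ^ 2) *
      (\<integral>\<^sup>+y\<in>\<Omega>. ennreal (norm (G y) * mollifier \<epsilon> (x + s *\<^sub>R v) y) \<partial>lebesgue) \<partial>lborel)"
    by (rule line_estimate[OF G \<open>open \<Omega>\<close> \<epsilon>(1) b cb u])
  also have "\<dots> \<le> (\<integral>\<^sup>+s. 4 * ((\<integral>\<^sup>+y. f y * ennreal (mollifier \<epsilon> (x + s *\<^sub>R v) y) \<partial>lborel) * indicator {0<..} s) \<partial>lborel)"
  proof (rule nn_integral_mono_AE)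
    have "AE s in lborel. s \<noteq> (0::real)" by (rule AE_lborel_singleton)
    then show "AE s in lborel. ennreal (norm v ^ 2) *
        (\<integral>\<^sup>+y\<in>\<Omega>. ennreal (norm (G y) * mollifier \<epsilon> (x + s *\<^sub>R v) y) \<partial>lebesgue) * indicator {0..b} s \<le>
        4 * ((\<integral>\<^sup>+y. f y * ennreal (mollifier \<epsilon> (x + s *\<^sub>R v) y) \<partial>lborel) * indicator {0<..} s)"
    proof eventually_elim
      fix s :: real assume s: "s \<noteq> 0"
      have "(\<integral>\<^sup>+y\<in>\<Omega>. ennreal (norm (G y) * mollifier \<epsilon> (x + s *\<^sub>R v) y) \<partial>lebesgue) \<le>
          (\<integral>\<^sup>+y. f y * ennreal (mollifier \<epsilon> (x + s *\<^sub>R v) y) \<partial>lebesgue)"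
      proof (rule nn_integral_mono_AE)
        show "AE y in lebesgue. ennreal (norm (G y) * mollifier \<epsilon> (x + s *\<^sub>R v) y) * indicator \<Omega> y \<le>
           f y * ennreal (mollifier \<epsilon> (x + s *\<^sub>R v) y)"
          using Gf by eventually_elim
            (auto simp: indicator_def ennreal_mult' intro!: mult_right_mono)
      qed
      also have "\<dots> = (\<integral>\<^sup>+y. f y * ennreal (mollifier \<epsilon> (x + s *\<^sub>R v) y) \<partial>lborel)"
        by (rule nn_integral_completion)
      finally have *: "(\<integral>\<^sup>+y\<in>\<Omega>. ennreal (norm (G y) * mollifier \<epsilon> (x + s *\<^sub>R v) y) \<partial>lebesgue) \<le> \<dots>" .
      have "norm v ^ 2 \<le> 2 ^ 2" using v(1) by (intro power_mono) auto
      then have "ennreal (norm v ^ 2) \<le> 4" using ennreal_leI[of "norm v ^ 2" 4] by simp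
      with * s show "ennreal (norm v ^ 2) *
        (\<integral>\<^sup>+y\<in>\<Omega>. ennreal (norm (G y) * mollifier \<epsilon> (x + s *\<^sub>R v) y) \<partial>lebesgue) * indicator {0..b} s \<le>
        4 * ((\<integral>\<^sup>+y. f y * ennreal (mollifier \<epsilon> (x + s *\<^sub>R v) y) \<partial>lborel) * indicator {0<..} s)"
        by (auto simp: indicator_def intro!: mult_mono)
    qed
  qed
  also have "\<dots> = 4 * (\<integral>\<^sup>+s\<in>{0<..}. (\<integral>\<^sup>+y. f y * ennreal (mollifier \<epsilon> (x + s *\<^sub>R v) y) \<partial>lborel) \<partial>lborel)"
    by (rule nn_integral_cmult) measurable
  finally show ?thesis .
qed

section \<open>The pointwise estimate\<close>

text \<open>The mollifier argument needs a closed segment inside \<Omega>, so the segment must stop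
  before the first exit time. Continuity of u on the closure lets it stop so late that the boundary
  bound is lost only by \<eta>.\<close>

lemma exit_or_vanish:
  fixes u :: "real^'n \<Rightarrow> real^'n" and x v :: "real^'n"
  assumes "open \<Omega>" "x \<in> \<Omega>" "v \<noteq> 0" and u: "continuous_on (closure \<Omega>) u"
    and bd: "bounded {y \<in> closure \<Omega>. u y \<noteq> 0}" and "0 \<le> \<tau>" "0 < \<eta>"
    and hit: "\<And>t. 0 < t \<Longrightarrow> x + t *\<^sub>R v \<in> frontier \<Omega> \<Longrightarrow> norm (u (x + t *\<^sub>R v)) \<le> \<tau>"
  obtains b where "0 \<le> b" "\<And>s. s \<in> {0..b} \<Longrightarrow> x + s *\<^sub>R v \<in> \<Omega>" "norm (u (x + b *\<^sub>R v)) < \<tau> + \<eta>"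
proof (cases "\<forall>s\<ge>0. x + s *\<^sub>R v \<in> \<Omega>")
  case True
  obtain R where R: "\<And>y. y \<in> closure \<Omega> \<Longrightarrow> u y \<noteq> 0 \<Longrightarrow> norm y \<le> R"
    using bd unfolding bounded_iff by auto
  \<comment> \<open>Far enough along the ray that |x + b v| exceeds the bound R on the
    support.\<close>
  define b where "b = (\<bar>R\<bar> + norm x + 1) / norm v"
  have b: "b \<ge> 0" by (simp add: b_def)
  have "norm (b *\<^sub>R v) = \<bar>R\<bar> + norm x + 1" using \<open>v \<noteq> 0\<close> by (simp add: b_def)
  moreover have "norm (b *\<^sub>R v) \<le> norm (x + b *\<^sub>R v) + norm x"
    using norm_triangle_ineq4[of "x + b *\<^sub>R v" x] by simp
  ultimately have "norm (x + b *\<^sub>R v) > R" by linarith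
  moreover have "x + b *\<^sub>R v \<in> closure \<Omega>" using True b closure_subset by blast
  ultimately have "u (x + b *\<^sub>R v) = 0" using R[of "x + b *\<^sub>R v"] by linarith
  with b True assms(6,7) show thesis by (intro that[of b]) auto
next
  case False
  define S where "S = {s. 0 \<le> s \<and> x + s *\<^sub>R v \<notin> \<Omega>}"
  define t where "t = Inf S"
  have S: "S \<noteq> {}" "bdd_below S" using False by (auto simp: S_def intro!: bdd_belowI[of _ 0])
  have "closed S"
  proof -
    have "S = {0..} \<inter> (\<lambda>s. x + s *\<^sub>R v) -` (- \<Omega>)" by (auto simp: S_def)
    then show ?thesis
      using \<open>open \<Omega>\<close> by (auto intro!: continuous_closed_vimage continuous_intros)
  qed
  then have tS: "t \<in> S" unfolding t_def using S by (intro closed_contains_Inf)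
  have below: "x + s *\<^sub>R v \<in> \<Omega>" if "0 \<le> s" "s < t" for s
    using that cInf_lower[OF _ S(2), of s] by (force simp: t_def S_def)
  have t: "t > 0" using tS \<open>x \<in> \<Omega>\<close> by (cases "t = 0") (auto simp: S_def)
  \<comment> \<open>Times increasing to the first exit time t but smaller than it; along them u
    tends to its value at the boundary point.\<close>
  define a where "a k = t * (1 - 1 / real (k + 2))" for k :: nat
  have a: "0 \<le> a k" "a k < t" for k using t by (auto simp: a_def)
  have lim: "(\<lambda>k. x + a k *\<^sub>R v) \<longlonglongrightarrow> x + (t * (1 - 0)) *\<^sub>R v"
    unfolding a_def by (intro tendsto_intros LIMSEQ_ignore_initial_segment[OF lim_1_over_n])
  then have lim: "(\<lambda>k. x + a k *\<^sub>R v) \<longlonglongrightarrow> x + t *\<^sub>R v" by simp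
  have cl: "x + t *\<^sub>R v \<in> closure \<Omega>"
    unfolding closure_sequential using lim below[OF a] by (intro exI[of _ "\<lambda>k. x + a k *\<^sub>R v"]) simp
  then have "x + t *\<^sub>R v \<in> frontier \<Omega>"
    using tS \<open>open \<Omega>\<close> by (simp add: frontier_def interior_open S_def)
  then have le: "norm (u (x + t *\<^sub>R v)) \<le> \<tau>" using hit t by blast
  have "(\<lambda>k. norm (u (x + a k *\<^sub>R v))) \<longlonglongrightarrow> norm (u (x + t *\<^sub>R v))"
    using below[OF a] closure_subset
    by (intro tendsto_norm continuous_on_tendsto_compose[OF u lim cl] always_eventually) blast
  then have "eventually (\<lambda>k. norm (u (x + a k *\<^sub>R v)) < \<tau> + \<eta>) sequentially"
    using le \<open>0 < \<eta>\<close> by (intro order_tendstoD) auto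
  then obtain k where "norm (u (x + a k *\<^sub>R v)) < \<tau> + \<eta>"
    by (auto simp: eventually_sequentially)
  then show thesis using a[of k] below by (intro that[of "a k"]) auto
qed

text \<open>For a single direction, compactness of the segment and continuity of u give some radius
  r. One mollification scale must serve many directions at once, so the directions are sorted by
  their radius into an increasing sequence of sets W k that covers the ball outside
  \<open>Bad\<close>; by continuity of the measure from below, one of them already has definite
  measure.\<close>

lemma good_directions:
  fixes u :: "real^'n \<Rightarrow> real^'n" and x e :: "real^'n"
  assumes "open \<Omega>" "x \<in> \<Omega>" and u: "continuous_on (closure \<Omega>) u"
    and bd: "bounded {y \<in> closure \<Omega>. u y \<noteq> 0}" and "0 \<le> \<tau>" "0 < \<eta>" and e: "norm e = 1"
    and Bad[measurable]: "Bad \<in> sets borel"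
    and Bad_le: "emeasure lborel Bad \<le> ennreal (measure lborel (ball (0::real^'n) (1/4)) / 2)"
    and hit: "\<And>t v. 0 < t \<Longrightarrow> 1 < norm v \<Longrightarrow> norm v < 2 \<Longrightarrow> x + t *\<^sub>R v \<in> frontier \<Omega> \<Longrightarrow> v \<notin> Bad \<Longrightarrow>
      norm (u (x + t *\<^sub>R v)) \<le> \<tau>"
  obtains V r where "V \<in> sets borel" "V \<subseteq> ball ((3/2) *\<^sub>R e) (1/4)" "0 < r"
    "ennreal (measure lborel (ball (0::real^'n) (1/4)) / 4) \<le> emeasure lborel V"
    "\<And>v. v \<in> V \<Longrightarrow> \<exists>b\<ge>0. (\<forall>s\<in>{0..b}. ball (x + s *\<^sub>R v) r \<subseteq> \<Omega>) \<and> (\<forall>y\<in>ball (x + b *\<^sub>R v) r. norm (u y) \<le> \<tau> + \<eta>)"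
proof -
  \<comment> \<open>On this ball v differs from 3e/2 by less than 1/4, so 1 < |v| < 2 and the inner
    product of e with v exceeds 1.\<close>
  let ?B = "ball ((3/2) *\<^sub>R e) (1/4)" and ?c = "measure lborel (ball (0::real^'n) (1/4))"
  \<comment> \<open>The strict inequality on r leaves room for a perturbation of v, which makes W k
    open and hence measurable.\<close>
  define W where "W k = {v. \<exists>b\<ge>0. \<exists>r>1 / real (Suc k). (\<forall>s\<in>{0..b}. ball (x + s *\<^sub>R v) r \<subseteq> \<Omega>) \<and>
      (\<forall>y\<in>ball (x + b *\<^sub>R v) r. norm (u y) \<le> \<tau> + \<eta>)}" for k
  have op: "open (W k)" for k
    unfolding open_dist
  proof
    fix v assume "v \<in> W k"
    then obtain b r where b: "b \<ge> 0" and r: "r > 1 / real (Suc k)"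
      and seg: "\<And>s. s \<in> {0..b} \<Longrightarrow> ball (x + s *\<^sub>R v) r \<subseteq> \<Omega>"
      and fin: "\<And>y. y \<in> ball (x + b *\<^sub>R v) r \<Longrightarrow> norm (u y) \<le> \<tau> + \<eta>"
      unfolding W_def by blast
    define d where "d = (r - 1 / real (Suc k)) / 2"
    have d: "d > 0" using r by (simp add: d_def)
    have "v' \<in> W k" if v': "dist v' v < d / (b + 1)" for v'
    proof -
      have sub: "ball (x + s *\<^sub>R v') (r - d) \<subseteq> ball (x + s *\<^sub>R v) r" if s: "s \<in> {0..b}" for s
      proof
        fix y assume y: "y \<in> ball (x + s *\<^sub>R v') (r - d)"
        have "dist (x + s *\<^sub>R v) (x + s *\<^sub>R v') = s * dist v' v"
          using s by (simp add: dist_norm scaleR_diff_right[symmetric] norm_minus_commute)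
        also have "\<dots> \<le> b * (d / (b + 1))" using s v' b by (intro mult_mono) auto
        also have "\<dots> \<le> d" using b d by (simp add: field_simps)
        finally show "y \<in> ball (x + s *\<^sub>R v) r"
          using y dist_triangle[of "x + s *\<^sub>R v" y "x + s *\<^sub>R v'"] by simp
      qed
      have mid: "c < r - (r - c) / 2" if "c < r" for c :: real using that by (simp add: field_simps)
      have "r - d > 1 / real (Suc k)" using mid[OF r] by (simp only: d_def)
      moreover have "\<forall>s\<in>{0..b}. ball (x + s *\<^sub>R v') (r - d) \<subseteq> \<Omega>" using sub seg by blast
      moreover have "\<forall>y\<in>ball (x + b *\<^sub>R v') (r - d). norm (u y) \<le> \<tau> + \<eta>" using sub[of b] fin b by auto
      ultimately show ?thesis unfolding W_def using b by blast
    qed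
    then show "\<exists>e>0. \<forall>y. dist y v < e \<longrightarrow> y \<in> W k" using b d by (intro exI[of _ "d / (b + 1)"]) auto
  qed
  then have Wm[measurable]: "W k \<in> sets borel" for k by simp
  have nv: "5/4 < norm v" "norm v < 7/4" if "v \<in> ?B" for v
  proof -
    have "norm ((3/2) *\<^sub>R e) = 3/2" using e by simp
    moreover have "norm ((3/2) *\<^sub>R e - v) < 1/4" using that by (simp add: dist_norm)
    ultimately show "5/4 < norm v" "norm v < 7/4"
      using norm_triangle_ineq2[of "(3/2) *\<^sub>R e" v] norm_triangle_ineq3[of "(3/2) *\<^sub>R e" v] by linarith+
  qed
  have cover: "?B - Bad \<subseteq> (\<Union>k. (?B - Bad) \<inter> W k)"
  proof
    fix v assume v: "v \<in> ?B - Bad"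
    then have nv': "1 < norm v" "norm v < 2" using nv[of v] by auto
    obtain b where b: "0 \<le> b" "\<And>s. s \<in> {0..b} \<Longrightarrow> x + s *\<^sub>R v \<in> \<Omega>" "norm (u (x + b *\<^sub>R v)) < \<tau> + \<eta>"
    proof (rule exit_or_vanish[OF assms(1,2) _ u bd assms(5,6), of v])
      show "v \<noteq> 0" using nv' by auto
      show "norm (u (x + t *\<^sub>R v)) \<le> \<tau>" if "0 < t" "x + t *\<^sub>R v \<in> frontier \<Omega>" for t
        using hit[OF that(1) nv' that(2)] v by blast
    qed blast
    have "compact ((\<lambda>s. x + s *\<^sub>R v) ` {0..b})" by (intro compact_continuous_image continuous_intros) auto
    moreover have "(\<lambda>s. x + s *\<^sub>R v) ` {0..b} \<subseteq> \<Omega>" using b by auto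
    ultimately obtain r1 where r1: "r1 > 0" "(\<Union>y\<in>(\<lambda>s. x + s *\<^sub>R v) ` {0..b}. cball y r1) \<subseteq> \<Omega>"
      using compact_subset_open_imp_cball_epsilon_subset[OF _ \<open>open \<Omega>\<close>] by metis
    have xb: "x + b *\<^sub>R v \<in> \<Omega>" using b by simp
    have "continuous_on \<Omega> u" using u closure_subset continuous_on_subset by blast
    then have "continuous (at (x + b *\<^sub>R v)) u" using xb \<open>open \<Omega>\<close> continuous_on_eq_continuous_at by blast
    then have "(u \<longlongrightarrow> u (x + b *\<^sub>R v)) (nhds (x + b *\<^sub>R v))"
      by (simp only: isCont_def tendsto_at_iff_tendsto_nhds)
    then have "\<forall>\<^sub>F y in nhds (x + b *\<^sub>R v). norm (u y) < \<tau> + \<eta>"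
      using b(3) by (intro order_tendstoD(2)[OF tendsto_norm])
    then obtain r2 where r2: "r2 > 0" "\<And>y. dist y (x + b *\<^sub>R v) < r2 \<Longrightarrow> norm (u y) < \<tau> + \<eta>"
      unfolding eventually_nhds_metric by blast
    have "min r1 r2 > 0" using r1 r2 by simp
    then obtain k where k: "1 / real (Suc k) < min r1 r2"
      using reals_Archimedean[of "min r1 r2"] by (auto simp: inverse_eq_divide)
    have "\<forall>y\<in>ball (x + b *\<^sub>R v) (min r1 r2). norm (u y) \<le> \<tau> + \<eta>"
      using r2(2) by (auto simp: dist_commute less_imp_le)
    moreover have "\<forall>s\<in>{0..b}. ball (x + s *\<^sub>R v) (min r1 r2) \<subseteq> \<Omega>"
      using r1(2) by fastforce
    ultimately have "v \<in> W k" unfolding W_def using b(1) k by blast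
    with v show "v \<in> (\<Union>k. (?B - Bad) \<inter> W k)" by blast
  qed
  have vol: "emeasure lborel ?B = ennreal ?c"
    using emeasure_ball[of "1/4" "(3/2) *\<^sub>R e"] content_ball[of "1/4" "0::real^'n"] by simp
  have c: "?c > 0" by (simp add: content_ball_pos)
  have inc: "incseq (\<lambda>k. (?B - Bad) \<inter> W k)"
  proof (rule incseq_SucI)
    fix k
    have "1 / real (Suc (Suc k)) \<le> 1 / real (Suc k)" by (simp add: field_simps)
    then have "W k \<subseteq> W (Suc k)" unfolding W_def using order_le_less_trans by blast
    then show "(?B - Bad) \<inter> W k \<subseteq> (?B - Bad) \<inter> W (Suc k)" by blast
  qed
  \<comment> \<open>At least half of the ball survives the removal of \<open>Bad\<close>. Asking
    only for a quarter gives the strict inequality needed to reach a member of the increasing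
    union.\<close>
  have "ennreal (?c / 4) < emeasure lborel (?B - Bad)"
  proof -
    have "emeasure lborel ?B \<le> emeasure lborel ((?B - Bad) \<union> Bad)"
      by (intro emeasure_mono) auto
    also have "\<dots> \<le> emeasure lborel (?B - Bad) + emeasure lborel Bad"
      by (intro emeasure_subadditive) auto
    also have "\<dots> \<le> emeasure lborel (?B - Bad) + ennreal (?c / 2)"
      by (intro add_left_mono Bad_le)
    finally have *: "ennreal ?c \<le> emeasure lborel (?B - Bad) + ennreal (?c / 2)" unfolding vol .
    show ?thesis
    proof (rule ccontr)
      assume "\<not> ?thesis"
      then have "emeasure lborel (?B - Bad) + ennreal (?c / 2) \<le> ennreal (?c / 4) + ennreal (?c / 2)"
        by (intro add_right_mono) auto
      with * have "ennreal ?c \<le> ennreal (?c / 4) + ennreal (?c / 2)" by (rule order_trans)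
      also have "\<dots> = ennreal (?c / 4 + ?c / 2)"
        using c by (intro ennreal_plus[symmetric]) auto
      finally have "?c \<le> ?c / 4 + ?c / 2" using c by (subst (asm) ennreal_le_iff) auto
      then show False using c by linarith
    qed
  qed
  also have "\<dots> \<le> emeasure lborel (\<Union>k. (?B - Bad) \<inter> W k)"
    by (intro emeasure_mono cover) auto
  also have "\<dots> = (SUP k. emeasure lborel ((?B - Bad) \<inter> W k))"
    using inc by (intro SUP_emeasure_incseq[symmetric]) auto
  finally obtain k where k: "ennreal (?c / 4) < emeasure lborel ((?B - Bad) \<inter> W k)"
    unfolding less_SUP_iff by blast
  show thesis
  proof (rule that[of "(?B - Bad) \<inter> W k" "1 / real (Suc k)"])
    fix v assume "v \<in> (?B - Bad) \<inter> W k"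
    then obtain b r where "b \<ge> 0" "r > 1 / real (Suc k)"
      "\<forall>s\<in>{0..b}. ball (x + s *\<^sub>R v) r \<subseteq> \<Omega>" "\<forall>y\<in>ball (x + b *\<^sub>R v) r. norm (u y) \<le> \<tau> + \<eta>"
      unfolding W_def by blast
    then show "\<exists>b\<ge>0. (\<forall>s\<in>{0..b}. ball (x + s *\<^sub>R v) (1 / real (Suc k)) \<subseteq> \<Omega>) \<and>
        (\<forall>y\<in>ball (x + b *\<^sub>R v) (1 / real (Suc k)). norm (u y) \<le> \<tau> + \<eta>)"
      by (intro exI[of _ b]) (auto simp: subset_iff)
  qed (use k in auto)
qed

text \<open>Rays which leave $\Omega$ through a boundary point where $|u| > \tau$ are discarded; the
  others, which by hypothesis make up a fixed proportion of the directions near $u(x)$, carry the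
  estimate.\<close>

lemma pointwise_estimate:
  assumes n: "CARD('n::finite) \<ge> 2"
  shows "\<exists>C>0. \<forall>\<Omega> (u :: real^'n \<Rightarrow> real^'n) G (f :: real^'n \<Rightarrow> ennreal) x \<tau> Bad.
    open \<Omega> \<longrightarrow> has_sym_grad \<Omega> u G \<longrightarrow> continuous_on (closure \<Omega>) u \<longrightarrow>
    bounded {y \<in> closure \<Omega>. u y \<noteq> 0} \<longrightarrow> f \<in> borel_measurable borel \<longrightarrow>
    (AE y in lebesgue. y \<in> \<Omega> \<longrightarrow> ennreal (norm (G y)) \<le> f y) \<longrightarrow>
    x \<in> \<Omega> \<longrightarrow> 0 \<le> \<tau> \<longrightarrow> Bad \<in> sets borel \<longrightarrow>
    emeasure lborel Bad \<le> ennreal (measure lborel (ball (0::real^'n) (1/4)) / 2) \<longrightarrow>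
    (\<forall>t v. 0 < t \<longrightarrow> 1 < norm v \<longrightarrow> norm v < 2 \<longrightarrow> x + t *\<^sub>R v \<in> frontier \<Omega> \<longrightarrow> v \<notin> Bad \<longrightarrow>
      norm (u (x + t *\<^sub>R v)) \<le> \<tau>) \<longrightarrow>
    ennreal (norm (u x)) \<le> ennreal (2 * \<tau>) +
      ennreal C * (\<integral>\<^sup>+y. f y * ennreal (norm (y - x) powr (- (real CARD('n) - 1))) \<partial>lborel)"
proof -
  let ?c = "measure lborel (ball (0::real^'n) (1/4))"
  let ?I = "\<lambda>f x::real^'n. \<integral>\<^sup>+y. f y * ennreal (norm (y - x) powr (- (real CARD('n) - 1))) \<partial>lborel"
  have c: "?c > 0" by (simp add: content_ball_pos)
  obtain C where C: "C > 0" "\<And>(f :: real^'n \<Rightarrow> ennreal) x \<epsilon>. \<epsilon> > 0 \<Longrightarrow> f \<in> borel_measurable borel \<Longrightarrow>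
    (\<integral>\<^sup>+w. (\<integral>\<^sup>+y. f y * ennreal (mollifier \<epsilon> w y) \<partial>lborel) * ennreal (norm (w - x) powr (- (real CARD('n) - 1))) \<partial>lborel) \<le>
      ennreal C * ?I f x"
    using nn_integral_mollified_kernel_le[OF n] by blast
  \<comment> \<open>The factors come from |v|^2 <= 4, from the passage from rays to the kernel, from
    the mollification, and from dividing by the measure of the good directions.\<close>
  define C1 where "C1 = 4 * 2 ^ (CARD('n) - 1) * C * (4 / ?c)"
  have C1: "C1 > 0" using C c by (simp add: C1_def)
  have "ennreal (norm (u x)) \<le> ennreal (2 * \<tau>) + ennreal C1 * ?I f x"
    if "open \<Omega>" and G: "has_sym_grad \<Omega> u G" and u: "continuous_on (closure \<Omega>) u"
      and bd: "bounded {y \<in> closure \<Omega>. u y \<noteq> 0}" and f[measurable]: "f \<in> borel_measurable borel"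
      and Gf: "AE y in lebesgue. y \<in> \<Omega> \<longrightarrow> ennreal (norm (G y)) \<le> f y"
      and x: "x \<in> \<Omega>" and \<tau>: "0 \<le> \<tau>" and Bad: "Bad \<in> sets borel"
      "emeasure lborel Bad \<le> ennreal (?c / 2)"
      and hit: "\<And>t v. 0 < t \<Longrightarrow> 1 < norm v \<Longrightarrow> norm v < 2 \<Longrightarrow> x + t *\<^sub>R v \<in> frontier \<Omega> \<Longrightarrow> v \<notin> Bad \<Longrightarrow>
        norm (u (x + t *\<^sub>R v)) \<le> \<tau>"
    for \<Omega> and u :: "real^'n \<Rightarrow> real^'n" and G and f :: "real^'n \<Rightarrow> ennreal" and x \<tau> Bad
  proof (cases "u x = 0")
    case False
    define e where "e = u x /\<^sub>R norm (u x)"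
    have e: "norm e = 1" using False by (simp add: e_def)
    have u\<Omega>: "continuous_on \<Omega> u" using u closure_subset continuous_on_subset by blast
    obtain M where M: "\<And>y. y \<in> closure \<Omega> \<Longrightarrow> norm (u y) \<le> M"
    proof -
      let ?S = "{y \<in> closure \<Omega>. u y \<noteq> 0}"
      have "compact (closure ?S)" using bd by (simp add: compact_closure)
      moreover have sub: "closure ?S \<subseteq> closure \<Omega>" by (rule closure_minimal) auto
      ultimately have "bounded (u ` closure ?S)"
        using u by (intro compact_imp_bounded compact_continuous_image) (auto intro: continuous_on_subset)
      then obtain M where "\<And>y. y \<in> closure ?S \<Longrightarrow> norm (u y) \<le> M" unfolding bounded_iff by auto
      then have "norm (u y) \<le> \<bar>M\<bar>" if "y \<in> closure \<Omega>" for y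
        using that closure_subset[of ?S] abs_ge_self[of M] by (cases "u y = 0") (auto intro: order_trans)
      then show thesis by (rule that)
    qed
    then have M\<Omega>: "\<And>y. y \<in> \<Omega> \<Longrightarrow> norm (u y) \<le> M" using closure_subset by blast
    \<comment> \<open>One \<eta> pays for the oscillation of u near x, the other for stopping short
      of the boundary. With \<eta> = \<delta>/4 the total loss at the end is \<delta>.\<close>
    have main: "ennreal (norm (u x) - 2 * \<eta> - 2 * (\<tau> + \<eta>)) \<le> ennreal C1 * ?I f x" if \<eta>: "\<eta> > 0" for \<eta>
    proof -
      obtain V r where V: "V \<in> sets borel" "V \<subseteq> ball ((3/2) *\<^sub>R e) (1/4)" "0 < r"
        "ennreal (?c / 4) \<le> emeasure lborel V"
        "\<And>v. v \<in> V \<Longrightarrow> \<exists>b\<ge>0. (\<forall>s\<in>{0..b}. ball (x + s *\<^sub>R v) r \<subseteq> \<Omega>) \<and> (\<forall>y\<in>ball (x + b *\<^sub>R v) r. norm (u y) \<le> \<tau> + \<eta>)"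
        using good_directions[OF \<open>open \<Omega>\<close> x u bd \<tau> \<eta> e Bad hit] by blast
      note V(1)[measurable]
      have "isCont u x" using u\<Omega> x \<open>open \<Omega>\<close> continuous_on_eq_continuous_at by blast
      then obtain r2 where r2: "r2 > 0" "\<And>y. dist y x < r2 \<Longrightarrow> norm (u y - u x) < \<eta>"
        using \<eta> unfolding continuous_at_eps_delta dist_norm by blast
      \<comment> \<open>This radius serves both the tubes around the segments and the continuity of
        u at x; the scale r'/2 is the same for all v in V.\<close>
      define r' where "r' = min r r2"
      have r': "0 < r'" "0 < r' / 2" "r' / 2 < r'" using V(3) r2 by (auto simp: r'_def)
      define H where "H w = (\<integral>\<^sup>+y. f y * ennreal (mollifier (r' / 2) w y) \<partial>lborel)" for w
      have H[measurable]: "H \<in> borel_measurable borel" unfolding H_def by measurable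
      let ?a = "ennreal (norm (u x) - 2 * \<eta> - 2 * (\<tau> + \<eta>))"
      have nv: "1 < norm v" "norm v < 2" "norm (u x) \<le> u x \<bullet> v" if "v \<in> V" for v
      proof -
        have d: "norm (v - (3/2) *\<^sub>R e) < 1/4" using that V(2) by (auto simp: dist_norm norm_minus_commute)
        moreover have "norm ((3/2) *\<^sub>R e) = 3/2" using e by simp
        ultimately show "1 < norm v" "norm v < 2"
          using norm_triangle_ineq2[of v "(3/2) *\<^sub>R e"] norm_triangle_ineq2[of "(3/2) *\<^sub>R e" v]
          by (simp_all only: norm_minus_commute)
        have ue: "u x = norm (u x) *\<^sub>R e" using False by (simp add: e_def)
        have "\<bar>e \<bullet> (v - (3/2) *\<^sub>R e)\<bar> \<le> norm e * norm (v - (3/2) *\<^sub>R e)" by (rule Cauchy_Schwarz_ineq2)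
        moreover have "e \<bullet> e = 1" using e by (simp add: dot_square_norm)
        ultimately have "1 \<le> e \<bullet> v" using d e by (simp add: inner_diff_right)
        then have "norm (u x) * 1 \<le> norm (u x) * (e \<bullet> v)" by (intro mult_left_mono) auto
        also have "\<dots> = u x \<bullet> v" by (subst (2) ue) simp
        finally show "norm (u x) \<le> u x \<bullet> v" by simp
      qed
      have dir: "?a \<le> 4 * (\<integral>\<^sup>+s\<in>{0<..}. H (x + s *\<^sub>R v) \<partial>lborel)" if v: "v \<in> V" for v
      proof -
        obtain b where b: "b \<ge> 0" "\<forall>s\<in>{0..b}. ball (x + s *\<^sub>R v) r \<subseteq> \<Omega>"
          "\<forall>y\<in>ball (x + b *\<^sub>R v) r. norm (u y) \<le> \<tau> + \<eta>" using V(5)[OF v] by blast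
        show ?thesis
          unfolding H_def
        proof (rule direction_estimate[OF G \<open>open \<Omega>\<close> u\<Omega> M\<Omega> f Gf r'(2,3) b(1)])
          show "ball (x + s *\<^sub>R v) r' \<subseteq> \<Omega>" if "s \<in> {0..b}" for s
          proof -
            have "ball (x + s *\<^sub>R v) r' \<subseteq> ball (x + s *\<^sub>R v) r" by (auto simp: r'_def)
            then show ?thesis using b(2) that by blast
          qed
          show "norm (u y) \<le> \<tau> + \<eta>" if "y \<in> ball (x + b *\<^sub>R v) r'" for y
            using b(3) that by (auto simp: r'_def)
          show "norm (u y - u x) \<le> \<eta>" if "y \<in> ball x r'" for y
            using r2(2)[of y] that by (auto simp: r'_def dist_commute)
        qed (use nv[OF v] in auto)
      qed
      \<comment> \<open>The left-hand side of \<open>dir\<close> does not depend on v, so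
        integration over V multiplies it by at least c/4; the right-hand side is enlarged from V to
        the annulus 1 < |v| < 2.\<close>
      have "?a * ennreal (?c / 4) \<le> ?a * emeasure lborel V" by (intro mult_left_mono V) auto
      also have "\<dots> = (\<integral>\<^sup>+v\<in>V. ?a \<partial>lborel)" by (simp add: nn_integral_cmult_indicator)
      also have "\<dots> \<le> (\<integral>\<^sup>+v. 4 * ((\<integral>\<^sup>+s\<in>{0<..}. H (x + s *\<^sub>R v) \<partial>lborel) * indicator {v. 1 < norm v \<and> norm v < 2} v) \<partial>lborel)"
        using dir nv by (intro nn_integral_mono) (auto simp: indicator_def)
      also have "\<dots> = 4 * (\<integral>\<^sup>+v\<in>{v. 1 < norm v \<and> norm v < 2}. (\<integral>\<^sup>+s\<in>{0<..}. H (x + s *\<^sub>R v) \<partial>lborel) \<partial>lborel)"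
        by (rule nn_integral_cmult) measurable
      also have "\<dots> \<le> 4 * (ennreal (2 ^ (CARD('n) - 1)) * (ennreal C * ?I f x))"
      proof -
        have "(\<integral>\<^sup>+w. H w * ennreal (norm (w - x) powr (- (real CARD('n) - 1))) \<partial>lborel) \<le> ennreal C * ?I f x"
          unfolding H_def by (rule C(2)[OF r'(2) f])
        then show ?thesis
          by (intro mult_left_mono order_trans[OF nn_integral_rays_le[OF H n]]) simp_all
      qed
      finally have "ennreal (4 / ?c) * (?a * ennreal (?c / 4)) \<le>
          ennreal (4 / ?c) * (4 * (ennreal (2 ^ (CARD('n) - 1)) * (ennreal C * ?I f x)))"
        by (rule mult_left_mono) simp
      also have "ennreal (4 / ?c) * (?a * ennreal (?c / 4)) = ?a"
      proof -
        have "ennreal (4 / ?c) * ennreal (?c / 4) = 1"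
          using c by (simp flip: ennreal_mult')
        then show ?thesis by (simp only: mult.left_commute[of "ennreal (4 / ?c)"] mult_1_right)
      qed
      also have "ennreal (4 / ?c) * (4 * (ennreal (2 ^ (CARD('n) - 1)) * (ennreal C * ?I f x))) = ennreal C1 * ?I f x"
      proof -
        have "ennreal C1 = 4 * ennreal (2 ^ (CARD('n) - 1)) * ennreal C * ennreal (4 / ?c)"
        proof -
          have nn: "0 \<le> C" "0 \<le> 4 / ?c" "(0::real) \<le> 2 ^ (CARD('n) - 1)" using C(1) c by auto
          show ?thesis
            unfolding C1_def ennreal_mult''[OF nn(1)] ennreal_mult''[OF nn(2)] ennreal_mult''[OF nn(3)]
            by (simp only: ennreal_numeral)
        qed
        then show ?thesis by (simp only: mult_ac)
      qed
      finally show ?thesis .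
    qed
    show ?thesis
    proof (rule ennreal_le_epsilon)
      fix \<delta> :: real assume \<delta>: "\<delta> > 0"
      have "ennreal (norm (u x)) \<le> ennreal (2 * \<tau> + \<delta> + (norm (u x) - 2 * (\<delta> / 4) - 2 * (\<tau> + \<delta> / 4)))"
        by (rule ennreal_leI) simp
      also have "\<dots> \<le> ennreal (2 * \<tau> + \<delta>) + ennreal (norm (u x) - 2 * (\<delta> / 4) - 2 * (\<tau> + \<delta> / 4))"
        by (cases "norm (u x) - 2 * (\<delta> / 4) - 2 * (\<tau> + \<delta> / 4) \<ge> 0")
          (use \<delta> \<tau> in \<open>auto simp: ennreal_plus[symmetric] ennreal_neg intro!: ennreal_leI simp del: ennreal_plus\<close>)
      also have "\<dots> \<le> ennreal (2 * \<tau> + \<delta>) + ennreal C1 * ?I f x"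
        using \<delta> by (intro add_left_mono main) auto
      also have "\<dots> = ennreal (2 * \<tau>) + ennreal C1 * ?I f x + ennreal \<delta>"
        using \<delta> \<tau> by (simp add: ennreal_plus ac_simps)
      finally show "ennreal (norm (u x)) \<le> ennreal (2 * \<tau>) + ennreal C1 * ?I f x + ennreal \<delta>" .
    qed
  qed simp
  then show ?thesis using C1 by (intro exI[of _ C1]) auto
qed

section \<open>Directions hitting the boundary\<close>

text \<open>Let e be the unit vector from x to y and R = |x-y|. If x + t v is within d of y, then v
  = (R/t) e + w/t with |w| <= d. When 2d <= R, the bound |v| < 2 forces t >= R/4, so v is within
  4d/R of the segment from 0 to 4e. A neighbourhood of that width has volume of order (d/R)^(n-1).
  Finitely many balls cover it, which settles measurability.\<close>

lemma cone_in_small_set: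
  assumes n: "CARD('n::finite) \<ge> 2"
  shows "\<exists>C>0. \<forall>(x::real^'n) y. \<forall>d>0. x \<noteq> y \<longrightarrow> (\<exists>S\<in>sets borel.
    emeasure lborel S \<le> ennreal (C * d ^ (CARD('n) - 1) * norm (x - y) powr (- (real CARD('n) - 1))) \<and>
    (\<forall>t v. 0 < t \<longrightarrow> 1 < norm v \<longrightarrow> norm v < 2 \<longrightarrow> x + t *\<^sub>R v \<in> cball y d \<longrightarrow> v \<in> S))"
proof -
  let ?n = "CARD('n)"
  let ?V = "unit_ball_vol (real ?n)"
  have V: "?V > 0" by simp
  \<comment> \<open>The number of balls is at most 2R/d, and 8^n comes from their radius 2q = 8d/R.
    The constant also covers the case 2d > R, where the ball of radius 2 serves as S.\<close>
  define C where "C = 2 * 8 ^ ?n * ?V"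
  have C: "C > 0" using V by (simp add: C_def)
  have "\<exists>S\<in>sets borel. emeasure lborel S \<le> ennreal (C * d ^ (?n - 1) * norm (x - y) powr (- (real ?n - 1))) \<and>
    (\<forall>t v. 0 < t \<longrightarrow> 1 < norm v \<longrightarrow> norm v < 2 \<longrightarrow> x + t *\<^sub>R v \<in> cball y d \<longrightarrow> v \<in> S)"
    if d: "d > 0" and xy: "x \<noteq> y" for x y :: "real^'n" and d
  proof -
    define R where "R = norm (y - x)"
    have R: "R > 0" using xy by (simp add: R_def)
    have R': "norm (x - y) = R" by (simp add: R_def norm_minus_commute)
    have "R powr (- (real ?n - 1)) = inverse (R ^ (?n - 1))"
    proof -
      have e: "real ?n - 1 = real (?n - 1)" using n by simp
      show ?thesis unfolding powr_minus e using R by (subst powr_realpow) auto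
    qed
    then have pow: "d ^ (?n - 1) * R powr (- (real ?n - 1)) = (d / R) ^ (?n - 1)"
      by (simp only: power_divide divide_inverse power_mult_distrib power_inverse)
    show ?thesis
    proof (cases "2 * d \<le> R")
      case False
      have "emeasure lborel (ball (0::real^'n) 2) = ennreal (?V * 2 ^ ?n)"
        using emeasure_ball[of 2 "0::real^'n"] by simp
      also have "\<dots> \<le> ennreal (C * (d ^ (?n - 1) * R powr (- (real ?n - 1))))"
      proof (rule ennreal_leI)
        have "1 / 2 \<le> d / R" using False R by (simp add: field_simps)
        then have "(1 / 2) ^ (?n - 1) \<le> (d / R) ^ (?n - 1)" by (intro power_mono) auto
        moreover have "(2::real) ^ ?n \<le> 2 * 8 ^ ?n * (1 / 2) ^ (?n - 1)"
        proof -
          obtain p where p: "?n = Suc p" using n by (cases ?n) auto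
          have "(8::real) ^ p * (1 / 2) ^ p = 4 ^ p" by (simp flip: power_mult_distrib)
          moreover have "(2::real) ^ p \<le> 4 ^ p" by (rule power_mono) auto
          moreover have "(0::real) \<le> 4 ^ p" by simp
          ultimately show ?thesis unfolding p by (simp, linarith)
        qed
        moreover have "2 * 8 ^ ?n * (1 / 2) ^ (?n - 1) \<le> 2 * 8 ^ ?n * (d / R) ^ (?n - 1)"
          using calculation(1) by (intro mult_left_mono) auto
        ultimately have "(2::real) ^ ?n \<le> 2 * 8 ^ ?n * (d / R) ^ (?n - 1)" by linarith
        then show "?V * 2 ^ ?n \<le> C * (d ^ (?n - 1) * R powr (- (real ?n - 1)))"
          unfolding pow C_def using mult_left_mono[of "2 ^ ?n" "2 * 8 ^ ?n * (d / R) ^ (?n - 1)" ?V] V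
          by (simp add: mult_ac)
      qed
      finally show ?thesis unfolding R'
        by (intro bexI[of _ "ball 0 2"]) (auto simp: mult.assoc)
    next
      case True
      define q where "q = 4 * d / R"
      have q: "q > 0" using d R by (simp add: q_def)
      define e where "e = (y - x) /\<^sub>R R"
      have e: "norm e = 1" using R by (simp add: e_def R_def)
      \<comment> \<open>The points a e with 0 <= a <= 4 are reached in steps of length q, and 4/q =
        R/d.\<close>
      define N where "N = nat \<lfloor>R / d\<rfloor>"
      define S where "S = (\<Union>k\<in>{..N}. cball ((real k * q) *\<^sub>R e) (2 * q))"
      have "emeasure lborel S \<le> (\<Sum>k\<in>{..N}. emeasure lborel (cball ((real k * q) *\<^sub>R e) (2 * q)))"
        unfolding S_def by (intro emeasure_subadditive_finite) auto
      also have "\<dots> = (\<Sum>k\<in>{..N}. ennreal (?V * (2 * q) ^ ?n))"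
        using q by (intro sum.cong refl) (simp add: emeasure_cball)
      also have "\<dots> = ennreal (real (Suc N) * (?V * (2 * q) ^ ?n))"
        using q V by (simp add: ennreal_of_nat_eq_real_of_nat ennreal_mult'' del: of_nat_Suc)
      also have "\<dots> \<le> ennreal (C * (d ^ (?n - 1) * R powr (- (real ?n - 1))))"
      proof (rule ennreal_leI)
        have "real N \<le> R / d" using R d by (simp add: N_def)
        moreover have "1 \<le> R / d" using True d by (simp add: field_simps)
        ultimately have "real (Suc N) \<le> 2 * (R / d)" by simp
        then have "real (Suc N) * (?V * (2 * q) ^ ?n) \<le> 2 * (R / d) * (?V * (2 * q) ^ ?n)"
          using q V by (intro mult_right_mono) auto
        also have "2 * (R / d) * (?V * (2 * q) ^ ?n) = C * (d / R) ^ (?n - 1)"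
        proof -
          have "(2 * q) ^ ?n = 8 ^ ?n * (d / R) ^ ?n"
            by (simp add: q_def flip: power_mult_distrib)
          also have "(d / R) ^ ?n = (d / R) * (d / R) ^ (?n - 1)"
            using n by (cases ?n) auto
          finally show ?thesis using R d by (simp add: C_def)
        qed
        finally show "real (Suc N) * (?V * (2 * q) ^ ?n) \<le> C * (d ^ (?n - 1) * R powr (- (real ?n - 1)))"
          unfolding pow .
      qed
      finally have "emeasure lborel S \<le> ennreal (C * d ^ (?n - 1) * norm (x - y) powr (- (real ?n - 1)))"
        unfolding R' by (simp only: mult.assoc)
      moreover have "v \<in> S" if t: "0 < t" and v: "1 < norm v" "norm v < 2" and hit: "x + t *\<^sub>R v \<in> cball y d" for t v
      proof -
        define w where "w = x + t *\<^sub>R v - y"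
        have w: "norm w \<le> d" using hit by (simp add: w_def dist_norm norm_minus_commute)
        have tv: "t *\<^sub>R v = R *\<^sub>R e + w" using R by (simp add: w_def e_def)
        have "R - d \<le> norm (t *\<^sub>R v)"
          unfolding tv using norm_diff_ineq[of "R *\<^sub>R e" w] w e R by simp
        also have "\<dots> \<le> t * 2" using t v by (simp add: mult_left_mono)
        finally have t4: "R / 4 \<le> t" using True by linarith
        define a where "a = R / t"
        have a: "0 \<le> a" "a \<le> 4" using R t t4 by (auto simp: a_def field_simps)
        define k where "k = nat \<lfloor>a / q\<rfloor>"
        have k: "real k \<le> a / q" "a / q < real k + 1" using a q by (auto simp: k_def)
        have "a / q \<le> 4 / q" using a q by (intro divide_right_mono) auto
        also have "\<dots> = R / d" using d R by (simp add: q_def)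
        finally have "k \<le> N" unfolding k_def N_def by (intro nat_mono floor_mono)
        have "v = (1 / t) *\<^sub>R (t *\<^sub>R v)" using t by simp
        also have "\<dots> = a *\<^sub>R e + (1 / t) *\<^sub>R w" unfolding tv by (simp add: a_def scaleR_add_right)
        finally have "v - (real k * q) *\<^sub>R e = (a - real k * q) *\<^sub>R e + (1 / t) *\<^sub>R w"
          by (simp add: scaleR_diff_left)
        then have "norm (v - (real k * q) *\<^sub>R e) \<le> \<bar>a - real k * q\<bar> + norm w / t"
          using norm_triangle_ineq[of "(a - real k * q) *\<^sub>R e" "(1 / t) *\<^sub>R w"] e t by simp
        also have "\<bar>a - real k * q\<bar> \<le> q" using k q by (simp add: field_simps abs_le_iff)
        also have "norm w / t \<le> q"
        proof -
          have "norm w / t \<le> d / (R / 4)" using w t t4 R d by (intro frac_le) auto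
          then show ?thesis by (simp add: q_def mult.commute)
        qed
        finally show ?thesis
          unfolding S_def using \<open>k \<le> N\<close> by (auto simp: dist_norm norm_minus_commute intro!: bexI[of _ k])
      qed
      moreover have "S \<in> sets borel" unfolding S_def by (intro sets.finite_UN) auto
      ultimately show ?thesis by blast
    qed
  qed
  with C show ?thesis by blast
qed

text \<open>The outer measure provides a cover by arbitrary bounded sets, whereas the kernel
  estimates need balls centred in A, because the growth of \<mu> is only available around points of
  the closure of \<Omega>. A covering set that meets A lies in a ball about one of its points in A
  with its diameter as radius; the other sets get an arbitrary centre. The factor 2^m /
  \<open>unit_ball_vol (real m)\<close> undoes the normalisation of the gauge, and the added 1 pays
  for making all radii positive.\<close>

lemma hausdorff_outer_cover:
  fixes A :: "'a::metric_space set"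
  assumes m: "m \<ge> 1" and A: "A \<noteq> {}" and s: "s > 0" "hausdorff_outer m A < ennreal s"
  obtains y :: "nat \<Rightarrow> 'a" and r :: "nat \<Rightarrow> real" where "\<And>i. y i \<in> A" "\<And>i. r i > 0"
    "A \<subseteq> (\<Union>i. cball (y i) (r i))"
    "(\<Sum>i. ennreal (r i ^ m)) \<le> ennreal ((2 ^ m / unit_ball_vol (real m) + 1) * s)"
proof -
  let ?V = "unit_ball_vol (real m)"
  have V: "?V > 0" by simp
  have "hausdorff_pre m 1 A \<le> hausdorff_outer m A"
    unfolding hausdorff_outer_def by (rule SUP_upper) simp
  also note s(2)
  finally have "hausdorff_pre m 1 A < ennreal s" .
  then obtain E :: "nat \<Rightarrow> 'a set" where E: "A \<subseteq> (\<Union>i. E i)" "\<And>i. bounded (E i)"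
    "(\<Sum>i. hausdorff_gauge m (E i)) < ennreal s"
    unfolding hausdorff_pre_def INF_less_iff by auto
  define d where "d i = (if E i \<inter> A = {} then 0 else diameter (E i))" for i
  have d: "d i \<ge> 0" for i using E(2) by (simp add: d_def diameter_ge_0)
  \<comment> \<open>Diameters may be 0; a summable positive amount with total s is added to their
    m-th powers.\<close>
  define a where "a i = d i ^ m + s * (1/2) ^ Suc i" for i
  have a: "a i > 0" "d i ^ m \<le> a i" for i using d[of i] s by (auto simp: a_def intro!: add_nonneg_pos)
  define y where "y i = (if E i \<inter> A = {} then SOME z. z \<in> A else SOME z. z \<in> E i \<inter> A)" for i
  have y: "y i \<in> A" "E i \<inter> A \<noteq> {} \<Longrightarrow> y i \<in> E i" for i
    using some_in_eq[of A] A some_in_eq[of "E i \<inter> A"] by (auto simp: y_def)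
  show thesis
  proof (rule that[of y "\<lambda>i. root m (a i)"])
    show "0 < root m (a i)" for i using a m by simp
    have le: "d i \<le> root m (a i)" for i
      using real_root_le_mono[of m, OF _ a(2)[of i]] m d[of i] by (simp add: real_root_power_cancel)
    show "A \<subseteq> (\<Union>i. cball (y i) (root m (a i)))"
    proof
      fix z assume z: "z \<in> A"
      then obtain i where i: "z \<in> E i" using E(1) by auto
      then have ne: "E i \<inter> A \<noteq> {}" using z by auto
      have "dist (y i) z \<le> diameter (E i)"
        using E(2)[of i] y(2)[OF ne] i by (rule diameter_bounded_bound)
      also have "\<dots> = d i" using ne by (simp add: d_def)
      finally show "z \<in> (\<Union>i. cball (y i) (root m (a i)))" using le[of i] by (intro UN_I[of i]) auto
    qed
    have gauge: "ennreal (d i ^ m) \<le> ennreal (2 ^ m / ?V) * hausdorff_gauge m (E i)" for i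
    proof (cases "E i \<inter> A = {}")
      case True
      then show ?thesis using m by (simp add: d_def power_0_left)
    next
      case False
      then have "hausdorff_gauge m (E i) = ennreal (?V * (d i / 2) ^ m)"
        by (auto simp: hausdorff_gauge_def d_def)
      then have "ennreal (2 ^ m / ?V) * hausdorff_gauge m (E i) = ennreal (2 ^ m / ?V * (?V * (d i / 2) ^ m))"
      proof -
        have "0 \<le> 2 ^ m / ?V" using V by simp
        then show ?thesis by (simp only: \<open>hausdorff_gauge m (E i) = _\<close> ennreal_mult')
      qed
      also have "2 ^ m / ?V * (?V * (d i / 2) ^ m) = d i ^ m"
        using less_imp_neq[OF V] by (simp add: power_divide)
      finally show ?thesis by simp
    qed
    have "(\<Sum>i. ennreal (root m (a i) ^ m)) = (\<Sum>i. ennreal (d i ^ m) + ennreal (s * (1/2) ^ Suc i))"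
      using m a d s by (intro suminf_cong) (simp add: less_imp_le a_def ennreal_plus)
    also have "\<dots> = (\<Sum>i. ennreal (d i ^ m)) + (\<Sum>i. ennreal (s * (1/2) ^ Suc i))"
      by (rule suminf_add[symmetric]) auto
    also have "(\<Sum>i. ennreal (s * (1/2) ^ Suc i)) = ennreal (s * 1)"
      using s by (intro suminf_ennreal_eq sums_mult power_half_series) auto
    also have "(\<Sum>i. ennreal (d i ^ m)) \<le> (\<Sum>i. ennreal (2 ^ m / ?V) * hausdorff_gauge m (E i))"
      by (intro suminf_le gauge) auto
    also have "\<dots> = ennreal (2 ^ m / ?V) * (\<Sum>i. hausdorff_gauge m (E i))"
      by (rule ennreal_suminf_cmult)
    also have "\<dots> \<le> ennreal (2 ^ m / ?V) * ennreal s" using E(3) by (intro mult_left_mono) auto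
    also have "ennreal (2 ^ m / ?V) * ennreal s + ennreal (s * 1) = ennreal ((2 ^ m / ?V + 1) * s)"
      using V s by (simp add: ennreal_mult''[symmetric] distrib_right ennreal_plus[symmetric] del: ennreal_plus)
    finally show "(\<Sum>i. ennreal (root m (a i) ^ m)) \<le> ennreal ((2 ^ m / ?V + 1) * s)"
      by (simp add: add_right_mono)
  qed (use y in auto)
qed

text \<open>Chebyshev on the superlevel set itself: if it has measure m > 0, then c m <= D
  m^(1-\<theta>), and m^(1-\<theta>) cancels. The cancellation needs m finite, hence the exhaustion
  by sets of finite measure. The hypothesis is preferred to the weak type bound as a working notion
  because it passes to sums and integrals of kernels with constants simply adding up.\<close>

lemma (in sigma_finite_measure) weak_type_of_restricted:
  assumes h[measurable]: "h \<in> borel_measurable M" and "0 < \<theta>" "0 \<le> D" "0 < c"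
    and int: "\<And>F m. F \<in> sets M \<Longrightarrow> 0 < m \<Longrightarrow> emeasure M F \<le> ennreal m \<Longrightarrow>
      (\<integral>\<^sup>+x\<in>F. h x \<partial>M) \<le> ennreal (D * m powr (1 - \<theta>))"
  shows "emeasure M {x\<in>space M. ennreal c < h x} \<le> ennreal ((D / c) powr (1 / \<theta>))"
proof -
  obtain A :: "nat \<Rightarrow> 'a set" where A: "range A \<subseteq> sets M" "(\<Union>i. A i) = space M"
    "\<And>i. emeasure M (A i) \<noteq> \<infinity>" "incseq A"
    using sigma_finite_incseq by metis
  have [measurable]: "A i \<in> sets M" for i using A(1) by auto
  let ?B = "{x\<in>space M. ennreal c < h x}"
  have bound: "emeasure M (?B \<inter> A i) \<le> ennreal ((D / c) powr (1 / \<theta>))" for i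
  proof -
    let ?F = "?B \<inter> A i"
    have "emeasure M ?F \<le> emeasure M (A i)" by (intro emeasure_mono) auto
    then obtain m where m: "m \<ge> 0" "emeasure M ?F = ennreal m"
      using A(3)[of i] by (cases "emeasure M ?F") (auto simp: top_unique)
    show ?thesis
    proof (cases "m = 0")
      case False
      then have m0: "m > 0" using m by simp
      have "ennreal c * emeasure M ?F = (\<integral>\<^sup>+x\<in>?F. ennreal c \<partial>M)"
        by (simp add: nn_integral_cmult_indicator)
      also have "\<dots> \<le> (\<integral>\<^sup>+x\<in>?F. h x \<partial>M)" by (intro nn_integral_mono) (auto simp: indicator_def)
      also have "\<dots> \<le> ennreal (D * m powr (1 - \<theta>))" using m m0 by (intro int) auto
      finally have "c * m \<le> D * m powr (1 - \<theta>)"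
        using m \<open>0 < c\<close> \<open>0 \<le> D\<close> by (simp add: ennreal_mult[symmetric] ennreal_le_iff)
      moreover have "m powr (1 - \<theta>) = m / m powr \<theta>" using m0 by (simp add: powr_diff)
      ultimately have "m powr \<theta> \<le> D / c" using m0 \<open>0 < c\<close> by (simp add: field_simps)
      then have "(m powr \<theta>) powr (1 / \<theta>) \<le> (D / c) powr (1 / \<theta>)"
        using \<open>0 < \<theta>\<close> by (intro powr_mono2) auto
      then have "m \<le> (D / c) powr (1 / \<theta>)" using m0 \<open>0 < \<theta>\<close> by (simp add: powr_powr)
      then show ?thesis using m by (simp add: ennreal_leI)
    qed (use m in simp)
  qed
  have "?B = (\<Union>i. ?B \<inter> A i)" using A(2) by auto
  then have "emeasure M ?B = emeasure M (\<Union>i. ?B \<inter> A i)" by simp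
  also have "\<dots> = (SUP i. emeasure M (?B \<inter> A i))"
    using A(4) by (intro SUP_emeasure_incseq[symmetric]) (auto simp: incseq_def)
  also have "\<dots> \<le> ennreal ((D / c) powr (1 / \<theta>))" by (intro SUP_least bound)
  finally show ?thesis .
qed

section \<open>Measures with a growth bound on balls\<close>

definition upper_regular :: "real \<Rightarrow> real \<Rightarrow> (real^'n) set \<Rightarrow> (real^'n) measure \<Rightarrow> bool" where
  "upper_regular \<alpha> K \<Omega> \<mu> \<longleftrightarrow> open \<Omega> \<and> sets \<mu> = sets (restrict_space borel \<Omega>) \<and>
     (\<forall>x\<in>\<Omega>. \<forall>r>0. emeasure \<mu> (ball x r \<inter> \<Omega>) \<le> ennreal (K * r powr \<alpha>))"

lemma upper_regular_sets:
  assumes "upper_regular \<alpha> K \<Omega> \<mu>"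
  shows "space \<mu> = \<Omega>" "f \<in> borel_measurable borel \<Longrightarrow> f \<in> borel_measurable \<mu>"
    "A \<in> sets borel \<Longrightarrow> A \<inter> \<Omega> \<in> sets \<mu>"
proof -
  have s: "sets \<mu> = sets (restrict_space borel \<Omega>)" using assms by (simp add: upper_regular_def)
  show "space \<mu> = \<Omega>" using sets_eq_imp_space_eq[OF s] by (simp add: space_restrict_space)
  show "f \<in> borel_measurable borel \<Longrightarrow> f \<in> borel_measurable \<mu>"
    unfolding measurable_cong_sets[OF s refl] by (rule measurable_restrict_space1)
  show "A \<inter> \<Omega> \<in> sets \<mu>" if "A \<in> sets borel"
    unfolding s sets_restrict_space using that by (auto simp: Int_commute)
qed

text \<open>The growth is assumed only for centres in \<Omega>, but the balls covering the boundary
  set are centred on the frontier. A point of \<Omega> within r of y is used as centre with twice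
  the radius, at the cost of the factor 2^\<alpha>.\<close>

lemma upper_regular_ball:
  fixes \<Omega> :: "(real^'n) set"
  assumes reg: "upper_regular \<alpha> K \<Omega> \<mu>" and y: "y \<in> closure \<Omega>" and r: "r > 0"
  shows "emeasure \<mu> {x \<in> space \<mu>. norm (x - y) < r} \<le> ennreal (K * 2 powr \<alpha> * r powr \<alpha>)"
proof -
  obtain z where z: "z \<in> \<Omega>" "dist z y < r" using y r by (auto simp: closure_approachable)
  have "emeasure \<mu> {x \<in> space \<mu>. norm (x - y) < r} \<le> emeasure \<mu> (ball z (2 * r) \<inter> \<Omega>)"
  proof (rule emeasure_mono)
    show "{x \<in> space \<mu>. norm (x - y) < r} \<subseteq> ball z (2 * r) \<inter> \<Omega>"
    proof
      fix x assume "x \<in> {x \<in> space \<mu>. norm (x - y) < r}"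
      then show "x \<in> ball z (2 * r) \<inter> \<Omega>"
        using z(2) dist_triangle[of z x y] upper_regular_sets(1)[OF reg] by (simp add: dist_norm norm_minus_commute)
    qed
  qed (use upper_regular_sets(3)[OF reg] in simp)
  also have "\<dots> \<le> ennreal (K * (2 * r) powr \<alpha>)" using reg z r by (simp add: upper_regular_def)
  also have "(2 * r) powr \<alpha> = 2 powr \<alpha> * r powr \<alpha>" using r by (simp add: powr_mult)
  finally show ?thesis by (simp add: mult.assoc)
qed

lemma upper_regular_sigma_finite:
  assumes reg: "upper_regular \<alpha> K \<Omega> \<mu>"
  shows "sigma_finite_measure \<mu>"
proof (cases "\<Omega> = {}")
  case True
  then have "finite_measure \<mu>"
    using upper_regular_sets(1)[OF reg] by (intro finite_measureI) simp
  then show ?thesis by (simp add: finite_measure_def)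
next
  case False
  then obtain p where p: "p \<in> \<Omega>" by auto
  note sp = upper_regular_sets(1)[OF reg]
  let ?A = "\<lambda>k::nat. ball p (real (Suc k)) \<inter> \<Omega>"
  show ?thesis
  proof
    show "\<exists>A. countable A \<and> A \<subseteq> sets \<mu> \<and> \<Union> A = space \<mu> \<and> (\<forall>a\<in>A. emeasure \<mu> a \<noteq> \<infinity>)"
    proof (intro exI[of _ "range ?A"] conjI ballI)
      show "range ?A \<subseteq> sets \<mu>" using upper_regular_sets(3)[OF reg] by auto
      show "\<Union> (range ?A) = space \<mu>"
      proof -
        have "\<exists>k. dist p x < real (Suc k)" for x
          using reals_Archimedean2[of "dist p x"] by (metis less_Suc_eq of_nat_less_iff order_less_trans)
        then show ?thesis unfolding sp by auto
      qed
      show "emeasure \<mu> a \<noteq> \<infinity>" if "a \<in> range ?A" for a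
      proof -
        from that obtain k where "a = ?A k" by (rule rangeE)
        moreover have "emeasure \<mu> (?A k) \<le> ennreal (K * real (Suc k) powr \<alpha>)"
          using reg p unfolding upper_regular_def by simp
        ultimately show ?thesis by (auto simp: top_unique)
      qed
    qed simp
  qed
qed

lemma upper_regular_kernel_le:
  fixes \<Omega> :: "(real^'n) set"
  assumes reg: "upper_regular \<alpha> K \<Omega> \<mu>" and y: "y \<in> closure \<Omega>" and "K > 0"
    and n: "CARD('n) \<ge> 2" "real CARD('n) - 1 < \<alpha>"
    and F: "F \<in> sets \<mu>" and m: "m > 0" "emeasure \<mu> F \<le> ennreal m"
  shows "(\<integral>\<^sup>+x\<in>F. ennreal (norm (x - y) powr (- (real CARD('n) - 1))) \<partial>\<mu>) \<le>
    ennreal ((1 + K * 2 powr \<alpha> * 2 powr (real CARD('n) - 1) / (1 - 2 powr (real CARD('n) - 1 - \<alpha>))) *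
      m powr (1 - (real CARD('n) - 1) / \<alpha>))"
  using \<open>K > 0\<close> n
  by (intro nn_integral_kernel_le upper_regular_ball[OF reg y] F m upper_regular_sets(2)[OF reg]) auto

text \<open>The exceptional set B consists of the points x at which the volume bounds for the cones
  over the covering balls add up to more than half the ball of directions. This sum is a countable
  combination of kernels |x-y_i|^(1-n), so its integral over a set of given \<mu>-measure is bounded
  term by term, and the weak type bound limits the \<mu>-measure of B. Off B the union of the cones
  serves as \<open>Bad\<close>.\<close>

lemma boundary_directions:
  fixes \<alpha> K :: real
  assumes n: "CARD('n::finite) \<ge> 2" "real CARD('n) - 1 < \<alpha>" and K: "K > 0"
  shows "\<exists>C>0. \<forall>(\<Omega> :: (real^'n) set) \<mu> E. \<forall>s>0. upper_regular \<alpha> K \<Omega> \<mu> \<longrightarrow> E \<subseteq> frontier \<Omega> \<longrightarrow>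
    hausdorff_outer (CARD('n) - 1) E < ennreal s \<longrightarrow>
    (\<exists>B\<in>sets \<mu>. emeasure \<mu> B \<le> ennreal ((C * s) powr (\<alpha> / (real CARD('n) - 1))) \<and>
      (\<forall>x\<in>\<Omega> - B. \<exists>Bad\<in>sets borel.
        emeasure lborel Bad \<le> ennreal (measure lborel (ball (0::real^'n) (1/4)) / 2) \<and>
        (\<forall>t v. 0 < t \<longrightarrow> 1 < norm v \<longrightarrow> norm v < 2 \<longrightarrow> x + t *\<^sub>R v \<in> E \<longrightarrow> v \<in> Bad)))"
proof -
  let ?\<beta> = "real CARD('n) - 1" and ?m = "CARD('n) - 1"
  let ?c = "measure lborel (ball (0::real^'n) (1/4)) / 2"
  have c: "?c > 0" by (simp add: content_ball_pos)
  have \<beta>: "?\<beta> > 0" "\<alpha> > 0" using n by auto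
  obtain C1 where C1: "C1 > 0" "\<And>(x::real^'n) y d. d > 0 \<Longrightarrow> x \<noteq> y \<Longrightarrow> \<exists>S\<in>sets borel.
    emeasure lborel S \<le> ennreal (C1 * d ^ ?m * norm (x - y) powr (- ?\<beta>)) \<and>
    (\<forall>t v. 0 < t \<longrightarrow> 1 < norm v \<longrightarrow> norm v < 2 \<longrightarrow> x + t *\<^sub>R v \<in> cball y d \<longrightarrow> v \<in> S)"
    using cone_in_small_set[OF n(1)] by blast
  define C2 where "C2 = 2 ^ ?m / unit_ball_vol (real ?m) + 1"
  have C2: "C2 > 0" unfolding C2_def by (intro add_nonneg_pos) auto
  define C3 where "C3 = 1 + K * 2 powr \<alpha> * 2 powr ?\<beta> / (1 - 2 powr (?\<beta> - \<alpha>))"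
  have "(2::real) powr (?\<beta> - \<alpha>) < 1" using n powr_less_one[of 2 "?\<beta> - \<alpha>"] by simp
  then have C3: "C3 > 0" unfolding C3_def using K by (intro add_pos_nonneg divide_nonneg_nonneg) auto
  define C where "C = C1 * C2 * C3 / ?c"
  have "C > 0" using C1 C2 C3 c by (simp add: C_def)
  have "\<exists>B\<in>sets \<mu>. emeasure \<mu> B \<le> ennreal ((C * s) powr (\<alpha> / ?\<beta>)) \<and>
      (\<forall>x\<in>\<Omega> - B. \<exists>Bad\<in>sets borel. emeasure lborel Bad \<le> ennreal ?c \<and>
        (\<forall>t v. 0 < t \<longrightarrow> 1 < norm v \<longrightarrow> norm v < 2 \<longrightarrow> x + t *\<^sub>R v \<in> E \<longrightarrow> v \<in> Bad))"
    if s: "s > 0" and reg: "upper_regular \<alpha> K \<Omega> \<mu>" and E: "E \<subseteq> frontier \<Omega>" "hausdorff_outer ?m E < ennreal s"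
    for \<Omega> :: "(real^'n) set" and \<mu> E s
  proof (cases "E = {}")
    case False
    have m1: "?m \<ge> 1" using n by simp
    obtain y r where y: "\<And>i. y i \<in> E" and r: "\<And>i. r i > 0"
      and cov: "E \<subseteq> (\<Union>i. cball (y i) (r i))" and sum: "(\<Sum>i. ennreal (r i ^ ?m)) \<le> ennreal (C2 * s)"
    proof (rule hausdorff_outer_cover[OF m1 False s E(2), folded C2_def])
      fix y :: "nat \<Rightarrow> real^'n" and r :: "nat \<Rightarrow> real"
      assume "\<And>i. y i \<in> E" "\<And>i. 0 < r i" "E \<subseteq> (\<Union>i. cball (y i) (r i))"
        "(\<Sum>i. ennreal (r i ^ ?m)) \<le> ennreal (C2 * s)"
      then show thesis by (rule that)
    qed
    have \<Omega>: "open \<Omega>" using reg by (simp add: upper_regular_def)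
    have ycl: "y i \<in> closure \<Omega>" "y i \<notin> \<Omega>" for i
      using y[of i] E(1) \<Omega> by (auto simp: frontier_def interior_open)
    define h where "h x = (\<Sum>i. ennreal (C1 * r i ^ ?m) * ennreal (norm (x - y i) powr (- ?\<beta>)))" for x
    have hm[measurable]: "h \<in> borel_measurable borel" unfolding h_def by measurable
    note upper_regular_sets(2)[OF reg, measurable]
    interpret \<mu>: sigma_finite_measure \<mu> by (rule upper_regular_sigma_finite[OF reg])
    define B where "B = {x \<in> space \<mu>. ennreal ?c < h x}"
    have Bm: "B \<in> sets \<mu>" unfolding B_def using upper_regular_sets(2)[OF reg hm] by measurable
    have "emeasure \<mu> B \<le> ennreal ((C1 * C2 * C3 * s / ?c) powr (1 / (?\<beta> / \<alpha>)))"
      unfolding B_def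
    proof (rule \<mu>.weak_type_of_restricted)
      fix F m assume F: "F \<in> sets \<mu>" and m: "0 < m" "emeasure \<mu> F \<le> ennreal m"
      let ?k = "\<lambda>i x. ennreal (norm (x - y i) powr (- ?\<beta>))"
      have km: "?k i \<in> borel_measurable \<mu>" for i by (rule upper_regular_sets(2)[OF reg]) measurable
      have "(\<integral>\<^sup>+x\<in>F. h x \<partial>\<mu>) = (\<integral>\<^sup>+x. (\<Sum>i. ennreal (C1 * r i ^ ?m) * (?k i x * indicator F x)) \<partial>\<mu>)"
        unfolding h_def by (simp only: ennreal_suminf_multc[symmetric] mult.assoc)
      also have "\<dots> = (\<Sum>i. \<integral>\<^sup>+x. ennreal (C1 * r i ^ ?m) * (?k i x * indicator F x) \<partial>\<mu>)"
        by (intro nn_integral_suminf borel_measurable_times_ennreal borel_measurable_const km borel_measurable_indicator F)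
      also have "\<dots> = (\<Sum>i. ennreal (C1 * r i ^ ?m) * (\<integral>\<^sup>+x\<in>F. ?k i x \<partial>\<mu>))"
        by (intro suminf_cong nn_integral_cmult borel_measurable_times_ennreal km borel_measurable_indicator F)
      also have "\<dots> \<le> (\<Sum>i. ennreal (C1 * r i ^ ?m) * ennreal (C3 * m powr (1 - ?\<beta> / \<alpha>)))"
        unfolding C3_def using reg ycl K n F m
        by (intro suminf_le mult_left_mono upper_regular_kernel_le) auto
      also have "\<dots> = (\<Sum>i. ennreal (C1 * (C3 * m powr (1 - ?\<beta> / \<alpha>))) * ennreal (r i ^ ?m))"
        using C1(1) C3 r by (intro suminf_cong) (simp add: ennreal_mult[symmetric] less_imp_le mult_ac)
      also have "\<dots> = ennreal (C1 * (C3 * m powr (1 - ?\<beta> / \<alpha>))) * (\<Sum>i. ennreal (r i ^ ?m))"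
        by (rule ennreal_suminf_cmult)
      also have "\<dots> \<le> ennreal (C1 * (C3 * m powr (1 - ?\<beta> / \<alpha>))) * ennreal (C2 * s)"
        by (intro mult_left_mono sum) simp
      also have "\<dots> = ennreal (C1 * C2 * C3 * s * m powr (1 - ?\<beta> / \<alpha>))"
        using C1(1) C2 C3 s by (simp add: ennreal_mult[symmetric] mult_ac)
      finally show "(\<integral>\<^sup>+x\<in>F. h x \<partial>\<mu>) \<le> ennreal (C1 * C2 * C3 * s * m powr (1 - ?\<beta> / \<alpha>))" .
    qed (use c \<beta> C1(1) C2 C3 s upper_regular_sets(2)[OF reg hm] in auto)
    also have "(C1 * C2 * C3 * s / ?c) powr (1 / (?\<beta> / \<alpha>)) = (C * s) powr (\<alpha> / ?\<beta>)"
    proof -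
      have e: "a * s / k = a / k * s" for a k :: real by simp
      have "1 / (?\<beta> / \<alpha>) = \<alpha> / ?\<beta>" by simp
      then show ?thesis by (simp only: C_def e)
    qed
    finally have Ble: "emeasure \<mu> B \<le> ennreal ((C * s) powr (\<alpha> / ?\<beta>))" .
    have "\<exists>Bad\<in>sets borel. emeasure lborel Bad \<le> ennreal ?c \<and>
        (\<forall>t v. 0 < t \<longrightarrow> 1 < norm v \<longrightarrow> norm v < 2 \<longrightarrow> x + t *\<^sub>R v \<in> E \<longrightarrow> v \<in> Bad)"
      if x: "x \<in> \<Omega> - B" for x
    proof -
      have "x \<noteq> y i" for i using x ycl by auto
      then have "\<exists>S\<in>sets borel. emeasure lborel S \<le> ennreal (C1 * r i ^ ?m * norm (x - y i) powr (- ?\<beta>)) \<and>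
        (\<forall>t v. 0 < t \<longrightarrow> 1 < norm v \<longrightarrow> norm v < 2 \<longrightarrow> x + t *\<^sub>R v \<in> cball (y i) (r i) \<longrightarrow> v \<in> S)" for i
        by (intro C1(2) r)
      then obtain S where S: "\<And>i. S i \<in> sets borel"
        "\<And>i. emeasure lborel (S i) \<le> ennreal (C1 * r i ^ ?m * norm (x - y i) powr (- ?\<beta>))"
        "\<And>i t v. 0 < t \<Longrightarrow> 1 < norm v \<Longrightarrow> norm v < 2 \<Longrightarrow> x + t *\<^sub>R v \<in> cball (y i) (r i) \<Longrightarrow> v \<in> S i"
        by metis
      have "emeasure lborel (\<Union>i. S i) \<le> (\<Sum>i. emeasure lborel (S i))"
        using S(1) by (intro emeasure_subadditive_countably) auto
      also have "\<dots> \<le> h x"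
        unfolding h_def
      proof (intro suminf_le)
        show "emeasure lborel (S i) \<le> ennreal (C1 * r i ^ ?m) * ennreal (norm (x - y i) powr (- ?\<beta>))" for i
          using S(2)[of i] C1(1) r[of i] by (simp add: ennreal_mult'')
      qed auto
      also have "\<dots> \<le> ennreal ?c"
        using x upper_regular_sets(1)[OF reg] by (auto simp: B_def)
      finally have "emeasure lborel (\<Union>i. S i) \<le> ennreal ?c" .
      moreover have "v \<in> (\<Union>i. S i)" if "0 < t" "1 < norm v" "norm v < 2" "x + t *\<^sub>R v \<in> E" for t v
        using that S(3)[of t v] cov by blast
      ultimately show ?thesis using S(1) by (intro bexI[of _ "\<Union>i. S i"]) auto
    qed
    with Bm Ble show ?thesis by blast
  qed (intro bexI[of _ "{}"], auto intro!: bexI[of _ "{}"])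
  with \<open>C > 0\<close> show ?thesis by blast
qed

section \<open>Rearrangements\<close>

text \<open>The substance is right-continuity of the distribution function: the set where f > t is
  the increasing union of the sets where f > t + 1/(k+1), so a strict lower bound on its measure
  persists at a slightly higher level. The equivalence is what identifies level sets of the
  rearrangement with initial segments.\<close>

lemma less_decreasing_rearrangement_iff:
  assumes f[measurable]: "f \<in> borel_measurable M"
  shows "t < decreasing_rearrangement M f s \<longleftrightarrow> ennreal s < emeasure M {x \<in> space M. t < f x}"
proof
  assume "t < decreasing_rearrangement M f s"
  then show "ennreal s < emeasure M {x \<in> space M. t < f x}"
    unfolding decreasing_rearrangement_def by (meson Inf_lower leD mem_Collect_eq not_le)
next
  assume s: "ennreal s < emeasure M {x \<in> space M. t < f x}"
  have "t \<noteq> top" using s by (auto simp: top.extremum_strict)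
  define q where "q k = t + ennreal (1 / real (Suc k))" for k
  have tq: "t < q k" for k
    using \<open>t \<noteq> top\<close> unfolding q_def by (cases t) (auto simp: ennreal_plus[symmetric] ennreal_less_iff simp del: ennreal_plus)
  have "{x \<in> space M. t < f x} = (\<Union>k. {x \<in> space M. q k < f x})"
  proof (intro equalityI subsetI)
    fix x assume x: "x \<in> {x \<in> space M. t < f x}"
    have "(\<lambda>k. t + ennreal (1 / real (Suc k))) \<longlonglongrightarrow> t + ennreal 0"
      by (intro tendsto_add tendsto_ennrealI tendsto_const)
        (use LIMSEQ_inverse_real_of_nat in \<open>simp add: inverse_eq_divide\<close>)
    then have "q \<longlonglongrightarrow> t" by (simp add: q_def[abs_def])
    from order_tendstoD(2)[OF this, of "f x"] x obtain k where "q k < f x"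
      by (auto simp: eventually_sequentially)
    then show "x \<in> (\<Union>k. {x \<in> space M. q k < f x})" using x by auto
  next
    fix x assume "x \<in> (\<Union>k. {x \<in> space M. q k < f x})"
    then show "x \<in> {x \<in> space M. t < f x}" using tq order_less_trans by blast
  qed
  moreover have "incseq (\<lambda>k. {x \<in> space M. q k < f x})"
  proof (rule incseq_SucI)
    fix k
    have "q (Suc k) \<le> q k" unfolding q_def by (intro add_left_mono ennreal_leI) (simp add: field_simps)
    then show "{x \<in> space M. q k < f x} \<subseteq> {x \<in> space M. q (Suc k) < f x}" by auto
  qed
  ultimately have "emeasure M {x \<in> space M. t < f x} = (SUP k. emeasure M {x \<in> space M. q k < f x})"
    by (simp add: SUP_emeasure_incseq image_subset_iff)
  with s obtain k where k: "ennreal s < emeasure M {x \<in> space M. q k < f x}"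
    by (auto simp only: less_SUP_iff)
  have "q k \<le> decreasing_rearrangement M f s"
    unfolding decreasing_rearrangement_def
  proof (rule Inf_greatest)
    fix t' assume t': "t' \<in> {t. emeasure M {x \<in> space M. t < f x} \<le> ennreal s}"
    show "q k \<le> t'"
    proof (rule ccontr)
      assume "\<not> q k \<le> t'"
      then have "emeasure M {x \<in> space M. q k < f x} \<le> emeasure M {x \<in> space M. t' < f x}"
        by (intro emeasure_mono) auto
      with k t' show False by (auto simp: not_less[symmetric])
    qed
  qed
  with tq show "t < decreasing_rearrangement M f s" by (rule order_less_le_trans)
qed

lemma decreasing_rearrangement_antimono:
  "s \<le> s' \<Longrightarrow> decreasing_rearrangement M f s' \<le> decreasing_rearrangement M f s"
  unfolding decreasing_rearrangement_def
  by (intro Inf_superset_mono) (auto intro: order_trans ennreal_leI)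

lemma emeasure_above_decreasing_rearrangement:
  "f \<in> borel_measurable M \<Longrightarrow>
    emeasure M {x \<in> space M. decreasing_rearrangement M f s < f x} \<le> ennreal s"
  using less_decreasing_rearrangement_iff[of f M "decreasing_rearrangement M f s" s] by (simp add: not_less)

lemma borel_measurable_decreasing_rearrangement [measurable]:
  "decreasing_rearrangement M f \<in> borel_measurable borel"
proof (rule borel_measurableI_greater)
  fix y
  let ?S = "{x. y < decreasing_rearrangement M f x}"
  have "is_interval ?S"
    unfolding is_interval_1
    using decreasing_rearrangement_antimono order_less_le_trans by blast
  then show "{x \<in> space borel. y < decreasing_rearrangement M f x} \<in> sets borel"
    using real_interval_borel_measurable[of ?S] by simp
qed

section \<open>Layer cake formulas and rearranged potentials\<close>

lemma ennreal_eq_topI: "(\<And>k::nat. ennreal (real k) \<le> x) \<Longrightarrow> x = top"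
  for x :: ennreal
proof -
  assume "\<And>k::nat. ennreal (real k) \<le> x"
  then have "(SUP k. of_nat k) \<le> x"
    by (intro SUP_least) (simp add: ennreal_of_nat_eq_real_of_nat)
  then show "x = top" unfolding ennreal_SUP_of_nat_eq_top by (simp add: top_unique)
qed

lemma emeasure_lborel_initial_segment:
  "emeasure lborel {r::real. 0 < r \<and> ennreal r < m} = m"
proof (cases m)
  case (real a)
  then have "{r::real. 0 < r \<and> ennreal r < m} = {0<..<a}" by (auto simp: ennreal_less_iff)
  then show ?thesis using real by simp
next
  case top
  have "ennreal (real k) \<le> emeasure lborel {r::real. 0 < r \<and> ennreal r < m}" for k :: nat
  proof -
    have "ennreal (real k) = emeasure lborel {0<..<real k}" by simp
    also have "\<dots> \<le> emeasure lborel {r::real. 0 < r \<and> ennreal r < m}"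
    proof (rule emeasure_mono)
      have "{r::real. 0 < r \<and> ennreal r < m} = {0<..}" using top by auto
      then show "{r::real. 0 < r \<and> ennreal r < m} \<in> sets lborel" by simp
    qed (use top in auto)
    finally show ?thesis .
  qed
  then show ?thesis unfolding top by (rule ennreal_eq_topI)
qed

lemma (in sigma_finite_measure) nn_integral_layer_cake:
  assumes [measurable]: "f \<in> borel_measurable M" "k \<in> borel_measurable M"
  shows "(\<integral>\<^sup>+x. f x * k x \<partial>M) = (\<integral>\<^sup>+t\<in>{0<..}. (\<integral>\<^sup>+x\<in>{x \<in> space M. ennreal t < f x}. k x \<partial>M) \<partial>lborel)"
proof -
  interpret pair_sigma_finite M "lborel :: real measure" ..
  have "(\<integral>\<^sup>+t\<in>{0<..}. (\<integral>\<^sup>+x\<in>{x \<in> space M. ennreal t < f x}. k x \<partial>M) \<partial>lborel) =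
      (\<integral>\<^sup>+t. (\<integral>\<^sup>+x. indicator {t. 0 < t \<and> ennreal t < f x} t * k x \<partial>M) \<partial>lborel)"
    by (subst nn_integral_multc[symmetric], measurable)
      (intro nn_integral_cong, auto simp: indicator_def)
  also have "\<dots> = (\<integral>\<^sup>+x. (\<integral>\<^sup>+t. indicator {t. 0 < t \<and> ennreal t < f x} t * k x \<partial>lborel) \<partial>M)"
    by (rule Fubini') measurable
  also have "\<dots> = (\<integral>\<^sup>+x. f x * k x \<partial>M)"
  proof (rule nn_integral_cong)
    fix x
    have "{t::real. 0 < t \<and> ennreal t < f x} \<in> sets borel" by measurable
    then show "(\<integral>\<^sup>+t. indicator {t. 0 < t \<and> ennreal t < f x} t * k x \<partial>lborel) = f x * k x"
      by (simp add: nn_integral_multc emeasure_lborel_initial_segment)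
  qed
  finally show ?thesis ..
qed

text \<open>For t = \<open>top\<close> the equivalence would fail, because
  \<open>top - top = top\<close> in \<open>ennreal\<close>.\<close>

lemma less_minus_ennreal_iff: "t \<noteq> top \<Longrightarrow> ennreal q < a - t \<longleftrightarrow> t + ennreal q < a" if "q > 0" for a t :: ennreal
  using that
  by (cases t; cases a)
    (auto simp: ennreal_minus ennreal_less_iff ennreal_plus[symmetric] simp del: ennreal_plus)

text \<open>Layer cake on both sides reduces the equality to single levels: the set where f > t + q
  and the corresponding set for the rearrangement on the half-line have the same measure.\<close>

lemma (in sigma_finite_measure) nn_integral_excess:
  assumes f[measurable]: "f \<in> borel_measurable M" and t: "t \<noteq> top"
  shows "(\<integral>\<^sup>+x. f x - t \<partial>M) = (\<integral>\<^sup>+r\<in>{0<..}. (decreasing_rearrangement M f r - t) \<partial>lborel)"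
proof -
  let ?F = "decreasing_rearrangement M f"
  have "(\<integral>\<^sup>+x. f x - t \<partial>M) = (\<integral>\<^sup>+x. (f x - t) * 1 \<partial>M)" by simp
  also have "\<dots> = (\<integral>\<^sup>+q\<in>{0<..}. (\<integral>\<^sup>+x\<in>{x \<in> space M. ennreal q < f x - t}. 1 \<partial>M) \<partial>lborel)"
    by (rule nn_integral_layer_cake) measurable
  also have "\<dots> = (\<integral>\<^sup>+q\<in>{0<..}. emeasure M {x \<in> space M. t + ennreal q < f x} \<partial>lborel)"
  proof (intro nn_integral_cong)
    fix q :: real
    have "{x \<in> space M. ennreal q < f x - t} = {x \<in> space M. t + ennreal q < f x}" if "q > 0"
      using less_minus_ennreal_iff[OF that t] by simp
    then show "(\<integral>\<^sup>+x\<in>{x \<in> space M. ennreal q < f x - t}. 1 \<partial>M) * indicator {0<..} q =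
        emeasure M {x \<in> space M. t + ennreal q < f x} * indicator {0<..} q"
      by (cases "q > 0") simp_all
  qed
  also have "\<dots> = (\<integral>\<^sup>+q\<in>{0<..}. (\<integral>\<^sup>+r\<in>{r \<in> space lborel. ennreal q < ?F r - t}. indicator {0<..} r \<partial>lborel) \<partial>lborel)"
  proof (intro nn_integral_cong)
    fix q :: real
    show "emeasure M {x \<in> space M. t + ennreal q < f x} * indicator {0<..} q =
      (\<integral>\<^sup>+r\<in>{r \<in> space lborel. ennreal q < ?F r - t}. indicator {0<..} r \<partial>lborel) * indicator {0<..} q"
    proof (cases "q > 0")
      case True
      have "(\<integral>\<^sup>+r\<in>{r \<in> space lborel. ennreal q < ?F r - t}. indicator {0<..} r \<partial>lborel) =
          (\<integral>\<^sup>+r. indicator {r. 0 < r \<and> ennreal r < emeasure M {x \<in> space M. t + ennreal q < f x}} r \<partial>lborel)"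
        using True by (intro nn_integral_cong)
          (auto simp: indicator_def less_minus_ennreal_iff[OF _ t] less_decreasing_rearrangement_iff)
      also have "\<dots> = emeasure lborel {r. 0 < r \<and> ennreal r < emeasure M {x \<in> space M. t + ennreal q < f x}}"
        by (rule nn_integral_indicator) simp
      finally show ?thesis by (simp add: emeasure_lborel_initial_segment)
    qed simp
  qed
  also have "\<dots> = (\<integral>\<^sup>+r. (?F r - t) * indicator {0<..} r \<partial>lborel)"
    by (rule lborel.nn_integral_layer_cake[symmetric]) measurable
  finally show ?thesis .
qed

text \<open>The bound m^(1/n) is rewritten as an integral over (0,m). In this form it can be
  integrated over the levels of a function, and it also covers sets of infinite measure, where the
  right-hand side is infinite.\<close>

lemma nn_integral_kernel_le_initial_segment:
  assumes n: "CARD('n::finite) \<ge> 2"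
  shows "\<exists>C>0. \<forall>x::real^'n. \<forall>F\<in>sets borel.
    (\<integral>\<^sup>+w\<in>F. ennreal (norm (w - x) powr (- (real CARD('n) - 1))) \<partial>lborel) \<le>
      ennreal C * (\<integral>\<^sup>+r\<in>{r. 0 < r \<and> ennreal r < emeasure lborel F}. ennreal (r powr (- ((real CARD('n) - 1) / real CARD('n)))) \<partial>lborel)"
proof -
  let ?n = "real CARD('n)"
  let ?k = "\<lambda>w x::real^'n. ennreal (norm (w - x) powr (- (?n - 1)))"
  let ?p = "\<lambda>r. ennreal (r powr (- ((?n - 1) / ?n)))"
  have n0: "?n > 0" using n by simp
  have e: "- ((?n - 1) / ?n) + 1 = 1 / ?n" "- ((?n - 1) / ?n) > -1" using n by (auto simp: field_simps)
  obtain C where C: "C > 0" "\<And>x F m. F \<in> sets borel \<Longrightarrow> m > 0 \<Longrightarrow> emeasure lborel F \<le> ennreal m \<Longrightarrow>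
      (\<integral>\<^sup>+w\<in>F. ?k w x \<partial>lborel) \<le> ennreal (C * m powr (1 / ?n))"
    using nn_integral_lborel_norm_kernel_le[OF n] by blast
  have seg: "(\<integral>\<^sup>+r\<in>{r. 0 < r \<and> ennreal r < ennreal m}. ?p r \<partial>lborel) = ennreal (?n * m powr (1 / ?n))"
    if m: "m > 0" for m
  proof -
    have "(\<integral>\<^sup>+r\<in>{r. 0 < r \<and> ennreal r < ennreal m}. ?p r \<partial>lborel) = (\<integral>\<^sup>+r\<in>{0..m}. ?p r \<partial>lborel)"
    proof (rule nn_integral_cong_AE)
      have "AE r in lborel. r \<noteq> 0" "AE r in lborel. r \<noteq> m" by (rule AE_lborel_singleton)+
      then show "AE r in lborel. ?p r * indicator {r. 0 < r \<and> ennreal r < ennreal m} r = ?p r * indicator {0..m} r"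
        by eventually_elim (auto simp: indicator_def ennreal_less_iff)
    qed
    also have "\<dots> = ennreal (m powr (1 / ?n) / (1 / ?n))"
      using nn_integral_powr_0[OF e(2), of m] m unfolding e(1) by simp
    finally show ?thesis by (simp add: mult.commute)
  qed
  have "(\<integral>\<^sup>+w\<in>F. ?k w x \<partial>lborel) \<le>
      ennreal C * (\<integral>\<^sup>+r\<in>{r. 0 < r \<and> ennreal r < emeasure lborel F}. ?p r \<partial>lborel)"
    if F[measurable]: "F \<in> sets borel" for F :: "(real^'n) set" and x
  proof (cases "emeasure lborel F")
    case (real m)
    show ?thesis
    proof (cases "m = 0")
      case True
      then have "AE w in lborel. w \<notin> F" using real F by (intro AE_not_in) (auto simp: null_sets_def)
      then have "(\<integral>\<^sup>+w\<in>F. ?k w x \<partial>lborel) = 0"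
        by (subst nn_integral_0_iff_AE) (auto elim!: eventually_mono)
      then show ?thesis by simp
    next
      case False
      then have m: "m > 0" using real by simp
      have "(\<integral>\<^sup>+w\<in>F. ?k w x \<partial>lborel) \<le> ennreal (C * m powr (1 / ?n))"
        using F m real by (intro C) auto
      also have "\<dots> \<le> ennreal (C * (?n * m powr (1 / ?n)))"
        using C n by (intro ennreal_leI mult_left_mono) (auto simp: mult_le_cancel_right1)
      also have "\<dots> = ennreal C * ennreal (?n * m powr (1 / ?n))" using C by (simp add: ennreal_mult')
      finally show ?thesis unfolding real using seg[OF m] by (simp only:)
    qed
  next
    case top
    have "ennreal (real k) \<le> (\<integral>\<^sup>+r\<in>{r. 0 < r \<and> ennreal r < top}. ?p r \<partial>lborel)" for k :: nat
    proof (cases "k = 0")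
      case False
      define m where "m = real k powr ?n"
      have m: "m > 0" using False by (simp add: m_def)
      have "ennreal (real k) \<le> ennreal (?n * m powr (1 / ?n))"
        using n False by (intro ennreal_leI) (simp add: m_def powr_powr mult_le_cancel_right1)
      also have "\<dots> = (\<integral>\<^sup>+r\<in>{r. 0 < r \<and> ennreal r < ennreal m}. ?p r \<partial>lborel)" using seg[OF m] by simp
      also have "\<dots> \<le> (\<integral>\<^sup>+r\<in>{r. 0 < r \<and> ennreal r < top}. ?p r \<partial>lborel)"
        by (intro nn_integral_mono) (auto simp: indicator_def)
      finally show ?thesis .
    qed simp
    then have "(\<integral>\<^sup>+r\<in>{r. 0 < r \<and> ennreal r < top}. ?p r \<partial>lborel) = top"
      by (rule ennreal_eq_topI)
    then show ?thesis unfolding top using C by (simp add: ennreal_mult_top)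
  qed
  with C(1) show ?thesis by blast
qed

text \<open>The estimate for sets is integrated over the levels of min(f, t). The initial segments
  that appear are the level sets of the truncated rearrangement, so a second layer cake reassembles
  the one-dimensional integral.\<close>

lemma nn_integral_truncated_kernel_le:
  assumes n: "CARD('n::finite) \<ge> 2"
  shows "\<exists>C>0. \<forall>(f :: real^'n \<Rightarrow> ennreal) x t. f \<in> borel_measurable borel \<longrightarrow>
    (\<integral>\<^sup>+y. min (f y) t * ennreal (norm (y - x) powr (- (real CARD('n) - 1))) \<partial>lborel) \<le>
      ennreal C * (\<integral>\<^sup>+r\<in>{0<..}. min (decreasing_rearrangement lborel f r) t *
        ennreal (r powr (- ((real CARD('n) - 1) / real CARD('n)))) \<partial>lborel)"
proof -
  let ?k = "\<lambda>w x::real^'n. ennreal (norm (w - x) powr (- (real CARD('n) - 1)))"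
  let ?p = "\<lambda>r. ennreal (r powr (- ((real CARD('n) - 1) / real CARD('n))))"
  obtain C where C: "C > 0" "\<And>x F. F \<in> sets borel \<Longrightarrow>
    (\<integral>\<^sup>+w\<in>F. ?k w x \<partial>lborel) \<le> ennreal C * (\<integral>\<^sup>+r\<in>{r. 0 < r \<and> ennreal r < emeasure lborel F}. ?p r \<partial>lborel)"
    using nn_integral_kernel_le_initial_segment[OF n] by blast
  have "(\<integral>\<^sup>+y. min (f y) t * ?k y x \<partial>lborel) \<le> ennreal C * (\<integral>\<^sup>+r\<in>{0<..}. min (decreasing_rearrangement lborel f r) t * ?p r \<partial>lborel)"
    if f[measurable]: "f \<in> borel_measurable borel" for f :: "real^'n \<Rightarrow> ennreal" and x t
  proof -
    let ?F = "decreasing_rearrangement lborel f"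
    have fl: "f \<in> borel_measurable lborel" by simp
    have "(\<integral>\<^sup>+y. min (f y) t * ?k y x \<partial>lborel) =
        (\<integral>\<^sup>+q\<in>{0<..}. (\<integral>\<^sup>+y\<in>{y \<in> space lborel. ennreal q < min (f y) t}. ?k y x \<partial>lborel) \<partial>lborel)"
      by (rule lborel.nn_integral_layer_cake) measurable
    also have "\<dots> \<le> (\<integral>\<^sup>+q. ennreal C * ((\<integral>\<^sup>+r\<in>{r \<in> space lborel. ennreal q < min (?F r) t}. ?p r * indicator {0<..} r \<partial>lborel) * indicator {0<..} q) \<partial>lborel)"
    proof (rule nn_integral_mono)
      fix q :: real
      have *: "{r. 0 < r \<and> ennreal r < emeasure lborel {y \<in> space lborel. ennreal q < min (f y) t}} =
          {r. 0 < r \<and> ennreal q < min (?F r) t}" if "q > 0"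
      proof (cases "ennreal q < t")
        case True
        then show ?thesis using less_decreasing_rearrangement_iff[OF fl, of "ennreal q"] by simp
      next
        case False
        then show ?thesis by simp
      qed
      have "(\<integral>\<^sup>+y\<in>{y \<in> space lborel. ennreal q < min (f y) t}. ?k y x \<partial>lborel) \<le>
        ennreal C * (\<integral>\<^sup>+r\<in>{r. 0 < r \<and> ennreal r < emeasure lborel {y \<in> space lborel. ennreal q < min (f y) t}}. ?p r \<partial>lborel)"
        by (rule C) measurable
      also have "(\<integral>\<^sup>+r\<in>{r. 0 < r \<and> ennreal r < emeasure lborel {y \<in> space lborel. ennreal q < min (f y) t}}. ?p r \<partial>lborel) =
         (\<integral>\<^sup>+r\<in>{r \<in> space lborel. ennreal q < min (?F r) t}. ?p r * indicator {0<..} r \<partial>lborel)" if "q > 0"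
        unfolding *[OF that] by (intro nn_integral_cong) (auto simp: indicator_def)
      finally show "(\<integral>\<^sup>+y\<in>{y \<in> space lborel. ennreal q < min (f y) t}. ?k y x \<partial>lborel) * indicator {0<..} q \<le>
          ennreal C * ((\<integral>\<^sup>+r\<in>{r \<in> space lborel. ennreal q < min (?F r) t}. ?p r * indicator {0<..} r \<partial>lborel) * indicator {0<..} q)"
        by (cases "q > 0") simp_all
    qed
    also have "\<dots> = ennreal C * (\<integral>\<^sup>+q\<in>{0<..}. (\<integral>\<^sup>+r\<in>{r \<in> space lborel. ennreal q < min (?F r) t}. ?p r * indicator {0<..} r \<partial>lborel) \<partial>lborel)"
      by (rule nn_integral_cmult) measurable
    also have "(\<integral>\<^sup>+q\<in>{0<..}. (\<integral>\<^sup>+r\<in>{r \<in> space lborel. ennreal q < min (?F r) t}. ?p r * indicator {0<..} r \<partial>lborel) \<partial>lborel) =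
        (\<integral>\<^sup>+r. min (?F r) t * (?p r * indicator {0<..} r) \<partial>lborel)"
      by (rule lborel.nn_integral_layer_cake[symmetric]) measurable
    finally show ?thesis by (simp only: mult.assoc)
  qed
  with C(1) show ?thesis by blast
qed

text \<open>G is only Lebesgue measurable and only matters on \<Omega>, while the estimates above
  take a Borel function on the whole space. The representative f is 0 off \<Omega> and has the same
  rearrangement, so nothing is lost when passing back to the norm of X.\<close>

lemma modulus_representative:
  fixes G :: "real^'n \<Rightarrow> real^'n^'n"
  assumes "open \<Omega>" and G: "locally_integrable \<Omega> G"
  shows "(\<lambda>y. ennreal (norm (G y))) \<in> borel_measurable (lebesgue_on \<Omega>)"
    and "\<exists>f\<in>borel_measurable borel. (AE y in lebesgue. y \<in> \<Omega> \<longrightarrow> ennreal (norm (G y)) = f y) \<and>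
      (\<forall>y. y \<notin> \<Omega> \<longrightarrow> f y = 0) \<and>
      decreasing_rearrangement (lebesgue_on \<Omega>) (\<lambda>y. ennreal (norm (G y))) = decreasing_rearrangement lborel f"
proof -
  have \<Omega>[measurable]: "\<Omega> \<in> sets borel" using \<open>open \<Omega>\<close> by simp
  have \<Omega>l[measurable]: "\<Omega> \<in> sets lebesgue" by (simp add: sets_completionI_sets)
  \<comment> \<open>Local integrability gives measurability on compact subsets only; an exhaustion
    of \<Omega> extends it to \<Omega>.\<close>
  obtain K :: "nat \<Rightarrow> (real^'n) set" where K: "\<And>k. compact (K k)" "\<And>k. K k \<subseteq> \<Omega>"
    "\<And>k. K k \<subseteq> interior (K (Suc k))" "\<Union> (range K) = \<Omega>"
  proof (rule open_Union_compact_subsets[OF \<open>open \<Omega>\<close>])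
    fix C :: "nat \<Rightarrow> (real^'n) set"
    assume "\<And>n. compact (C n)" "\<And>n. C n \<subseteq> \<Omega>" "\<And>n. C n \<subseteq> interior (C (Suc n))" "\<Union> (range C) = \<Omega>"
    then show thesis by (rule that)
  qed
  have mono: "K k \<subseteq> K l" if "k \<le> l" for k l
    using order_trans[OF K(3) interior_subset] that by (rule lift_Suc_mono_le)
  have Gm: "(\<lambda>y. indicator (K k) y *\<^sub>R G y) \<in> borel_measurable lebesgue" for k
  proof -
    have "G absolutely_integrable_on K k"
      using G K(1,2)[of k] by (simp add: locally_integrable_def)
    then show ?thesis
      unfolding set_integrable_def by (rule borel_measurable_integrable)
  qed
  have gm: "(\<lambda>y. ennreal (norm (indicator \<Omega> y *\<^sub>R G y))) \<in> borel_measurable lebesgue"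
  proof -
    have "(\<lambda>y. indicator \<Omega> y *\<^sub>R G y) \<in> borel_measurable lebesgue"
    proof (rule borel_measurable_LIMSEQ_metric[OF Gm])
      fix y
      show "(\<lambda>k. indicator (K k) y *\<^sub>R G y) \<longlonglongrightarrow> indicator \<Omega> y *\<^sub>R G y"
      proof (cases "y \<in> \<Omega>")
        case True
        then obtain k where "y \<in> K k" using K(4) by auto
        then have "indicator (K l) y *\<^sub>R G y = indicator \<Omega> y *\<^sub>R G y" if "l \<ge> k" for l
          using mono[OF that] True by auto
        then show ?thesis
          by (intro tendsto_eventually) (auto simp: eventually_sequentially)
      next
        case False
        then have "y \<notin> K k" for k using K(2) by auto
        with False show ?thesis by simp
      qed
    qed
    then show ?thesis by measurable
  qed
  have gm': "(\<lambda>y. ennreal (norm (G y)) * indicator \<Omega> y) \<in> borel_measurable lebesgue"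
    using gm by (rule measurable_cong[THEN iffD1, rotated]) (auto simp: indicator_def)
  then show Gmeas: "(\<lambda>y. ennreal (norm (G y))) \<in> borel_measurable (lebesgue_on \<Omega>)"
    by (subst borel_measurable_restrict_space_iff_ennreal) auto
  obtain g where g: "g \<in> borel_measurable lborel" "AE y in lborel. ennreal (norm (G y)) * indicator \<Omega> y = g y"
    using completion_ex_borel_measurable[OF gm'] by blast
  define f where "f y = g y * indicator \<Omega> y" for y
  have f[measurable]: "f \<in> borel_measurable borel" using g(1) unfolding f_def by simp
  have ae: "AE y in lborel. y \<in> \<Omega> \<longrightarrow> ennreal (norm (G y)) = f y"
    using g(2) by eventually_elim (auto simp: f_def)
  then have ae': "AE y in lebesgue. y \<in> \<Omega> \<longrightarrow> ennreal (norm (G y)) = f y"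
    by (rule AE_completion)
  have f0: "f y = 0" if "y \<notin> \<Omega>" for y using that by (simp add: f_def)
  have "emeasure (lebesgue_on \<Omega>) {y \<in> space (lebesgue_on \<Omega>). t < ennreal (norm (G y))} =
      emeasure lborel {y \<in> space lborel. t < f y}" for t
  proof -
    have m: "{y \<in> \<Omega>. t < ennreal (norm (G y))} \<in> sets lebesgue"
    proof -
      have "{y \<in> space lebesgue. t < ennreal (norm (G y)) * indicator \<Omega> y} \<in> sets lebesgue"
        using gm' by measurable
      also have "{y \<in> space lebesgue. t < ennreal (norm (G y)) * indicator \<Omega> y} = {y \<in> \<Omega>. t < ennreal (norm (G y))}"
        by (auto simp: indicator_def split: if_splits)
      finally show ?thesis .
    qed
    have "emeasure (lebesgue_on \<Omega>) {y \<in> space (lebesgue_on \<Omega>). t < ennreal (norm (G y))} =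
        emeasure lebesgue {y \<in> \<Omega>. t < ennreal (norm (G y))}"
      by (subst emeasure_restrict_space) (auto simp: space_restrict_space Int_absorb1)
    also have "\<dots> = emeasure lebesgue {y. t < f y}"
    proof (rule emeasure_eq_AE[OF _ m])
      show "AE y in lebesgue. y \<in> {y \<in> \<Omega>. t < ennreal (norm (G y))} \<longleftrightarrow> y \<in> {y. t < f y}"
        using ae' by eventually_elim (use f0 in \<open>auto, metis not_less_zero\<close>)
      have "{y \<in> space borel. t < f y} \<in> sets borel" by measurable
      then show "{y. t < f y} \<in> sets lebesgue" by (simp add: sets_completionI_sets)
    qed
    also have "\<dots> = emeasure lborel {y. t < f y}"
    proof -
      have "{y \<in> space borel. t < f y} \<in> sets borel" by measurable
      then show ?thesis by (simp add: emeasure_completion)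
    qed
    finally show ?thesis by simp
  qed
  then have "decreasing_rearrangement (lebesgue_on \<Omega>) (\<lambda>y. ennreal (norm (G y))) = decreasing_rearrangement lborel f"
    by (intro ext) (simp only: decreasing_rearrangement_def)
  with f ae' f0 show "\<exists>f\<in>borel_measurable borel. (AE y in lebesgue. y \<in> \<Omega> \<longrightarrow> ennreal (norm (G y)) = f y) \<and>
      (\<forall>y. y \<notin> \<Omega> \<longrightarrow> f y = 0) \<and>
      decreasing_rearrangement (lebesgue_on \<Omega>) (\<lambda>y. ennreal (norm (G y))) = decreasing_rearrangement lborel f"
    by blast
qed

text \<open>By Tonelli, the integral of the potential over a set of \<mu>-measure m is at most the
  integral of f - t times the kernel bound C m^(1-\<theta>), which is uniform in the centre y. This
  is the input of \<open>weak_type_of_restricted\<close>.\<close>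

lemma excess_weak_type:
  fixes f :: "real^'n \<Rightarrow> ennreal" and \<alpha> K :: real
  assumes n: "CARD('n) \<ge> 2" "real CARD('n) - 1 < \<alpha>" and K: "K > 0"
    and reg: "upper_regular \<alpha> K \<Omega> \<mu>" and f[measurable]: "f \<in> borel_measurable borel"
    and f0: "\<And>y. y \<notin> \<Omega> \<Longrightarrow> f y = 0"
    and t: "(\<integral>\<^sup>+y. f y - t \<partial>lborel) \<le> ennreal J" and J: "J > 0" and s: "s > 0"
    and C: "C = 1 + K * 2 powr \<alpha> * 2 powr (real CARD('n) - 1) / (1 - 2 powr (real CARD('n) - 1 - \<alpha>))"
  shows "emeasure \<mu> {x \<in> space \<mu>. ennreal (C * J * 2 powr ((real CARD('n) - 1) / \<alpha>) * s powr (- ((real CARD('n) - 1) / \<alpha>))) <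
      (\<integral>\<^sup>+y. (f y - t) * ennreal (norm (y - x) powr (- (real CARD('n) - 1))) \<partial>lborel)} \<le> ennreal (s / 2)"
proof -
  let ?\<beta> = "real CARD('n) - 1"
  define \<theta> where "\<theta> = ?\<beta> / \<alpha>"
  have \<theta>: "\<theta> > 0" using n by (simp add: \<theta>_def)
  have "(2::real) powr (?\<beta> - \<alpha>) < 1" using n powr_less_one[of 2 "?\<beta> - \<alpha>"] by simp
  then have C0: "C > 0" unfolding C using K by (intro add_pos_nonneg divide_nonneg_nonneg) auto
  let ?k = "\<lambda>x y::real^'n. ennreal (norm (y - x) powr (- ?\<beta>))"
  define h where "h x = (\<integral>\<^sup>+y. (f y - t) * ?k x y \<partial>lborel)" for x
  have hm: "h \<in> borel_measurable borel" unfolding h_def by measurable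
  interpret \<mu>: sigma_finite_measure \<mu> by (rule upper_regular_sigma_finite[OF reg])
  interpret P: pair_sigma_finite \<mu> "lborel :: (real^'n) measure" ..
  \<comment> \<open>Chosen so that (C J / c)^(1/\<theta>) is exactly s/2.\<close>
  define c where "c = C * J * 2 powr \<theta> * s powr (- \<theta>)"
  have c: "c > 0" using C0 J s by (simp add: c_def)
  have "emeasure \<mu> {x \<in> space \<mu>. ennreal c < h x} \<le> ennreal ((C * J / c) powr (1 / \<theta>))"
  proof (rule \<mu>.weak_type_of_restricted[OF upper_regular_sets(2)[OF reg hm] \<theta> _ c])
    fix F m assume F: "F \<in> sets \<mu>" and m: "0 < m" "emeasure \<mu> F \<le> ennreal m"
    have idm: "(\<lambda>x. x) \<in> measurable \<mu> borel"
      using reg unfolding upper_regular_def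
      by (metis measurable_cong_sets measurable_ident_sets measurable_restrict_space1 id_apply measurable_ident)
    have meas: "(\<lambda>z. (f (snd z) - t) * (?k (fst z) (snd z) * indicator F (fst z))) \<in> borel_measurable (\<mu> \<Otimes>\<^sub>M lborel)"
    proof -
      have "(\<lambda>z. (fst z, snd z)) \<in> measurable (\<mu> \<Otimes>\<^sub>M lborel) (borel \<Otimes>\<^sub>M borel)"
        by (intro measurable_Pair measurable_compose[OF measurable_fst idm])
          (use measurable_snd[of \<mu> "lborel :: (real^'n) measure"] in simp)
      from measurable_compose[OF this, of "\<lambda>z. (f (snd z) - t) * ?k (fst z) (snd z)" borel]
      have 1: "(\<lambda>z. (f (snd z) - t) * ?k (fst z) (snd z)) \<in> borel_measurable (\<mu> \<Otimes>\<^sub>M lborel)"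
        by simp
      have 2: "(\<lambda>z. indicator F (fst z) :: ennreal) \<in> borel_measurable (\<mu> \<Otimes>\<^sub>M lborel)"
        by (rule measurable_compose[OF measurable_fst borel_measurable_indicator[OF F]])
      show ?thesis using borel_measurable_times_ennreal[OF 1 2] by (simp only: mult.assoc)
    qed
    have kF: "(\<lambda>x. ?k x y * indicator F x) \<in> borel_measurable \<mu>" for y
      by (intro borel_measurable_times_ennreal borel_measurable_indicator F upper_regular_sets(2)[OF reg]) measurable
    have "(\<integral>\<^sup>+x\<in>F. h x \<partial>\<mu>) = (\<integral>\<^sup>+x. (\<integral>\<^sup>+y. (f y - t) * (?k x y * indicator F x) \<partial>lborel) \<partial>\<mu>)"
      unfolding h_def mult.assoc[symmetric] by (intro nn_integral_cong nn_integral_multc[symmetric]) measurable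
    also have "\<dots> = (\<integral>\<^sup>+y. (\<integral>\<^sup>+x. (f y - t) * (?k x y * indicator F x) \<partial>\<mu>) \<partial>lborel)"
      using P.Fubini'[of "\<lambda>x y. (f y - t) * (?k x y * indicator F x)"] meas
      by (simp add: split_def)
    also have "\<dots> = (\<integral>\<^sup>+y. (f y - t) * (\<integral>\<^sup>+x\<in>F. ?k x y \<partial>\<mu>) \<partial>lborel)"
      by (intro nn_integral_cong nn_integral_cmult kF)
    also have "\<dots> \<le> (\<integral>\<^sup>+y. (f y - t) * ennreal (C * m powr (1 - \<theta>)) \<partial>lborel)"
    proof (rule nn_integral_mono)
      fix y
      \<comment> \<open>The kernel bound requires y in the closure of \<Omega>; elsewhere f vanishes
        and so does the excess.\<close>
      show "(f y - t) * (\<integral>\<^sup>+x\<in>F. ?k x y \<partial>\<mu>) \<le> (f y - t) * ennreal (C * m powr (1 - \<theta>))"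
      proof (cases "y \<in> \<Omega>")
        case True
        then have "y \<in> closure \<Omega>" using closure_subset by blast
        from upper_regular_kernel_le[OF reg this K n F m]
        have "(\<integral>\<^sup>+x\<in>F. ?k x y \<partial>\<mu>) \<le> ennreal (C * m powr (1 - \<theta>))"
          by (simp only: C \<theta>_def norm_minus_commute[of y])
        then show ?thesis by (rule mult_left_mono) simp
      next
        case False
        then show ?thesis by (simp add: f0)
      qed
    qed
    also have "\<dots> = (\<integral>\<^sup>+y. f y - t \<partial>lborel) * ennreal (C * m powr (1 - \<theta>))"
      by (rule nn_integral_multc) measurable
    also have "\<dots> \<le> ennreal J * ennreal (C * m powr (1 - \<theta>))"
      by (intro mult_right_mono t) simp
    also have "\<dots> = ennreal (C * J * m powr (1 - \<theta>))"
      using J C0 by (simp add: ennreal_mult'[symmetric] mult_ac)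
    finally show "(\<integral>\<^sup>+x\<in>F. h x \<partial>\<mu>) \<le> ennreal (C * J * m powr (1 - \<theta>))" .
  qed (use C0 J in simp)
  also have "(C * J / c) powr (1 / \<theta>) = s / 2"
  proof -
    have "C * J / c = (s / 2) powr \<theta>"
      using C0 J s by (simp add: c_def powr_minus powr_divide field_simps)
    then show ?thesis using \<theta> s by (simp add: powr_powr)
  qed
  finally show ?thesis by (simp only: c_def h_def \<theta>_def)
qed

section \<open>The bound for the rearrangement of u\<close>

lemma decreasing_rearrangement_le_average:
  assumes "0 \<le> a" "a \<le> b"
  shows "decreasing_rearrangement M f a * ennreal a \<le>
    (\<integral>\<^sup>+r\<in>{0..b}. decreasing_rearrangement M f r \<partial>lborel)"
proof -
  have "decreasing_rearrangement M f a * ennreal a = (\<integral>\<^sup>+r\<in>{0..a}. decreasing_rearrangement M f a \<partial>lborel)"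
    using assms by (simp add: nn_integral_cmult_indicator)
  also have "\<dots> \<le> (\<integral>\<^sup>+r\<in>{0..b}. decreasing_rearrangement M f r \<partial>lborel)"
    using assms by (intro nn_integral_mono) (auto simp: indicator_def intro: decreasing_rearrangement_antimono)
  finally show ?thesis .
qed

text \<open>Up to a the minimum is at most the value at a, the weight integrates to n a^(1/n), and
  monotonicity bounds a times that value by the integral over [0,a]. Beyond a the truncation is
  dropped.\<close>

lemma nn_integral_truncated_rearrangement_le:
  fixes n :: real
  assumes n: "n \<ge> 2" and a: "a > 0"
  shows "(\<integral>\<^sup>+r\<in>{0<..}. min (decreasing_rearrangement M f r) (decreasing_rearrangement M f a) *
      ennreal (r powr (- ((n - 1) / n))) \<partial>lborel) \<le>
    ennreal (n * a powr (- ((n - 1) / n))) * (\<integral>\<^sup>+r\<in>{0..a}. decreasing_rearrangement M f r \<partial>lborel) +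
    (\<integral>\<^sup>+r\<in>{a..}. ennreal (r powr (- ((n - 1) / n))) * decreasing_rearrangement M f r \<partial>lborel)"
proof -
  let ?F = "decreasing_rearrangement M f" and ?p = "\<lambda>r. ennreal (r powr (- ((n - 1) / n)))"
  have e: "- ((n - 1) / n) + 1 = 1 / n" "- ((n - 1) / n) > -1" using n by (auto simp: field_simps)
  have "(\<integral>\<^sup>+r\<in>{0<..}. min (?F r) (?F a) * ?p r \<partial>lborel) \<le>
      (\<integral>\<^sup>+r. ?F a * (?p r * indicator {0..a} r) + ?p r * ?F r * indicator {a..} r \<partial>lborel)"
  proof (rule nn_integral_mono)
    fix r :: real
    consider "r \<le> 0" | "0 < r" "r \<le> a" | "a < r" by linarith
    then show "min (?F r) (?F a) * ?p r * indicator {0<..} r \<le>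
        ?F a * (?p r * indicator {0..a} r) + ?p r * ?F r * indicator {a..} r"
    proof cases
      case 2
      have "min (?F r) (?F a) * ?p r \<le> ?F a * ?p r" by (intro mult_right_mono) auto
      then show ?thesis using 2 by (auto intro: add_increasing2)
    next
      case 3
      have "min (?F r) (?F a) * ?p r \<le> ?F r * ?p r" by (intro mult_right_mono) auto
      then show ?thesis using 3 a by (simp add: mult.commute)
    qed simp
  qed
  also have "\<dots> = ?F a * (\<integral>\<^sup>+r\<in>{0..a}. ?p r \<partial>lborel) + (\<integral>\<^sup>+r\<in>{a..}. ?p r * ?F r \<partial>lborel)"
    by (subst nn_integral_add) (auto simp: nn_integral_cmult)
  also have "(\<integral>\<^sup>+r\<in>{0..a}. ?p r \<partial>lborel) = ennreal (n * a powr (- ((n - 1) / n))) * ennreal a"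
  proof -
    have "(\<integral>\<^sup>+r\<in>{0..a}. ?p r \<partial>lborel) = ennreal (a powr (- ((n - 1) / n) + 1) / (1 / n))"
      using nn_integral_powr_0[OF e(2), of a] a by (simp only: e(1))
    also have "a powr (- ((n - 1) / n) + 1) / (1 / n) = n * a powr (- ((n - 1) / n)) * a"
      unfolding powr_add using a by simp
    also have "ennreal \<dots> = ennreal (n * a powr (- ((n - 1) / n))) * ennreal a"
      using a by (intro ennreal_mult'') simp
    finally show ?thesis .
  qed
  also have "?F a * (ennreal (n * a powr (- ((n - 1) / n))) * ennreal a) =
      ennreal (n * a powr (- ((n - 1) / n))) * (?F a * ennreal a)"
    by (simp only: mult_ac)
  also have "\<dots> \<le> ennreal (n * a powr (- ((n - 1) / n))) * (\<integral>\<^sup>+r\<in>{0..a}. ?F r \<partial>lborel)"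
    using a by (intro mult_left_mono decreasing_rearrangement_le_average) auto
  finally show ?thesis by (simp add: add_right_mono)
qed

text \<open>Connects the rearrangement on the boundary, which is defined through the restricted
  Hausdorff measure, with the outer measure, from which covers can be extracted.\<close>

lemma boundary_level_set:
  fixes u :: "real^'n \<Rightarrow> real^'n"
  assumes "open \<Omega>" and u: "continuous_on (closure \<Omega>) u"
  shows "(\<lambda>x. ennreal (norm (u x))) \<in> borel_measurable (restrict_space (hausdorff_measure m) (frontier \<Omega>))"
    and "0 \<le> \<tau> \<Longrightarrow> emeasure (restrict_space (hausdorff_measure m) (frontier \<Omega>))
      {x \<in> space (restrict_space (hausdorff_measure m) (frontier \<Omega>)). ennreal \<tau> < ennreal (norm (u x))} =
      hausdorff_outer m {x \<in> frontier \<Omega>. \<tau> < norm (u x)}"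
proof -
  have fr: "closed (frontier \<Omega>)" "frontier \<Omega> \<subseteq> closure \<Omega>" by (auto simp: frontier_def)
  have "continuous_on (frontier \<Omega>) (\<lambda>x. norm (u x))"
    using continuous_on_subset[OF u fr(2)] by (intro continuous_intros)
  then have m: "(\<lambda>x. norm (u x)) \<in> borel_measurable (restrict_space borel (frontier \<Omega>))"
    by (rule borel_measurable_continuous_on_restrict)
  have s: "sets (restrict_space (hausdorff_measure m) (frontier \<Omega>)) = sets (restrict_space borel (frontier \<Omega>))"
    by (simp add: sets_restrict_space)
  have m': "(\<lambda>x. norm (u x)) \<in> borel_measurable (restrict_space (hausdorff_measure m) (frontier \<Omega>))"
    unfolding measurable_cong_sets[OF s refl] by (rule m)
  then show "(\<lambda>x. ennreal (norm (u x))) \<in> borel_measurable (restrict_space (hausdorff_measure m) (frontier \<Omega>))"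
    by simp
  assume \<tau>: "0 \<le> \<tau>"
  let ?E = "{x \<in> frontier \<Omega>. \<tau> < norm (u x)}"
  have "{x \<in> space (restrict_space borel (frontier \<Omega>)). \<tau> < norm (u x)} \<in> sets (restrict_space borel (frontier \<Omega>))"
    using m by measurable
  then have "?E \<in> sets (restrict_space borel (frontier \<Omega>))" by (simp add: space_restrict_space)
  then have E: "?E \<in> sets borel"
    using fr(1) by (subst (asm) sets_restrict_space_iff) auto
  have "emeasure (restrict_space (hausdorff_measure m) (frontier \<Omega>)) ?E = emeasure (hausdorff_measure m) ?E"
    using fr(1) by (intro emeasure_restrict_space) auto
  also have "\<dots> = hausdorff_outer m ?E" by (rule emeasure_hausdorff_measure[OF E])
  finally show "emeasure (restrict_space (hausdorff_measure m) (frontier \<Omega>))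
      {x \<in> space (restrict_space (hausdorff_measure m) (frontier \<Omega>)). ennreal \<tau> < ennreal (norm (u x))} =
      hausdorff_outer m ?E"
    using \<tau> by (simp add: space_restrict_space ennreal_less_iff)
qed

text \<open>The exponents come from scaling. With \<theta> = (n-1)/\<alpha>, an exceptional set of
  \<mu>-measure s/2 can be afforded once the boundary level set has Hausdorff measure of order
  s^\<theta>. Truncating at the value of the rearrangement at s^(n/\<alpha>) gives the excess and
  the part of the truncated potential coming from r <= s^(n/\<alpha>) the common weight
  s^(-\<theta>).\<close>

lemma rearrangement_estimate:
  fixes \<alpha> K :: real
  assumes n: "CARD('n::finite) \<ge> 2" "real CARD('n) - 1 < \<alpha>" and K: "K > 0"
  shows "\<exists>C>0. \<forall>(\<Omega> :: (real^'n) set) \<mu> (u :: real^'n \<Rightarrow> real^'n) G. \<forall>s>0.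
    upper_regular \<alpha> K \<Omega> \<mu> \<longrightarrow> has_sym_grad \<Omega> u G \<longrightarrow> u \<in> Cb_closure \<Omega> \<longrightarrow>
    decreasing_rearrangement \<mu> (\<lambda>x. ennreal (norm (u x))) s \<le> ennreal C *
      (ennreal (s powr (- ((real CARD('n) - 1) / \<alpha>))) *
        (\<integral>\<^sup>+r\<in>{0..s powr (real CARD('n) / \<alpha>)}.
          decreasing_rearrangement (lebesgue_on \<Omega>) (\<lambda>x. ennreal (norm (G x))) r \<partial>lborel) +
       (\<integral>\<^sup>+r\<in>{s powr (real CARD('n) / \<alpha>)..}. ennreal (r powr (- ((real CARD('n) - 1) / real CARD('n)))) *
          decreasing_rearrangement (lebesgue_on \<Omega>) (\<lambda>x. ennreal (norm (G x))) r \<partial>lborel) +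
       ennreal (s powr (- ((real CARD('n) - 1) / \<alpha>))) *
        (\<integral>\<^sup>+r\<in>{0..s powr ((real CARD('n) - 1) / \<alpha>)}.
          decreasing_rearrangement (restrict_space (hausdorff_measure (CARD('n) - 1)) (frontier \<Omega>))
            (\<lambda>x. ennreal (norm (u x))) r \<partial>lborel))"
proof -
  let ?n = "real CARD('n)"
  let ?\<beta> = "?n - 1"
  let ?k = "\<lambda>x y::real^'n. ennreal (norm (y - x) powr (- ?\<beta>))"
  let ?c = "measure lborel (ball (0::real^'n) (1/4))"
  define \<theta> where "\<theta> = ?\<beta> / \<alpha>"
  have \<alpha>: "\<alpha> > 0" and \<theta>: "\<theta> > 0" using n by (auto simp: \<theta>_def)
  obtain Cp where Cp: "Cp > 0" "\<And>\<Omega> (u :: real^'n \<Rightarrow> real^'n) G (f :: real^'n \<Rightarrow> ennreal) x \<tau> Bad.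
    open \<Omega> \<Longrightarrow> has_sym_grad \<Omega> u G \<Longrightarrow> continuous_on (closure \<Omega>) u \<Longrightarrow>
    bounded {y \<in> closure \<Omega>. u y \<noteq> 0} \<Longrightarrow> f \<in> borel_measurable borel \<Longrightarrow>
    (AE y in lebesgue. y \<in> \<Omega> \<longrightarrow> ennreal (norm (G y)) \<le> f y) \<Longrightarrow>
    x \<in> \<Omega> \<Longrightarrow> 0 \<le> \<tau> \<Longrightarrow> Bad \<in> sets borel \<Longrightarrow> emeasure lborel Bad \<le> ennreal (?c / 2) \<Longrightarrow>
    (\<forall>t v. 0 < t \<longrightarrow> 1 < norm v \<longrightarrow> norm v < 2 \<longrightarrow> x + t *\<^sub>R v \<in> frontier \<Omega> \<longrightarrow> v \<notin> Bad \<longrightarrow>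
      norm (u (x + t *\<^sub>R v)) \<le> \<tau>) \<Longrightarrow>
    ennreal (norm (u x)) \<le> ennreal (2 * \<tau>) + ennreal Cp * (\<integral>\<^sup>+y. f y * ?k x y \<partial>lborel)"
    using pointwise_estimate[OF n(1)] by blast
  obtain Cb where Cb: "Cb > 0" "\<And>(\<Omega> :: (real^'n) set) \<mu> E s. s > 0 \<Longrightarrow> upper_regular \<alpha> K \<Omega> \<mu> \<Longrightarrow> E \<subseteq> frontier \<Omega> \<Longrightarrow>
    hausdorff_outer (CARD('n) - 1) E < ennreal s \<Longrightarrow>
    \<exists>B\<in>sets \<mu>. emeasure \<mu> B \<le> ennreal ((Cb * s) powr (\<alpha> / ?\<beta>)) \<and>
      (\<forall>x\<in>\<Omega> - B. \<exists>Bad\<in>sets borel. emeasure lborel Bad \<le> ennreal (?c / 2) \<and>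
        (\<forall>t v. 0 < t \<longrightarrow> 1 < norm v \<longrightarrow> norm v < 2 \<longrightarrow> x + t *\<^sub>R v \<in> E \<longrightarrow> v \<in> Bad))"
    using boundary_directions[OF n K] by blast
  obtain Ct where Ct: "Ct > 0" "\<And>(f :: real^'n \<Rightarrow> ennreal) x t. f \<in> borel_measurable borel \<Longrightarrow>
    (\<integral>\<^sup>+y. min (f y) t * ?k x y \<partial>lborel) \<le> ennreal Ct * (\<integral>\<^sup>+r\<in>{0<..}. min (decreasing_rearrangement lborel f r) t *
        ennreal (r powr (- (?\<beta> / ?n))) \<partial>lborel)"
    using nn_integral_truncated_kernel_le[OF n(1)] by blast
  define C3 where "C3 = 1 + K * 2 powr \<alpha> * 2 powr ?\<beta> / (1 - 2 powr (?\<beta> - \<alpha>))"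
  have "(2::real) powr (?\<beta> - \<alpha>) < 1" using n powr_less_one[of 2 "?\<beta> - \<alpha>"] by simp
  then have C3: "C3 > 0" unfolding C3_def using K by (intro add_pos_nonneg divide_nonneg_nonneg) auto
  \<comment> \<open>With b = \<kappa> s^\<theta>, the bound \<kappa> <= 1 lets the integral of the
    boundary rearrangement over [0, s^\<theta>] control its value at b. The other bound makes Cb
    (2b) at most (s/2)^\<theta>, so that the exceptional set B has \<mu>-measure at most
    s/2.\<close>
  define \<kappa> where "\<kappa> = min 1 ((1/2) powr \<theta> / (2 * Cb))"
  have \<kappa>: "0 < \<kappa>" "\<kappa> \<le> 1" "2 * Cb * \<kappa> \<le> (1/2) powr \<theta>"
  proof -
    show "0 < \<kappa>" "\<kappa> \<le> 1" using Cb(1) by (auto simp: \<kappa>_def)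
    have "\<kappa> \<le> (1/2) powr \<theta> / (2 * Cb)" by (simp add: \<kappa>_def)
    then show "2 * Cb * \<kappa> \<le> (1/2) powr \<theta>" using Cb(1) by (simp add: field_simps)
  qed
  \<comment> \<open>The term 2/\<kappa> belongs to the boundary level, Ct n and Ct to the two parts
    of the truncated potential, and the last term to the excess.\<close>
  define C where "C = 2 / \<kappa> + Cp * (Ct * ?n + Ct + C3 * 2 powr \<theta>)"
  have C: "C > 0" unfolding C_def using \<kappa> Cp(1) Ct(1) C3 by (intro add_pos_pos mult_pos_pos) auto
  have "decreasing_rearrangement \<mu> (\<lambda>x. ennreal (norm (u x))) s \<le> ennreal C *
      (ennreal (s powr (- (?\<beta> / \<alpha>))) * (\<integral>\<^sup>+r\<in>{0..s powr (?n / \<alpha>)}.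
          decreasing_rearrangement (lebesgue_on \<Omega>) (\<lambda>x. ennreal (norm (G x))) r \<partial>lborel) +
       (\<integral>\<^sup>+r\<in>{s powr (?n / \<alpha>)..}. ennreal (r powr (- (?\<beta> / ?n))) *
          decreasing_rearrangement (lebesgue_on \<Omega>) (\<lambda>x. ennreal (norm (G x))) r \<partial>lborel) +
       ennreal (s powr (- (?\<beta> / \<alpha>))) * (\<integral>\<^sup>+r\<in>{0..s powr (?\<beta> / \<alpha>)}.
          decreasing_rearrangement (restrict_space (hausdorff_measure (CARD('n) - 1)) (frontier \<Omega>))
            (\<lambda>x. ennreal (norm (u x))) r \<partial>lborel))" (is "?L \<le> ennreal C * (?T1 + ?T2 + ?T3)")
    if s: "s > 0" and reg: "upper_regular \<alpha> K \<Omega> \<mu>" and G: "has_sym_grad \<Omega> u G" and u: "u \<in> Cb_closure \<Omega>"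
    for \<Omega> :: "(real^'n) set" and \<mu> and u :: "real^'n \<Rightarrow> real^'n" and G s
  proof -
    have \<Omega>: "open \<Omega>" using reg by (simp add: upper_regular_def)
    have uc: "continuous_on (closure \<Omega>) u" and ub: "bounded {y \<in> closure \<Omega>. u y \<noteq> 0}"
      using u by (auto simp: Cb_closure_def)
    let ?H = "restrict_space (hausdorff_measure (CARD('n) - 1)) (frontier \<Omega>)"
    let ?v = "\<lambda>x. ennreal (norm (u x))"
    define F where "F = decreasing_rearrangement (lebesgue_on \<Omega>) (\<lambda>x. ennreal (norm (G x)))"
    define g where "g = decreasing_rearrangement ?H ?v"
    define p where "p = s powr (- \<theta>)"
    have p: "p > 0" using s by (simp add: p_def)
    define a where "a = s powr (?n / \<alpha>)"
    have a: "a > 0" using s by (simp add: a_def)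
    define A1 where "A1 = (\<integral>\<^sup>+r\<in>{0..a}. F r \<partial>lborel)"
    define A2 where "A2 = (\<integral>\<^sup>+r\<in>{a..}. ennreal (r powr (- (?\<beta> / ?n))) * F r \<partial>lborel)"
    define A3 where "A3 = (\<integral>\<^sup>+r\<in>{0..s powr \<theta>}. g r \<partial>lborel)"
    obtain f where f[measurable]: "f \<in> borel_measurable borel"
      and Gf: "AE y in lebesgue. y \<in> \<Omega> \<longrightarrow> ennreal (norm (G y)) = f y"
      and f0: "\<And>y. y \<notin> \<Omega> \<Longrightarrow> f y = 0" and F: "F = decreasing_rearrangement lborel f"
      using modulus_representative(2)[OF \<Omega>, of G] G unfolding has_sym_grad_def F_def by blast
    \<comment> \<open>If A1 or A3 is infinite there is nothing to prove. Otherwise the levels t and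
      \<tau> are finite, because a non-increasing function is bounded at a point by its integral up
      to there.\<close>
    have goal: "?L \<le> ennreal C * (ennreal p * A1 + A2 + ennreal p * A3)"
    proof (cases "A1 = top \<or> A3 = top")
      case True
      then have top: "ennreal p * A1 + A2 + ennreal p * A3 = top" using p by (auto simp: ennreal_mult_top)
      show ?thesis unfolding top using C by (simp add: ennreal_mult_top)
    next
      case False
      then obtain J where J: "J \<ge> 0" "A1 = ennreal J" by (cases A1) auto
      define t where "t = F a"
      have "t * ennreal a \<le> A1" unfolding t_def A1_def F by (rule decreasing_rearrangement_le_average) (use a in auto)
      then have t: "t \<noteq> top" using a J by (auto simp: ennreal_top_mult top_unique)
      define b where "b = \<kappa> * s powr \<theta>"
      have b: "0 < b" "b \<le> s powr \<theta>" using \<kappa> s by (auto simp: b_def mult_left_le_one_le)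
      have gb: "g b * ennreal b \<le> A3" unfolding g_def A3_def using b by (intro decreasing_rearrangement_le_average) auto
      then have "g b \<noteq> top" using False b by (auto simp: ennreal_top_mult top_unique)
      then obtain \<tau> where \<tau>: "\<tau> \<ge> 0" "g b = ennreal \<tau>" by (cases "g b") auto
      define E where "E = {x \<in> frontier \<Omega>. \<tau> < norm (u x)}"
      have "hausdorff_outer (CARD('n) - 1) E = emeasure ?H {x \<in> space ?H. g b < ?v x}"
        unfolding E_def \<tau>(2) by (rule boundary_level_set(2)[OF \<Omega> uc \<tau>(1), symmetric])
      also have "\<dots> \<le> ennreal b"
        unfolding g_def by (rule emeasure_above_decreasing_rearrangement[OF boundary_level_set(1)[OF \<Omega> uc]])
      \<comment> \<open>\<open>boundary_directions\<close> asks for a strict bound, hence 2b in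
        place of b.\<close>
      also have "\<dots> < ennreal (2 * b)" using b by (simp add: ennreal_less_iff)
      finally have HE: "hausdorff_outer (CARD('n) - 1) E < ennreal (2 * b)" .
      have EB: "E \<subseteq> frontier \<Omega>" "2 * b > 0" using b by (auto simp: E_def)
      obtain B where B: "B \<in> sets \<mu>" "emeasure \<mu> B \<le> ennreal ((Cb * (2 * b)) powr (\<alpha> / ?\<beta>))"
        and Bad: "\<forall>x\<in>\<Omega> - B. \<exists>Bad\<in>sets borel. emeasure lborel Bad \<le> ennreal (?c / 2) \<and>
        (\<forall>t v. 0 < t \<longrightarrow> 1 < norm v \<longrightarrow> norm v < 2 \<longrightarrow> x + t *\<^sub>R v \<in> E \<longrightarrow> v \<in> Bad)"
        using Cb(2)[OF EB(2) reg EB(1) HE] by (elim bexE conjE) (rule that)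
      have Ble: "emeasure \<mu> B \<le> ennreal (s / 2)"
      proof -
        have "Cb * (2 * b) = (2 * Cb * \<kappa>) * s powr \<theta>" by (simp add: b_def)
        also have "\<dots> \<le> (1/2) powr \<theta> * s powr \<theta>" using \<kappa>(3) by (intro mult_right_mono) auto
        also have "\<dots> = (s / 2) powr \<theta>" using s by (simp add: powr_mult[symmetric])
        finally have "(Cb * (2 * b)) powr (1 / \<theta>) \<le> ((s / 2) powr \<theta>) powr (1 / \<theta>)"
          using \<theta> Cb(1) b by (intro powr_mono2) auto
        also have "\<dots> = s / 2" using \<theta> s by (simp add: powr_powr)
        finally have "(Cb * (2 * b)) powr (\<alpha> / ?\<beta>) \<le> s / 2" by (simp add: \<theta>_def)
        then show ?thesis using B(2) ennreal_leI order_trans by blast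
      qed
      have excess: "(\<integral>\<^sup>+y. f y - t \<partial>lborel) \<le> A1"
      proof -
        have "(\<integral>\<^sup>+y. f y - t \<partial>lborel) = (\<integral>\<^sup>+r\<in>{0<..}. (F r - t) \<partial>lborel)"
          unfolding F by (rule lborel.nn_integral_excess) (use t in auto)
        also have "\<dots> \<le> A1"
          unfolding A1_def
        proof (rule nn_integral_mono)
          fix r :: real
          show "(F r - t) * indicator {0<..} r \<le> F r * indicator {0..a} r"
          proof (cases "r \<le> a")
            case True
            then show ?thesis by (auto simp: indicator_def diff_le_self_ennreal)
          next
            case False
            then have "F r \<le> t" unfolding t_def F by (intro decreasing_rearrangement_antimono) auto
            then have "F r - t = 0" using t by (intro diff_eq_0_ennreal) (auto simp: less_top intro: order_le_less_trans)
            then show ?thesis by simp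
          qed
        qed
        finally show ?thesis .
      qed
      define h where "h x = (\<integral>\<^sup>+y. (f y - t) * ?k x y \<partial>lborel)" for x
      define m where "m = (\<integral>\<^sup>+r\<in>{0<..}. min (F r) t * ennreal (r powr (- (?\<beta> / ?n))) \<partial>lborel)"
      define X where "X = ennreal (2 * \<tau>) + ennreal Cp * (ennreal Ct * m + ennreal (C3 * 2 powr \<theta> * p) * ennreal J)"
      have weak: "?L \<le> X + ennreal \<delta>" if \<delta>: "\<delta> > 0" for \<delta>
      proof -
        \<comment> \<open>\<open>excess_weak_type\<close> wants a positive bound, but J may be 0, so
          J is raised by d; the choice of d makes the extra term in \<Lambda> exactly
          \<delta>.\<close>
        define d where "d = \<delta> / (Cp * C3 * 2 powr \<theta> * p)"
        have d: "d > 0" using \<delta> Cp(1) C3 p by (simp add: d_def)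
        define c where "c = C3 * (J + d) * 2 powr \<theta> * p"
        have "emeasure \<mu> {x \<in> space \<mu>. ennreal c < h x} \<le> ennreal (s / 2)"
          unfolding c_def h_def p_def \<theta>_def
        proof (rule excess_weak_type[OF n K reg f f0 _ _ s C3_def])
          show "(\<integral>\<^sup>+y. f y - t \<partial>lborel) \<le> ennreal (J + d)"
            using excess J d by (auto intro: order_trans ennreal_leI)
        qed (use J d in auto)
        moreover have hm: "{x \<in> space \<mu>. ennreal c < h x} \<in> sets \<mu>"
        proof -
          have "h \<in> borel_measurable \<mu>"
            by (rule upper_regular_sets(2)[OF reg]) (unfold h_def, measurable)
          then show ?thesis by measurable
        qed
        moreover have "emeasure \<mu> (B \<union> {x \<in> space \<mu>. ennreal c < h x}) \<le> emeasure \<mu> B + emeasure \<mu> {x \<in> space \<mu>. ennreal c < h x}"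
          by (rule emeasure_subadditive[OF B(1) hm])
        ultimately have small: "emeasure \<mu> (B \<union> {x \<in> space \<mu>. ennreal c < h x}) \<le> ennreal (s / 2) + ennreal (s / 2)"
          using Ble by (meson add_mono order_trans)
        define \<Lambda> where "\<Lambda> = ennreal (2 * \<tau>) + ennreal Cp * (ennreal Ct * m + ennreal c)"
        \<comment> \<open>Off B at least half of the directions miss E, and rays that leave \<Omega>
          elsewhere meet values at most \<tau>. Off the second set the potential of the excess is at
          most c. So the pointwise estimate gives at most \<Lambda> outside the union.\<close>
        have "{x \<in> space \<mu>. \<Lambda> < ?v x} \<subseteq> B \<union> {x \<in> space \<mu>. ennreal c < h x}"
        proof (rule subsetI, rule ccontr)
          fix x assume x: "x \<in> {x \<in> space \<mu>. \<Lambda> < ?v x}" "x \<notin> B \<union> {x \<in> space \<mu>. ennreal c < h x}"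
          then have x\<Omega>: "x \<in> \<Omega> - B" and hx: "h x \<le> ennreal c" using upper_regular_sets(1)[OF reg] by auto
          obtain Bd where Bd: "Bd \<in> sets borel" "emeasure lborel Bd \<le> ennreal (?c / 2)"
            "\<And>t v. 0 < t \<Longrightarrow> 1 < norm v \<Longrightarrow> norm v < 2 \<Longrightarrow> x + t *\<^sub>R v \<in> E \<Longrightarrow> v \<in> Bd"
            using bspec[OF Bad x\<Omega>] by blast
          have "?v x \<le> ennreal (2 * \<tau>) + ennreal Cp * (\<integral>\<^sup>+y. f y * ?k x y \<partial>lborel)"
          proof (rule Cp(2)[OF \<Omega> G uc ub f _ _ \<tau>(1) Bd(1,2)])
            show "AE y in lebesgue. y \<in> \<Omega> \<longrightarrow> ennreal (norm (G y)) \<le> f y"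
              using Gf by eventually_elim auto
            show "\<forall>t v. 0 < t \<longrightarrow> 1 < norm v \<longrightarrow> norm v < 2 \<longrightarrow> x + t *\<^sub>R v \<in> frontier \<Omega> \<longrightarrow> v \<notin> Bd \<longrightarrow>
                norm (u (x + t *\<^sub>R v)) \<le> \<tau>"
              using Bd(3) unfolding E_def by (metis (mono_tags, lifting) mem_Collect_eq not_le)
          qed (use x\<Omega> in auto)
          also have "(\<integral>\<^sup>+y. f y * ?k x y \<partial>lborel) = (\<integral>\<^sup>+y. min (f y) t * ?k x y + (f y - t) * ?k x y \<partial>lborel)"
          proof (rule nn_integral_cong)
            fix y
            have "f y = min (f y) t + (f y - t)"
            proof (cases "f y \<le> t")
              case True
              then have "f y - t = 0" using t by (intro diff_eq_0_ennreal) (auto simp: less_top intro: order_le_less_trans)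
              then show ?thesis using True by simp
            next
              case False
              then have "t + (f y - t) = f y" by (intro add_diff_inverse_ennreal) simp
              moreover have "min (f y) t = t" using False by simp
              ultimately show ?thesis by (simp only:)
            qed
            then show "f y * ?k x y = min (f y) t * ?k x y + (f y - t) * ?k x y"
              by (metis distrib_right)
          qed
          also have "\<dots> = (\<integral>\<^sup>+y. min (f y) t * ?k x y \<partial>lborel) + h x"
            unfolding h_def by (rule nn_integral_add) measurable
          also have "ennreal (2 * \<tau>) + ennreal Cp * \<dots> \<le> \<Lambda>"
            unfolding \<Lambda>_def m_def F by (intro add_left_mono mult_left_mono add_mono hx Ct(2) f) simp
          also have "\<Lambda> < ?v x" using x(1) by simp
          finally show False by (simp only: less_irrefl)
        qed
        then have "emeasure \<mu> {x \<in> space \<mu>. \<Lambda> < ?v x} \<le> emeasure \<mu> (B \<union> {x \<in> space \<mu>. ennreal c < h x})"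
          using B(1) hm by (intro emeasure_mono) auto
        also note small
        also have "ennreal (s / 2) + ennreal (s / 2) = ennreal s"
          using s by (simp add: ennreal_plus[symmetric] del: ennreal_plus)
        finally have "?L \<le> \<Lambda>" unfolding decreasing_rearrangement_def by (intro Inf_lower) simp
        also have "\<Lambda> = X + ennreal \<delta>"
        proof -
          have "c = C3 * 2 powr \<theta> * p * J + C3 * 2 powr \<theta> * p * d" by (simp add: c_def algebra_simps)
          then have 1: "ennreal c = ennreal (C3 * 2 powr \<theta> * p) * ennreal J + ennreal (C3 * 2 powr \<theta> * p * d)"
            using C3 p J d by (simp add: ennreal_mult ennreal_plus)
          have "Cp * (C3 * 2 powr \<theta> * p * d) = \<delta>" using Cp(1) C3 p by (simp add: d_def)
          then have 2: "ennreal Cp * ennreal (C3 * 2 powr \<theta> * p * d) = ennreal \<delta>"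
            using Cp(1) by (simp flip: ennreal_mult')
          show ?thesis unfolding \<Lambda>_def X_def 1 2[symmetric] by (simp only: distrib_left add.assoc)
        qed
        finally show ?thesis .
      qed
      have "?L \<le> X" by (rule ennreal_le_epsilon) (rule weak)
      also have "X \<le> ennreal C * (ennreal p * A1 + A2 + ennreal p * A3)"
      proof -
        have 1: "ennreal (2 * \<tau>) \<le> ennreal (2 / \<kappa>) * (ennreal p * A3)"
        proof -
          have "2 * \<tau> = 2 / \<kappa> * (p * (\<tau> * b))"
          proof -
            have "p * b = \<kappa>" using s by (simp add: p_def b_def powr_minus)
            then have "2 / \<kappa> * (p * (\<tau> * b)) = 2 / \<kappa> * (\<tau> * \<kappa>)" by (metis mult.left_commute)
            then show ?thesis using \<kappa> by simp
          qed
          then have "ennreal (2 * \<tau>) = ennreal (2 / \<kappa>) * (ennreal p * (g b * ennreal b))"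
            using \<kappa> p \<tau> b by (simp add: ennreal_mult[symmetric])
          also have "\<dots> \<le> ennreal (2 / \<kappa>) * (ennreal p * A3)" by (intro mult_left_mono gb) auto
          finally show ?thesis .
        qed
        have 2: "m \<le> ennreal ?n * (ennreal p * A1) + A2"
        proof -
          have "?n \<ge> 2" using n by simp
          from nn_integral_truncated_rearrangement_le[OF this a, of lborel f]
          have "m \<le> ennreal (?n * a powr (- (?\<beta> / ?n))) * A1 + A2"
            unfolding m_def t_def A1_def A2_def F .
          \<comment> \<open>The weights agree because a = s^(n/\<alpha>) turns the exponent -(n-1)/n
            into -(n-1)/\<alpha>.\<close>
          also have "a powr (- (?\<beta> / ?n)) = p"
          proof -
            have "N / A * (- (b / N)) = - (b / A)" if "N \<noteq> 0" for N A b :: real using that by simp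
            from this[of ?n \<alpha> ?\<beta>] show ?thesis
              unfolding a_def p_def powr_powr \<theta>_def using n(1) by simp
          qed
          also have "ennreal (?n * p) = ennreal ?n * ennreal p" by (rule ennreal_mult') simp
          finally show ?thesis by (simp only: mult.assoc)
        qed
        let ?a = "ennreal p * A1" and ?b = "ennreal p * A3"
        have "X \<le> ennreal (2 / \<kappa>) * ?b + ennreal Cp * (ennreal Ct * (ennreal ?n * ?a + A2) + ennreal (C3 * 2 powr \<theta>) * ?a)"
        proof -
          have "ennreal (C3 * 2 powr \<theta> * p) * ennreal J = ennreal (C3 * 2 powr \<theta>) * ?a"
            using p by (simp add: J ennreal_mult'' mult.assoc)
          then show ?thesis
            unfolding X_def by (intro add_mono 1 mult_left_mono 2) auto
        qed
        also have "\<dots> = ennreal (2 / \<kappa>) * ?b + (ennreal (Cp * Ct * ?n + Cp * C3 * 2 powr \<theta>) * ?a + ennreal (Cp * Ct) * A2)"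
          using Cp(1) Ct(1) C3 by (simp add: ennreal_mult ennreal_plus distrib_left distrib_right mult.assoc add_ac)
        also have "\<dots> \<le> ennreal C * ?b + (ennreal C * ?a + ennreal C * A2)"
          using Cp(1) Ct(1) C3 \<kappa>(1)
          by (intro add_mono mult_right_mono ennreal_leI) (auto simp: C_def algebra_simps)
        also have "\<dots> = ennreal C * (?a + A2 + ?b)" by (simp add: distrib_left add_ac)
        finally show ?thesis .
      qed
      finally show ?thesis .
    qed
    then show ?thesis by (simp only: A1_def A2_def A3_def F_def g_def p_def a_def \<theta>_def)
  qed
  with C show ?thesis by blast
qed

section \<open>Rearrangement-invariant norms\<close>

lemma banach_function_normD:
  assumes "banach_function_norm M \<rho>"
  shows "f \<in> borel_measurable M \<Longrightarrow> \<rho> f = 0 \<longleftrightarrow> (AE x in M. f x = 0)"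
    and "f \<in> borel_measurable M \<Longrightarrow> c \<ge> 0 \<Longrightarrow> \<rho> (\<lambda>x. ennreal c * f x) = ennreal c * \<rho> f"
    and "f \<in> borel_measurable M \<Longrightarrow> g \<in> borel_measurable M \<Longrightarrow> \<rho> (\<lambda>x. f x + g x) \<le> \<rho> f + \<rho> g"
    and "f \<in> borel_measurable M \<Longrightarrow> g \<in> borel_measurable M \<Longrightarrow> (\<And>x. x \<in> space M \<Longrightarrow> f x \<le> g x) \<Longrightarrow> \<rho> f \<le> \<rho> g"
    and "E \<in> sets M \<Longrightarrow> emeasure M E < \<infinity> \<Longrightarrow> \<rho> (indicator E) < \<infinity>"
  using assms unfolding banach_function_norm_def by (blast intro: AE_I2)+

lemma banach_function_norm_SUP:
  assumes "banach_function_norm M \<rho>" "\<And>i::nat. F i \<in> borel_measurable M" "f \<in> borel_measurable M"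
    and "\<And>x. x \<in> space M \<Longrightarrow> incseq (\<lambda>i. F i x)" "\<And>x. x \<in> space M \<Longrightarrow> f x = (SUP i. F i x)"
  shows "\<rho> f = (SUP i. \<rho> (F i))"
proof -
  have "AE x in M. incseq (\<lambda>i. F i x) \<and> f x = (SUP i. F i x)"
    using assms(4,5) by (intro AE_I2) auto
  with assms(1-3) show ?thesis unfolding banach_function_norm_def by blast
qed

lemma representation_normD:
  assumes "representation_norm M \<rho> \<rho>'"
  shows "banach_function_norm (lebesgue_on {0<..}) \<rho>'"
    and "f \<in> borel_measurable M \<Longrightarrow> \<rho> f < \<infinity> \<Longrightarrow> \<rho> f = \<rho>' (decreasing_rearrangement M f)"
  using assms unfolding representation_norm_def ri_norm_def by blast+

lemma SUP_min_of_nat: "(SUP k. min a (of_nat k)) = (a::ennreal)"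
proof -
  have "(SUP k. inf a (of_nat k)) = inf a (SUP k. of_nat k)" by (rule inf_SUP[symmetric])
  then have "(SUP k. inf a (of_nat k)) = a" by (simp only: ennreal_SUP_of_nat_eq_top inf_top_right)
  then show ?thesis by (simp only: inf_min)
qed

lemma incseq_min_of_nat: "incseq (\<lambda>k. min a (of_nat k :: ennreal))"
  by (rule incseq_SucI) (auto simp: min_def intro: order_trans)

lemma borel_measurable_lebesgue_on:
  "f \<in> borel_measurable borel \<Longrightarrow> f \<in> borel_measurable (lebesgue_on S)"
  by (intro measurable_restrict_space1 measurable_completion) simp

text \<open>The operator inequalities are only available for real-valued, hence bounded, functions.\<close>

lemma banach_function_norm_operator_le:
  fixes F :: "real \<Rightarrow> ennreal" and p :: "real \<Rightarrow> ennreal"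
  assumes Y: "banach_function_norm (lebesgue_on {0<..}) Y" and X: "banach_function_norm (lebesgue_on {0<..}) X"
    and F[measurable]: "F \<in> borel_measurable borel"
    and p[measurable]: "p \<in> borel_measurable borel"
    and W[measurable]: "(\<lambda>(s, r). W s r) \<in> borel_measurable (borel \<Otimes>\<^sub>M borel)"
    and le: "\<And>k::nat. Y (\<lambda>s. p s * (\<integral>\<^sup>+r. min (F r) (of_nat k) * W s r \<partial>lborel)) \<le>
      c * X (\<lambda>r. min (F r) (of_nat k))"
  shows "Y (\<lambda>s. p s * (\<integral>\<^sup>+r. F r * W s r \<partial>lborel)) \<le> c * X F"
proof -
  let ?T = "\<lambda>k s. p s * (\<integral>\<^sup>+r. min (F r) (of_nat k) * W s r \<partial>lborel)"
  have Wm[measurable]: "W s \<in> borel_measurable borel" for s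
    using measurable_compose[OF measurable_Pair1'[of s borel borel] W] by simp
  have inc: "incseq (\<lambda>k. min (F r) (of_nat k) * W s r)" for r s
    using incseq_min_of_nat[of "F r"] unfolding incseq_def by (auto intro: mult_right_mono)
  have "Y (\<lambda>s. p s * (\<integral>\<^sup>+r. F r * W s r \<partial>lborel)) = (SUP k. Y (?T k))"
  proof (rule banach_function_norm_SUP[OF Y])
    show "?T k \<in> borel_measurable (lebesgue_on {0<..})" for k
      by (rule borel_measurable_lebesgue_on) measurable
    show "(\<lambda>s. p s * (\<integral>\<^sup>+r. F r * W s r \<partial>lborel)) \<in> borel_measurable (lebesgue_on {0<..})"
      by (rule borel_measurable_lebesgue_on) measurable
    fix s
    show "incseq (\<lambda>k. ?T k s)"
      using inc unfolding incseq_def by (auto intro!: mult_left_mono nn_integral_mono)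
    have "(\<integral>\<^sup>+r. F r * W s r \<partial>lborel) = (\<integral>\<^sup>+r. (SUP k. min (F r) (of_nat k) * W s r) \<partial>lborel)"
      by (simp add: SUP_mult_right_ennreal[symmetric] SUP_min_of_nat)
    also have "\<dots> = (SUP k. \<integral>\<^sup>+r. min (F r) (of_nat k) * W s r \<partial>lborel)"
      using inc[of _ s] by (intro nn_integral_monotone_convergence_SUP) (auto simp: incseq_def le_fun_def)
    finally show "p s * (\<integral>\<^sup>+r. F r * W s r \<partial>lborel) = (SUP k. ?T k s)"
      by (simp add: SUP_mult_left_ennreal)
  qed
  also have "\<dots> \<le> c * X F"
  proof (rule SUP_least)
    fix k
    have "X (\<lambda>r. min (F r) (of_nat k)) \<le> X F"
      by (rule banach_function_normD(4)[OF X]) (auto intro!: borel_measurable_lebesgue_on)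
    then show "Y (?T k) \<le> c * X F"
      using le[of k] by (meson mult_left_mono order_trans zero_le)
  qed
  finally show ?thesis .
qed

lemma borel_measurable_initial_interval:
  "(\<lambda>(s, r). indicator {0..s powr e} r :: ennreal) \<in> borel_measurable (borel \<Otimes>\<^sub>M borel)" for e :: real
proof -
  have "{z \<in> space (borel \<Otimes>\<^sub>M borel :: (real \<times> real) measure). 0 \<le> snd z \<and> snd z \<le> fst z powr e} \<in> sets (borel \<Otimes>\<^sub>M borel)"
    by measurable
  from borel_measurable_indicator[OF this] show ?thesis
    by (rule measurable_cong[THEN iffD1, rotated]) (auto simp: indicator_def space_pair_measure)
qed

lemma borel_measurable_tail_interval:
  "(\<lambda>(s, r). ennreal (r powr e') * indicator {s powr e..} r) \<in> borel_measurable (borel \<Otimes>\<^sub>M borel)" for e e' :: real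
proof -
  have "{z \<in> space (borel \<Otimes>\<^sub>M borel :: (real \<times> real) measure). fst z powr e \<le> snd z} \<in> sets (borel \<Otimes>\<^sub>M borel)"
    by measurable
  from borel_measurable_indicator[OF this]
  have "(\<lambda>z. ennreal (snd z powr e') * indicator {z \<in> space (borel \<Otimes>\<^sub>M borel). fst z powr e \<le> snd z} z)
      \<in> borel_measurable (borel \<Otimes>\<^sub>M borel)"
    by measurable
  then show ?thesis
    by (rule measurable_cong[THEN iffD1, rotated]) (auto simp: indicator_def space_pair_measure)
qed

lemma borel_measurable_operators:
  fixes F :: "real \<Rightarrow> ennreal" and d e :: real
  assumes [measurable]: "F \<in> borel_measurable borel"
  shows "(\<lambda>s. ennreal (s powr d) * (\<integral>\<^sup>+r\<in>{0..s powr e}. F r \<partial>lborel)) \<in> borel_measurable borel"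
    and "(\<lambda>s. \<integral>\<^sup>+r\<in>{s powr e..}. ennreal (r powr d) * F r \<partial>lborel) \<in> borel_measurable borel"
proof -
  have *: "(\<lambda>s. \<integral>\<^sup>+r. F r * W s r \<partial>lborel) \<in> borel_measurable borel"
    if [measurable]: "(\<lambda>(s, r). W s r) \<in> borel_measurable (borel \<Otimes>\<^sub>M borel)" for W :: "real \<Rightarrow> real \<Rightarrow> ennreal"
    by measurable
  have "(\<lambda>s::real. ennreal (s powr d)) \<in> borel_measurable borel" by measurable
  from borel_measurable_times_ennreal[OF this *[OF borel_measurable_initial_interval]]
  show "(\<lambda>s. ennreal (s powr d) * (\<integral>\<^sup>+r\<in>{0..s powr e}. F r \<partial>lborel)) \<in> borel_measurable borel"
    .
  from *[OF borel_measurable_tail_interval]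
  show "(\<lambda>s. \<integral>\<^sup>+r\<in>{s powr e..}. ennreal (r powr d) * F r \<partial>lborel) \<in> borel_measurable borel"
    by (simp only: mult.assoc mult.left_commute[of "F _"])
qed

text \<open>A rearrangement may take infinite values, whereas the hypotheses speak of real-valued
  functions. The truncations of F at k are real-valued and still non-increasing, and the Fatou
  property lets k grow.\<close>

lemma hardy_operators_le:
  fixes n \<alpha> C :: real
  assumes Y: "banach_function_norm (lebesgue_on {0<..}) Y"
    and X: "banach_function_norm (lebesgue_on {0<..}) X" and Z: "banach_function_norm (lebesgue_on {0<..}) Z"
    and F: "\<And>r r'. r \<le> r' \<Longrightarrow> F r' \<le> F r" "F \<in> borel_measurable borel"
    and hyp: "\<forall>\<phi> :: real \<Rightarrow> real. antimono_on {0..} \<phi> \<and> (\<forall>r\<ge>0. \<phi> r \<ge> 0) \<longrightarrow>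
        Y (\<lambda>s. ennreal (s powr (- ((n - 1) / \<alpha>))) *
                 (\<integral>\<^sup>+r\<in>{0..s powr (n / \<alpha>)}. ennreal (\<phi> r) \<partial>lborel))
          \<le> ennreal C * X (\<lambda>r. ennreal (\<phi> r)) \<and>
        Y (\<lambda>s. \<integral>\<^sup>+r\<in>{s powr (n / \<alpha>)..}.
                   ennreal (r powr (- ((n - 1) / n)) * \<phi> r) \<partial>lborel)
          \<le> ennreal C * X (\<lambda>r. ennreal (\<phi> r)) \<and>
        Y (\<lambda>s. ennreal (s powr (- ((n - 1) / \<alpha>))) *
                 (\<integral>\<^sup>+r\<in>{0..s powr ((n - 1) / \<alpha>)}. ennreal (\<phi> r) \<partial>lborel))
          \<le> ennreal C * Z (\<lambda>r. ennreal (\<phi> r))"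
  shows "Y (\<lambda>s. ennreal (s powr (- ((n - 1) / \<alpha>))) * (\<integral>\<^sup>+r\<in>{0..s powr (n / \<alpha>)}. F r \<partial>lborel)) \<le> ennreal C * X F"
    and "Y (\<lambda>s. \<integral>\<^sup>+r\<in>{s powr (n / \<alpha>)..}. ennreal (r powr (- ((n - 1) / n))) * F r \<partial>lborel) \<le> ennreal C * X F"
    and "Y (\<lambda>s. ennreal (s powr (- ((n - 1) / \<alpha>))) * (\<integral>\<^sup>+r\<in>{0..s powr ((n - 1) / \<alpha>)}. F r \<partial>lborel)) \<le> ennreal C * Z F"
proof -
  define \<phi> where "\<phi> k r = enn2real (min (F r) (of_nat k))" for k :: nat and r
  have fin: "min (F r) (of_nat k) < top" for k :: nat and r
    by (rule order_le_less_trans[OF min.cobounded2]) (simp add: of_nat_less_top)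
  have \<phi>: "ennreal (\<phi> k r) = min (F r) (of_nat k)" for k r
    unfolding \<phi>_def by (rule ennreal_enn2real[OF fin])
  have "antimono_on {0..} (\<phi> k) \<and> (\<forall>r\<ge>0. \<phi> k r \<ge> 0)" for k
  proof (intro conjI monotone_onI allI impI)
    fix r r' :: real assume "r \<le> r'"
    then have "min (F r') (of_nat k) \<le> min (F r) (of_nat k)" using F(1) by (intro min.mono) auto
    then show "\<phi> k r' \<le> \<phi> k r" unfolding \<phi>_def using fin by (intro enn2real_mono)
  qed (simp add: \<phi>_def)
  note h = hyp[rule_format, OF this]
  note h1 = h[THEN conjunct1] and h2 = h[THEN conjunct2, THEN conjunct1] and h3 = h[THEN conjunct2, THEN conjunct2]
  have \<phi>0: "\<phi> k r \<ge> 0" for k r by (simp add: \<phi>_def)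
  have "Y (\<lambda>s. ennreal (s powr (- ((n - 1) / \<alpha>))) * (\<integral>\<^sup>+r. F r * indicator {0..s powr (n / \<alpha>)} r \<partial>lborel)) \<le> ennreal C * X F"
    by (rule banach_function_norm_operator_le[OF Y X F(2), of _ "\<lambda>s r. indicator {0..s powr (n / \<alpha>)} r"])
      (use h1 borel_measurable_initial_interval in \<open>auto simp: \<phi>\<close>)
  then show "Y (\<lambda>s. ennreal (s powr (- ((n - 1) / \<alpha>))) * (\<integral>\<^sup>+r\<in>{0..s powr (n / \<alpha>)}. F r \<partial>lborel)) \<le> ennreal C * X F" .
  have "Y (\<lambda>s. ennreal (s powr (- ((n - 1) / \<alpha>))) * (\<integral>\<^sup>+r. F r * indicator {0..s powr ((n - 1) / \<alpha>)} r \<partial>lborel)) \<le> ennreal C * Z F"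
    by (rule banach_function_norm_operator_le[OF Y Z F(2), of _ "\<lambda>s r. indicator {0..s powr ((n - 1) / \<alpha>)} r"])
      (use h3 borel_measurable_initial_interval in \<open>auto simp: \<phi>\<close>)
  then show "Y (\<lambda>s. ennreal (s powr (- ((n - 1) / \<alpha>))) * (\<integral>\<^sup>+r\<in>{0..s powr ((n - 1) / \<alpha>)}. F r \<partial>lborel)) \<le> ennreal C * Z F" .
  have eq: "ennreal (r powr (- ((n - 1) / n)) * \<phi> k r) = min (F r) (of_nat k) * ennreal (r powr (- ((n - 1) / n)))" for r k
    using \<phi>0 by (simp add: ennreal_mult \<phi> mult.commute)
  have "Y (\<lambda>s. 1 * (\<integral>\<^sup>+r. F r * (ennreal (r powr (- ((n - 1) / n))) * indicator {s powr (n / \<alpha>)..} r) \<partial>lborel)) \<le> ennreal C * X F"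
    by (rule banach_function_norm_operator_le[OF Y X F(2), of _ "\<lambda>s r. ennreal (r powr (- ((n - 1) / n))) * indicator {s powr (n / \<alpha>)..} r"])
      (use h2 borel_measurable_tail_interval in \<open>auto simp: \<phi> eq mult.assoc\<close>)
  then show "Y (\<lambda>s. \<integral>\<^sup>+r\<in>{s powr (n / \<alpha>)..}. ennreal (r powr (- ((n - 1) / n))) * F r \<partial>lborel) \<le> ennreal C * X F"
    by (simp add: mult_ac)
qed

section \<open>From rearrangements back to norms\<close>

lemma decreasing_rearrangement_mono:
  assumes "g \<in> borel_measurable M" "\<And>x. x \<in> space M \<Longrightarrow> f x \<le> g x"
  shows "decreasing_rearrangement M f s \<le> decreasing_rearrangement M g s"
  unfolding decreasing_rearrangement_def
proof (rule Inf_superset_mono, rule subsetI)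
  fix t assume t: "t \<in> {t. emeasure M {x \<in> space M. t < g x} \<le> ennreal s}"
  have "emeasure M {x \<in> space M. t < f x} \<le> emeasure M {x \<in> space M. t < g x}"
    using assms by (intro emeasure_mono) (auto intro: order_less_le_trans)
  with t show "t \<in> {t. emeasure M {x \<in> space M. t < f x} \<le> ennreal s}" by auto
qed

text \<open>A representation norm computes the norm only of functions in the space; membership is
  deduced here by exhausting the function by bounded functions supported on sets of finite measure.\<close>

lemma norm_le_of_rearrangement_le:
  fixes v :: "real^'n \<Rightarrow> real"
  assumes reg: "upper_regular \<alpha> K \<Omega> \<mu>" and Y: "banach_function_norm \<mu> Y"
    and rep: "representation_norm \<mu> Y Yr"
    and v: "(\<lambda>x. ennreal (v x)) \<in> borel_measurable \<mu>"
    and R: "R \<in> borel_measurable borel"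
    and le: "\<And>s. s > 0 \<Longrightarrow> decreasing_rearrangement \<mu> (\<lambda>x. ennreal (v x)) s \<le> R s"
  shows "Y (\<lambda>x. ennreal (v x)) \<le> Yr R"
proof (cases "\<Omega> = {}")
  case True
  then have "Y (\<lambda>x. ennreal (v x)) = 0"
    using v upper_regular_sets(1)[OF reg] by (subst banach_function_normD(1)[OF Y]) (auto intro!: AE_I2)
  then show ?thesis by simp
next
  case False
  then obtain q where q: "q \<in> \<Omega>" by auto
  note sp = upper_regular_sets(1)[OF reg]
  define A where "A k = ball q (real (Suc k)) \<inter> \<Omega>" for k
  have A[measurable]: "A k \<in> sets \<mu>" for k unfolding A_def by (rule upper_regular_sets(3)[OF reg]) simp
  have Afin: "emeasure \<mu> (A k) < \<infinity>" for k
  proof -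
    have "emeasure \<mu> (A k) \<le> ennreal (K * real (Suc k) powr \<alpha>)"
      using reg q unfolding upper_regular_def A_def by simp
    also have "\<dots> < \<infinity>" by simp
    finally show ?thesis .
  qed
  have Yr: "banach_function_norm (lebesgue_on {0<..}) Yr"
    by (rule representation_normD(1)[OF rep])
  define V where "V k x = min (ennreal (v x)) (of_nat k) * indicator (A k) x" for k x
  have Vm: "V k \<in> borel_measurable \<mu>" for k
    unfolding V_def using v by measurable
  have Vle: "V k x \<le> ennreal (v x)" for k x
    by (auto simp: V_def indicator_def)
  have "Y (\<lambda>x. ennreal (v x)) = (SUP k. Y (V k))"
  proof (rule banach_function_norm_SUP[OF Y Vm v])
    fix x assume x: "x \<in> space \<mu>"
    show "incseq (\<lambda>k. V k x)"
    proof (rule incseq_SucI)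
      fix k
      have "min (ennreal (v x)) (of_nat k) \<le> min (ennreal (v x)) (of_nat (Suc k))"
        using incseq_SucD[OF incseq_min_of_nat[of "ennreal (v x)"]] .
      moreover have "indicator (A k) x \<le> (indicator (A (Suc k)) x :: ennreal)"
        by (auto simp: A_def indicator_def)
      ultimately show "V k x \<le> V (Suc k) x" unfolding V_def by (intro mult_mono) auto
    qed
    show "ennreal (v x) = (SUP k. V k x)"
    proof (rule antisym)
      obtain k :: nat where k: "max (v x) (dist q x) < real k" using reals_Archimedean2 by blast
      have "ennreal (v x) \<le> of_nat k"
        using k by (simp add: ennreal_of_nat_eq_real_of_nat ennreal_leI)
      moreover have "x \<in> A k" using k x sp by (auto simp: A_def)
      ultimately have "ennreal (v x) = V k x" by (simp add: V_def min_absorb1)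
      also have "\<dots> \<le> (SUP k. V k x)" by (rule SUP_upper) simp
      finally show "ennreal (v x) \<le> (SUP k. V k x)" .
    qed (intro SUP_least Vle)
  qed
  also have "\<dots> \<le> Yr R"
  proof (rule SUP_least)
    fix k
    have "Y (V k) \<le> Y (\<lambda>x. ennreal (real k) * indicator (A k) x)"
      by (rule banach_function_normD(4)[OF Y Vm])
        (auto simp: V_def ennreal_of_nat_eq_real_of_nat intro!: mult_right_mono)
    also have "\<dots> = ennreal (real k) * Y (indicator (A k))"
      by (rule banach_function_normD(2)[OF Y]) auto
    also have "\<dots> < \<infinity>"
      using banach_function_normD(5)[OF Y A Afin, of k] by (simp add: ennreal_mult_less_top)
    finally have "Y (V k) = Yr (decreasing_rearrangement \<mu> (V k))"
      by (rule representation_normD(2)[OF rep Vm])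
    also have "\<dots> \<le> Yr R"
    proof (rule banach_function_normD(4)[OF Yr])
      fix s :: real assume "s \<in> space (lebesgue_on {0<..})"
      then have "s > 0" by (simp add: space_restrict_space)
      then show "decreasing_rearrangement \<mu> (V k) s \<le> R s"
        by (intro order_trans[OF decreasing_rearrangement_mono[OF v Vle] le])
    qed (auto intro: borel_measurable_lebesgue_on R)
    finally show "Y (V k) \<le> Yr R" .
  qed
  finally show ?thesis .
qed

theorem theorem3p2:
  fixes n :: nat and \<alpha> C\<^sub>\<mu> C :: real
  assumes "n = CARD('n::finite)" and "n \<ge> 2"
    and "real n - 1 < \<alpha>" and "\<alpha> \<le> real n" and "C\<^sub>\<mu> > 0"
  shows "\<exists>C'>0::real.
    \<forall>(\<Omega> :: (real^'n) set) (\<mu> :: (real^'n) measure)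
      (X :: (real^'n \<Rightarrow> ennreal) \<Rightarrow> ennreal) (Y :: (real^'n \<Rightarrow> ennreal) \<Rightarrow> ennreal)
      (Z :: (real^'n \<Rightarrow> ennreal) \<Rightarrow> ennreal)
      (Xr :: (real \<Rightarrow> ennreal) \<Rightarrow> ennreal) (Yr :: (real \<Rightarrow> ennreal) \<Rightarrow> ennreal)
      (Zr :: (real \<Rightarrow> ennreal) \<Rightarrow> ennreal).
      open \<Omega> \<longrightarrow>
      sets \<mu> = sets (restrict_space borel \<Omega>) \<longrightarrow>
      (\<forall>x\<in>\<Omega>. \<forall>r>0. emeasure \<mu> (ball x r \<inter> \<Omega>) \<le> ennreal (C\<^sub>\<mu> * r powr \<alpha>)) \<longrightarrow>
      ri_norm (lebesgue_on \<Omega>) X \<longrightarrow> representation_norm (lebesgue_on \<Omega>) X Xr \<longrightarrow>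
      ri_norm \<mu> Y \<longrightarrow> representation_norm \<mu> Y Yr \<longrightarrow>
      ri_norm (restrict_space (hausdorff_measure (n - 1)) (frontier \<Omega>)) Z \<longrightarrow>
      representation_norm (restrict_space (hausdorff_measure (n - 1)) (frontier \<Omega>)) Z Zr \<longrightarrow>
      (\<forall>\<phi> :: real \<Rightarrow> real. antimono_on {0..} \<phi> \<and> (\<forall>r\<ge>0. \<phi> r \<ge> 0) \<longrightarrow>
        Yr (\<lambda>s. ennreal (s powr (- ((real n - 1) / \<alpha>))) *
                 (\<integral>\<^sup>+r\<in>{0..s powr (real n / \<alpha>)}. ennreal (\<phi> r) \<partial>lborel))
          \<le> ennreal C * Xr (\<lambda>r. ennreal (\<phi> r)) \<and>
        Yr (\<lambda>s. \<integral>\<^sup>+r\<in>{s powr (real n / \<alpha>)..}.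
                   ennreal (r powr (- ((real n - 1) / real n)) * \<phi> r) \<partial>lborel)
          \<le> ennreal C * Xr (\<lambda>r. ennreal (\<phi> r)) \<and>
        Yr (\<lambda>s. ennreal (s powr (- ((real n - 1) / \<alpha>))) *
                 (\<integral>\<^sup>+r\<in>{0..s powr ((real n - 1) / \<alpha>)}. ennreal (\<phi> r) \<partial>lborel))
          \<le> ennreal C * Zr (\<lambda>r. ennreal (\<phi> r))) \<longrightarrow>
      (\<forall>u \<in> E1 \<Omega> X \<inter> Cb_closure \<Omega>.
        Y (\<lambda>x. ennreal (norm (u x)))
          \<le> ennreal C' * (X (\<lambda>x. ennreal (norm (sym_grad \<Omega> u x))) +
                           Z (\<lambda>x. ennreal (norm (u x)))))"
proof -
  have n: "CARD('n) \<ge> 2" "real CARD('n) - 1 < \<alpha>" using assms by auto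
  obtain A where A: "A > 0" and est: "\<forall>(\<Omega> :: (real^'n) set) \<mu> (u :: real^'n \<Rightarrow> real^'n) G. \<forall>s>0.
    upper_regular \<alpha> C\<^sub>\<mu> \<Omega> \<mu> \<longrightarrow> has_sym_grad \<Omega> u G \<longrightarrow> u \<in> Cb_closure \<Omega> \<longrightarrow>
    decreasing_rearrangement \<mu> (\<lambda>x. ennreal (norm (u x))) s \<le> ennreal A *
      (ennreal (s powr (- ((real n - 1) / \<alpha>))) *
        (\<integral>\<^sup>+r\<in>{0..s powr (real n / \<alpha>)}.
          decreasing_rearrangement (lebesgue_on \<Omega>) (\<lambda>x. ennreal (norm (G x))) r \<partial>lborel) +
       (\<integral>\<^sup>+r\<in>{s powr (real n / \<alpha>)..}. ennreal (r powr (- ((real n - 1) / real n))) *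
          decreasing_rearrangement (lebesgue_on \<Omega>) (\<lambda>x. ennreal (norm (G x))) r \<partial>lborel) +
       ennreal (s powr (- ((real n - 1) / \<alpha>))) *
        (\<integral>\<^sup>+r\<in>{0..s powr ((real n - 1) / \<alpha>)}.
          decreasing_rearrangement (restrict_space (hausdorff_measure (n - 1)) (frontier \<Omega>))
            (\<lambda>x. ennreal (norm (u x))) r \<partial>lborel))"
    using rearrangement_estimate[OF n \<open>C\<^sub>\<mu> > 0\<close>] unfolding assms(1) by blast
  show ?thesis
  \<comment> \<open>The factor 2 counts the two operators acting on X; the Z term is doubled too so
    that both share one constant. The sign of C is arbitrary, hence the absolute value, and the
    added 1 keeps the constant positive even for C = 0.\<close>
  proof (intro exI[of _ "2 * A * \<bar>C\<bar> + 1"] conjI allI impI ballI)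
    show "2 * A * \<bar>C\<bar> + 1 > 0" using A by (intro add_nonneg_pos) auto
    fix \<Omega> :: "(real^'n) set" and \<mu> :: "(real^'n) measure"
      and X Y Z :: "(real^'n \<Rightarrow> ennreal) \<Rightarrow> ennreal" and Xr Yr Zr :: "(real \<Rightarrow> ennreal) \<Rightarrow> ennreal" and u
    let ?H = "restrict_space (hausdorff_measure (n - 1)) (frontier \<Omega>) :: (real^'n) measure"
    assume \<Omega>: "open \<Omega>" and sets: "sets \<mu> = sets (restrict_space borel \<Omega>)"
      and growth: "\<forall>x\<in>\<Omega>. \<forall>r>0. emeasure \<mu> (ball x r \<inter> \<Omega>) \<le> ennreal (C\<^sub>\<mu> * r powr \<alpha>)"
      and X: "representation_norm (lebesgue_on \<Omega>) X Xr"
      and Y: "ri_norm \<mu> Y" "representation_norm \<mu> Y Yr"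
      and Z: "representation_norm ?H Z Zr"
      and hyp: "\<forall>\<phi> :: real \<Rightarrow> real. antimono_on {0..} \<phi> \<and> (\<forall>r\<ge>0. \<phi> r \<ge> 0) \<longrightarrow>
        Yr (\<lambda>s. ennreal (s powr (- ((real n - 1) / \<alpha>))) *
                 (\<integral>\<^sup>+r\<in>{0..s powr (real n / \<alpha>)}. ennreal (\<phi> r) \<partial>lborel))
          \<le> ennreal C * Xr (\<lambda>r. ennreal (\<phi> r)) \<and>
        Yr (\<lambda>s. \<integral>\<^sup>+r\<in>{s powr (real n / \<alpha>)..}.
                   ennreal (r powr (- ((real n - 1) / real n)) * \<phi> r) \<partial>lborel)
          \<le> ennreal C * Xr (\<lambda>r. ennreal (\<phi> r)) \<and>
        Yr (\<lambda>s. ennreal (s powr (- ((real n - 1) / \<alpha>))) *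
                 (\<integral>\<^sup>+r\<in>{0..s powr ((real n - 1) / \<alpha>)}. ennreal (\<phi> r) \<partial>lborel))
          \<le> ennreal C * Zr (\<lambda>r. ennreal (\<phi> r))"
      and u: "u \<in> E1 \<Omega> X \<inter> Cb_closure \<Omega>"
    have reg: "upper_regular \<alpha> C\<^sub>\<mu> \<Omega> \<mu>" using \<Omega> sets growth by (simp add: upper_regular_def)
    let ?v = "\<lambda>x. ennreal (norm (u x))" and ?G = "sym_grad \<Omega> u"
    \<comment> \<open>\<open>sym_grad\<close> is a choice; it is a symmetric gradient because
      membership in \<open>E1\<close> provides one.\<close>
    have G: "has_sym_grad \<Omega> u ?G"
    proof -
      from u obtain G where "has_sym_grad \<Omega> u G" by (auto simp: E1_def)
      then show ?thesis unfolding sym_grad_def by (rule someI[of "has_sym_grad \<Omega> u"])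
    qed
    have bX: "banach_function_norm (lebesgue_on {0<..}) Xr" and bY: "banach_function_norm (lebesgue_on {0<..}) Yr"
      and bZ: "banach_function_norm (lebesgue_on {0<..}) Zr"
      by (rule representation_normD(1)[OF X], rule representation_normD(1)[OF Y(2)], rule representation_normD(1)[OF Z])
    have uc: "continuous_on (closure \<Omega>) u" using u by (simp add: Cb_closure_def)
    define F where "F = decreasing_rearrangement (lebesgue_on \<Omega>) (\<lambda>x. ennreal (norm (?G x)))"
    define g where "g = decreasing_rearrangement ?H ?v"
    have XF: "X (\<lambda>x. ennreal (norm (?G x))) = Xr F"
    proof -
      have "(\<lambda>x. ennreal (norm (?G x))) \<in> borel_measurable (lebesgue_on \<Omega>)"
        using G by (intro modulus_representative(1) \<Omega>) (simp add: has_sym_grad_def)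
      moreover have "X (\<lambda>x. ennreal (norm (?G x))) < \<infinity>" using u by (simp add: E1_def)
      ultimately show ?thesis unfolding F_def by (rule representation_normD(2)[OF X])
    qed
    show "Y ?v \<le> ennreal (2 * A * \<bar>C\<bar> + 1) * (X (\<lambda>x. ennreal (norm (?G x))) + Z ?v)"
    \<comment> \<open>A representation norm gives the value of a norm only when it is finite. For
      the symmetric gradient finiteness is part of \<open>E1\<close>; for the boundary values the
      infinite case is trivial and is treated apart.\<close>
    proof (cases "Z ?v = \<infinity>")
      case True
      have "0 < 2 * A * \<bar>C\<bar> + 1" using A by (intro add_nonneg_pos) auto
      then show ?thesis unfolding True by (simp add: ennreal_mult_top)
    next
      case False
      have Zg: "Z ?v = Zr g"
        unfolding g_def using False
        by (intro representation_normD(2)[OF Z] boundary_level_set(1)[OF \<Omega> uc]) (simp add: less_top)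
      define T1 where "T1 s = ennreal (s powr (- ((real n - 1) / \<alpha>))) * (\<integral>\<^sup>+r\<in>{0..s powr (real n / \<alpha>)}. F r \<partial>lborel)" for s
      define T2 where "T2 s = (\<integral>\<^sup>+r\<in>{s powr (real n / \<alpha>)..}. ennreal (r powr (- ((real n - 1) / real n))) * F r \<partial>lborel)" for s
      define T3 where "T3 s = ennreal (s powr (- ((real n - 1) / \<alpha>))) * (\<integral>\<^sup>+r\<in>{0..s powr ((real n - 1) / \<alpha>)}. g r \<partial>lborel)" for s
      have Fm[measurable]: "F \<in> borel_measurable borel" and gm[measurable]: "g \<in> borel_measurable borel"
        by (simp_all add: F_def g_def)
      have T: "T1 \<in> borel_measurable borel" "T2 \<in> borel_measurable borel" "T3 \<in> borel_measurable borel"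
        unfolding T1_def T2_def T3_def by (intro borel_measurable_operators Fm gm)+
      note T[measurable]
      note ops = hardy_operators_le[OF bY bX bZ _ _ hyp]
      have T1: "Yr T1 \<le> ennreal C * Xr F" and T2: "Yr T2 \<le> ennreal C * Xr F"
        using ops(1,2)[of F] decreasing_rearrangement_antimono[of _ _ "lebesgue_on \<Omega>"] Fm
        by (simp_all add: T1_def[abs_def] T2_def[abs_def] F_def)
      have T3: "Yr T3 \<le> ennreal C * Zr g"
        using ops(3)[of g] decreasing_rearrangement_antimono[of _ _ ?H] gm
        by (simp add: T3_def[abs_def] g_def)
      have "Y ?v \<le> Yr (\<lambda>s. ennreal A * (T1 s + T2 s + T3 s))"
      proof (rule norm_le_of_rearrangement_le[OF reg _ Y(2)])
        show "banach_function_norm \<mu> Y" using Y(1) by (simp add: ri_norm_def)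
        have "(\<lambda>x. ennreal (norm (u x))) \<in> borel_measurable (restrict_space borel \<Omega>)"
          using continuous_on_subset[OF uc closure_subset]
          by (intro measurable_compose[OF borel_measurable_continuous_on_restrict measurable_ennreal] continuous_intros)
        then show "?v \<in> borel_measurable \<mu>" unfolding measurable_cong_sets[OF sets refl] .
        show "decreasing_rearrangement \<mu> ?v s \<le> ennreal A * (T1 s + T2 s + T3 s)" if "s > 0" for s
          using est that reg G u unfolding T1_def T2_def T3_def F_def g_def by blast
      qed measurable
      also have "\<dots> = ennreal A * Yr (\<lambda>s. T1 s + T2 s + T3 s)"
        using A by (intro banach_function_normD(2)[OF bY] borel_measurable_lebesgue_on) auto
      also have "\<dots> \<le> ennreal A * (Yr T1 + Yr T2 + Yr T3)"
      proof (rule mult_left_mono)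
        have "Yr (\<lambda>s. T1 s + T2 s + T3 s) \<le> Yr (\<lambda>s. T1 s + T2 s) + Yr T3"
          by (intro banach_function_normD(3)[OF bY] borel_measurable_lebesgue_on) auto
        also have "\<dots> \<le> Yr T1 + Yr T2 + Yr T3"
          by (intro add_right_mono banach_function_normD(3)[OF bY] borel_measurable_lebesgue_on T)
        finally show "Yr (\<lambda>s. T1 s + T2 s + T3 s) \<le> Yr T1 + Yr T2 + Yr T3" .
      qed simp
      also have "\<dots> \<le> ennreal A * (ennreal \<bar>C\<bar> * Xr F + ennreal \<bar>C\<bar> * Xr F + (ennreal \<bar>C\<bar> * Zr g + ennreal \<bar>C\<bar> * Zr g))"
      proof (rule mult_left_mono)
        have C: "ennreal C * x \<le> ennreal \<bar>C\<bar> * x" for x by (intro mult_right_mono ennreal_leI) auto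
        show "Yr T1 + Yr T2 + Yr T3 \<le> ennreal \<bar>C\<bar> * Xr F + ennreal \<bar>C\<bar> * Xr F + (ennreal \<bar>C\<bar> * Zr g + ennreal \<bar>C\<bar> * Zr g)"
          using order_trans[OF T1 C] order_trans[OF T2 C] order_trans[OF T3 C]
          by (intro add_mono add_increasing2) auto
      qed simp
      also have "\<dots> = ennreal (2 * A * \<bar>C\<bar>) * (Xr F + Zr g)"
      proof -
        have "ennreal (2 * A * \<bar>C\<bar>) = ennreal A * ennreal \<bar>C\<bar> + ennreal A * ennreal \<bar>C\<bar>"
          using A by (simp add: ennreal_mult[symmetric] ennreal_plus[symmetric] del: ennreal_plus)
        then show ?thesis by (simp add: distrib_left distrib_right mult.assoc add_ac)
      qed
      also have "\<dots> \<le> ennreal (2 * A * \<bar>C\<bar> + 1) * (Xr F + Zr g)"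
        by (intro mult_right_mono ennreal_leI) auto
      finally show ?thesis unfolding XF Zg .
    qed
  qed
qed

end
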